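(* Let $d,T\ge1$, let $\mu=\mathcal N(a,A)$ and $\nu=\mathcal N(b,B)$ be non-degenerate Gaussian measures on $\mathbb R^{dT}$ whose covariance matrices have Cholesky decompositions $A=LL^\top$ and $B=MM^\top$, and let $\lambda\ge0$. Then $$\mathcal{AW}_{2,\lambda}^2(\mu,\nu)=|a-b|^2+\operatorname{tr}(A+B)-2\operatorname{tr}(D_\lambda S)-\frac{\lambda}{2}\log\det(I-D_\lambda^2),$$ where $D_\lambda=f_\lambda(S)$ (element-wise) and $S=\operatorname{diag}(S_1,\dots,S_T)$, with $S_t\in\mathbb R^{d\times d}$ the diagonal matrix of singular values of the $d\times d$ block $(M^\top L)_{t,t}$. In particular, when $\lambda=0$, $f_\lambda$ is the sign function and the formula reduces to $$\mathcal{AW}_{2}^2(\mu,\nu)=|a-b|^2+\operatorname{tr}(A+B)-2\operatorname{tr}(S).$$ Moreover, $\lim_{\lambda\to0}\mathcal{AW}_{2,\lambda}^2(\mu,\nu)=\mathcal{AW}_2^2(\mu,\nu)$.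
   Context: $\mathbb R^{dT}$ is the space of $d$-dimensional paths $x=(x_1,\dots,x_T)$, $x_t\in\mathbb R^d$, with Euclidean norm $|\cdot|$. Write $x_{1:t}=(x_1,\dots,x_t)\in\mathbb R^{dt}$. For a matrix $K\in\mathbb R^{dT\times dT}$, $K_{s,t}\in\mathbb R^{d\times d}$ denotes its $(s,t)$ block, $s,t\in\{1,\dots,T\}$. For a probability measure $\mu$ on $\mathbb R^{dT}$, $\mu_{x_{1:t}}$ denotes the regular conditional law under $\mu$ of $x_{t+1:T}$ given $x_{1:t}$; for a probability $\pi$ on $\mathbb R^{dT}\times\mathbb R^{dT}$, $\pi_{x_{1:t},y_{1:t}}$ denotes the regular conditional law of $(x_{t+1:T},y_{t+1:T})$ given $(x_{1:t},y_{1:t})$ (kernels being understood up to a.e. equality). $\mathrm{Cpl}(\mu,\nu)$ is the set of probability measures with first marginal $\mu$ and second marginal $\nu$. A coupling $\pi\in\mathrm{Cpl}(\mu,\nu)$ is bi-causal, written $\pi\in\mathrm{Cpl}_{\mathrm{bc}}(\mu,\nu)$, if for all $t=1,\dots,T-1$ and all $x_{1:t},y_{1:t}\in\mathbb R^{dt}$ one has $\pi_{x_{1:t},y_{1:t}}\in\mathrm{Cpl}(\mu_{x_{1:t}},\nu_{y_{1:t}})$. The entropic adapted 2-Wasserstein distance is $$\mathcal{AW}_{2,\lambda}^2(\mu,\nu)=\inf_{\pi\in\mathrm{Cpl}_{\mathrm{bc}}(\mu,\nu)}\int|x-y|^2\,d\pi+\lambda\,\mathcal D_{\mathrm{KL}}(\pi\,|\,\mu\otimes\nu),$$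 where $\mathcal D_{\mathrm{KL}}(\mu|\nu)=\int\log(d\mu/d\nu)\,d\mu$ if $\mu\ll\nu$ and $+\infty$ otherwise. For $\lambda=0$ the entropic term is absent and one writes $\mathcal{AW}_2=\mathcal{AW}_{2,0}$; likewise the term $\frac{\lambda}{2}\log\det(\cdot)$ is read as $0$ when $\lambda=0$. In the Cholesky decompositions, $L,M\in\mathbb R^{dT\times dT}$ are lower triangular with positive diagonal entries. For $\lambda\ge0$, $f_\lambda:\mathbb R\to\mathbb R$ is $$f_\lambda(x)=\operatorname{sign}(x)\Big(\sqrt{\big(\tfrac{\lambda}{4|x|}\big)^2+1}-\tfrac{\lambda}{4|x|}\Big)\ \text{ if }x\ne0,\qquad f_\lambda(0)=0,$$ with the convention $\operatorname{sign}(0)=0$; thus $f_0=\operatorname{sign}$. The limit $\lambda\to0$ is over $\lambda>0$. *)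

theory Defs
  imports "HOL-Probability.Probability"
begin

text \<open>
  The time index ranges over a finite linearly ordered type \<open>'t\<close> (in place of \<open>{1..T}\<close>) and the space
  index over a finite linearly ordered type \<open>'d\<close> (in place of \<open>{1..d}\<close>). A path is a vector of type
  \<open>real ^ ('t \<times> 'd)\<close> whose entry at \<open>(s, i)\<close> is the \<open>i\<close>-th coordinate of \<open>x\<^sub>s\<close>; index pairs are ordered
  lexicographically, so that the entries at a fixed time form a contiguous block.
\<close>

text \<open>Only meaningful for positive definite \<open>A\<close>, i.e.\ for non-degenerate Gaussian laws.\<close>

definition gaussian_measure :: "real ^ 'n \<Rightarrow> real ^ 'n ^ 'n \<Rightarrow> (real ^ 'n) measure" where
  "gaussian_measure a A = density lborel (\<lambda>x. ennreal
     (exp (- ((x - a) \<bullet> (matrix_inv A *v (x - a))) / 2) / sqrt ((2 * pi) ^ CARD('n) * det A)))"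

definition couplings :: "'a measure \<Rightarrow> 'b measure \<Rightarrow> ('a \<times> 'b) measure set" where
  "couplings M N = {P. prob_space P \<and> sets P = sets (M \<Otimes>\<^sub>M N) \<and>
     distr P M fst = M \<and> distr P N snd = N}"

text \<open>\<open>\<kappa>\<close> is a version of the regular conditional law of \<open>Y\<close> given \<open>X\<close> under \<open>P\<close>.\<close>

definition regular_cond_law ::
  "'w measure \<Rightarrow> ('w \<Rightarrow> 'a) \<Rightarrow> 'a measure \<Rightarrow> ('w \<Rightarrow> 'b) \<Rightarrow> 'b measure \<Rightarrow> ('a \<Rightarrow> 'b measure) \<Rightarrow> bool" where
  "regular_cond_law P X MX Y MY \<kappa> \<longleftrightarrow>
     X \<in> P \<rightarrow>\<^sub>M MX \<and> Y \<in> P \<rightarrow>\<^sub>M MY \<and> \<kappa> \<in> MX \<rightarrow>\<^sub>M prob_algebra MY \<and>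
     (\<forall>A\<in>sets MX. \<forall>B\<in>sets MY.
        emeasure P {w \<in> space P. X w \<in> A \<and> Y w \<in> B} =
        (\<integral>\<^sup>+x. emeasure (\<kappa> x) B * indicator A x \<partial>distr P MX X))"

definition past_space :: "'t::linorder \<Rightarrow> ('t \<times> 'd \<Rightarrow> real) measure" where
  "past_space t = PiM ({..t} \<times> UNIV) (\<lambda>_. borel)"

definition future_space :: "'t::linorder \<Rightarrow> ('t \<times> 'd \<Rightarrow> real) measure" where
  "future_space t = PiM ({t<..} \<times> UNIV) (\<lambda>_. borel)"

definition past :: "'t::{finite,linorder} \<Rightarrow> real ^ ('t \<times> 'd::finite) \<Rightarrow> ('t \<times> 'd \<Rightarrow> real)" where
  "past t x = restrict (($) x) ({..t} \<times> UNIV)"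

definition future :: "'t::{finite,linorder} \<Rightarrow> real ^ ('t \<times> 'd::finite) \<Rightarrow> ('t \<times> 'd \<Rightarrow> real)" where
  "future t x = restrict (($) x) ({t<..} \<times> UNIV)"

text \<open>
  Regular conditional laws are determined only up to null sets, so the coupling property of the
  kernels is required almost everywhere. As any two versions agree almost everywhere, it is
  immaterial which versions \<open>m\<close>, \<open>n\<close>, \<open>p\<close> are used.
\<close>

definition bicausal_couplings ::
  "(real ^ ('t::{finite,linorder} \<times> 'd::finite)) measure \<Rightarrow> (real ^ ('t \<times> 'd)) measure \<Rightarrow>
   ((real ^ ('t \<times> 'd)) \<times> (real ^ ('t \<times> 'd))) measure set" where
  "bicausal_couplings \<mu> \<nu> = {\<pi> \<in> couplings \<mu> \<nu>. \<forall>t < Max UNIV. \<exists>m n p.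
     regular_cond_law \<mu> (past t) (past_space t) (future t) (future_space t) m \<and>
     regular_cond_law \<nu> (past t) (past_space t) (future t) (future_space t) n \<and>
     regular_cond_law \<pi>
       (\<lambda>(x, y). (past t x, past t y)) (past_space t \<Otimes>\<^sub>M past_space t)
       (\<lambda>(x, y). (future t x, future t y)) (future_space t \<Otimes>\<^sub>M future_space t) p \<and>
     (AE (x, y) in \<pi>. p (past t x, past t y) \<in> couplings (m (past t x)) (n (past t y)))}"

text \<open>
  The integral of the logarithmic density is the difference of the integrals of its positive and
  negative parts: the library constant \<open>KL_divergence\<close> is a Bochner integral, which would be \<open>0\<close>
  instead of \<open>\<infinity>\<close> when the logarithmic density is not integrable. For probability measures the
  negative part is always integrable.
\<close>

definition kl_div :: "'a measure \<Rightarrow> 'a measure \<Rightarrow> ereal" where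
  "kl_div P Q = (if absolutely_continuous Q P
     then enn2ereal (\<integral>\<^sup>+x. ennreal (entropy_density (exp 1) Q P x) \<partial>P)
        - enn2ereal (\<integral>\<^sup>+x. ennreal (- entropy_density (exp 1) Q P x) \<partial>P)
     else \<infinity>)"

text \<open>
  This is the squared distance. Since \<open>0 * \<infinity> = 0\<close> in \<^typ>\<open>ereal\<close>, the entropic term is absent
  for \<open>lam = 0\<close>.
\<close>

definition adapted_wasserstein_sq ::
  "real \<Rightarrow> (real ^ ('t::{finite,linorder} \<times> 'd::finite)) measure \<Rightarrow> (real ^ ('t \<times> 'd)) measure \<Rightarrow> ereal" where
  "adapted_wasserstein_sq lam \<mu> \<nu> = (INF \<pi>\<in>bicausal_couplings \<mu> \<nu>.
     enn2ereal (\<integral>\<^sup>+(x, y). ennreal ((norm (x - y))\<^sup>2) \<partial>\<pi>) + ereal lam * kl_div \<pi> (\<mu> \<Otimes>\<^sub>M \<nu>))"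

definition cholesky ::
  "real ^ ('t::{finite,linorder} \<times> 'd::{finite,linorder}) ^ ('t \<times> 'd) \<Rightarrow>
   real ^ ('t \<times> 'd) ^ ('t \<times> 'd) \<Rightarrow> bool" where
  "cholesky A L \<longleftrightarrow>
     (\<forall>s i t j. s < t \<or> s = t \<and> i < j \<longrightarrow> L $ (s, i) $ (t, j) = 0) \<and>
     (\<forall>p. 0 < L $ p $ p) \<and> A = L ** transpose L"

definition block :: "real ^ ('t \<times> 'd) ^ ('t \<times> 'd) \<Rightarrow> 't::finite \<Rightarrow> 't \<Rightarrow> real ^ 'd ^ 'd::finite" where
  "block K s t = (\<chi> i j. K $ (s, i) $ (t, j))"

definition block_diag :: "('t \<Rightarrow> real ^ 'd ^ 'd) \<Rightarrow> real ^ ('t::finite \<times> 'd::finite) ^ ('t \<times> 'd)" where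
  "block_diag S = (\<chi> p q. if fst p = fst q then S (fst p) $ snd p $ snd q else 0)"

text \<open>
  \<open>\<Sigma>\<close> is a diagonal matrix whose diagonal consists of the singular values of \<open>C\<close> with multiplicity,
  in any order, i.e.\ the middle factor of a singular value decomposition of \<open>C\<close>.
\<close>

definition singular_value_matrix :: "real ^ 'n ^ 'n \<Rightarrow> real ^ 'n ^ 'n \<Rightarrow> bool" where
  "singular_value_matrix C \<Sigma> \<longleftrightarrow>
     (\<forall>i j. i \<noteq> j \<longrightarrow> \<Sigma> $ i $ j = 0) \<and> (\<forall>i. 0 \<le> \<Sigma> $ i $ i) \<and>
     (\<exists>U V. orthogonal_matrix U \<and> orthogonal_matrix V \<and> C = U ** \<Sigma> ** transpose V)"

definition f_lambda :: "real \<Rightarrow> real \<Rightarrow> real" where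
  "f_lambda lam x = (if x = 0 then 0
     else sgn x * (sqrt ((lam / (4 * \<bar>x\<bar>))\<^sup>2 + 1) - lam / (4 * \<bar>x\<bar>)))"

end

theory Submission
  imports Defs "HOL-Real_Asymp.Real_Asymp"
begin

text \<open>
  Whitening reduces the problem to couplings of two standard Gaussian vectors. Write
  \<open>x = a + L z\<close> and \<open>y = b + M w\<close>. The factors \<open>L\<close> and \<open>M\<close> are lower triangular and invertible, so the path
  of \<open>x\<close> up to time \<open>t\<close> and the path of \<open>z\<close> up to time \<open>t\<close> determine each other (\<open>causal_iso\<close>), and a coupling
  of \<open>x\<close> and \<open>y\<close> may be described by the coupling of \<open>z\<close> and \<open>w\<close> that it induces.

  Bicausality says that, given both pasts, the future of \<open>y\<close> is distributed as given the past of \<open>y\<close> alone.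
  Since \<open>w\<close> at a time after \<open>t\<close> is independent of the past of \<open>y\<close> up to \<open>t\<close>, it is then independent of the joint
  past, so \<open>z\<close> and \<open>w\<close> are uncorrelated at distinct times (\<open>bicausal_innovations_uncorrelated\<close>). Hence only the
  diagonal blocks of \<open>M\<^sup>T L\<close> contribute to the expected value of \<open>|x - y|\<^sup>2\<close>. Rotating \<open>z\<close> and \<open>w\<close> at each time
  by the orthogonal factors of the singular value decomposition is again causal, and makes these blocks
  diagonal: the transport cost is a constant minus \<open>2 * \<Sum>p. s p * r p\<close>, where \<open>r p\<close> is the correlation of the
  coordinates \<open>z p\<close> and \<open>w p\<close> (\<open>cost_law\<close>).

  For the entropy, \<open>kl_div_ge\<close> bounds it below by the integral of any \<open>g\<close> for which \<open>exp g\<close> is a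
  subprobability density with respect to \<open>\<mu> \<Otimes> \<nu>\<close>. Take for \<open>exp g\<close> the density of the Gaussian pair with
  independent coordinate pairs of correlations \<open>d p\<close>. As \<open>g\<close> is quadratic and the marginals are given, the bound
  is affine in the \<open>r p\<close>. Its slope in \<open>r p\<close> times \<open>\<lambda>\<close> is \<open>\<lambda> * d p / (1 - (d p)\<^sup>2)\<close>, which cancels the slope
  \<open>- 2 * s p\<close> of the transport cost exactly when \<open>d p = f_lambda \<lambda> (s p)\<close>. For this \<open>d\<close> the lower bound is the
  same number for every coupling, and the correlated Gaussian pair itself attains it
  (\<open>adapted_wasserstein_sq_pos\<close>). For \<open>\<lambda> = 0\<close> the bound is \<open>r p \<le> 1\<close>, approached by pairs with
  constant correlation tending to 1 (\<open>adapted_wasserstein_sq_zero\<close>), and the limit \<open>\<lambda> \<longrightarrow> 0\<close> is read off from the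
  closed formula.

  The correlated pair has to be shown bicausal. All conditional laws of Gaussian paths come from one symmetry:
  a Gaussian vector with independent coordinates keeps its law when its coordinates after time \<open>t\<close> are replaced
  by those of an independent copy (\<open>resampling\<close>, \<open>regular_cond_law_resampling\<close>). The same symmetry yields the
  independence and the orthogonality of distinct coordinates.
\<close>

section \<open>Lebesgue measure under linear maps\<close>

lemma measurable_vec_lambda_PiM [measurable]:
  "(vec_lambda :: _ \<Rightarrow> real ^ 'n) \<in> PiM UNIV (\<lambda>_. borel) \<rightarrow>\<^sub>M borel"
  by (subst borel_measurable_euclidean_space) (auto simp: Basis_vec_def inner_axis)

lemma borel_measurable_vec_lambda [measurable (raw)]:
  assumes "\<And>i. (\<lambda>x. f x i) \<in> borel_measurable M"
  shows "(\<lambda>x. (\<chi> i. f x i) :: real ^ 'n) \<in> borel_measurable M"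
  using assms by (subst borel_measurable_euclidean_space) (auto simp: Basis_vec_def inner_axis)

lemma borel_measurable_vec_nth_comp [measurable (raw)]:
  "f \<in> borel_measurable M \<Longrightarrow> (\<lambda>x. (f x :: real ^ 'n) $ i) \<in> borel_measurable M"
  by (rule measurable_compose[OF _ borel_measurable_nth])

lemma borel_measurable_matrix_vector_mult [measurable (raw)]:
  "f \<in> borel_measurable M \<Longrightarrow> (\<lambda>x. (A :: real ^ 'n ^ 'm) *v f x) \<in> borel_measurable M"
  unfolding matrix_vector_mult_def by measurable

lemma Basis_vec_eq_range: "(Basis :: (real ^ 'n) set) = range (\<lambda>i. axis i 1)"
  by (auto simp: Basis_vec_def)

lemma lborel_vec_eq_distr_PiM:
  "(lborel :: (real ^ 'n) measure) = distr (PiM UNIV (\<lambda>_. lborel)) borel vec_lambda"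
proof (rule lborel_eqI)
  interpret product_sigma_finite "\<lambda>_::'n. lborel :: real measure" ..
  have [measurable]: "(vec_lambda :: _ \<Rightarrow> real ^ 'n) \<in> PiM UNIV (\<lambda>_. lborel) \<rightarrow>\<^sub>M borel"
    by (simp cong: measurable_cong_sets sets_PiM_cong)
  fix l u :: "real ^ 'n" assume le: "\<And>b. b \<in> Basis \<Longrightarrow> l \<bullet> b \<le> u \<bullet> b"
  have le': "l $ i \<le> u $ i" for i
    using le[of "axis i 1"] by (simp add: inner_axis)
  have "vec_lambda -` box l u \<inter> space (PiM UNIV (\<lambda>_::'n. lborel :: real measure)) = PiE UNIV (\<lambda>i. {l $ i <..< u $ i})"
    by (force simp: mem_box_cart space_PiM PiE_def Pi_def)
  then have "emeasure (distr (PiM UNIV (\<lambda>_. lborel)) borel vec_lambda) (box l u) = (\<Prod>i\<in>UNIV. ennreal ((u - l) $ i))"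
    by (simp add: emeasure_distr emeasure_PiM le')
  also have "\<dots> = (\<Prod>b\<in>(\<lambda>i::'n. axis i 1)`UNIV. ennreal ((u - l) \<bullet> b))"
    by (subst prod.reindex) (auto simp: inj_on_def axis_eq_axis inner_axis)
  also have "(\<lambda>i::'n. axis i 1)`UNIV = (Basis :: (real^'n) set)"
    by (rule Basis_vec_eq_range[symmetric])
  finally show "emeasure (distr (PiM UNIV (\<lambda>_. lborel)) borel vec_lambda) (box l u) = (\<Prod>b\<in>Basis. (u - l) \<bullet> b)"
    using le by (simp add: prod_ennreal inner_diff_left)
qed simp

lemma nn_integral_lborel_vec:
  assumes [measurable]: "f \<in> borel_measurable (borel :: (real ^ 'n) measure)"
  shows "(\<integral>\<^sup>+x. f x \<partial>lborel) = (\<integral>\<^sup>+x. f (vec_lambda x) \<partial>PiM UNIV (\<lambda>_. lborel))"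
proof -
  have [measurable]: "(vec_lambda :: _ \<Rightarrow> real ^ 'n) \<in> PiM UNIV (\<lambda>_. lborel) \<rightarrow>\<^sub>M borel"
    by (simp cong: measurable_cong_sets sets_PiM_cong)
  show ?thesis
    by (subst lborel_vec_eq_distr_PiM) (simp add: nn_integral_distr)
qed

text \<open>
  Integrating over coordinate \<open>m\<close> first, the shear is a translation by \<open>x $ n\<close>, which is constant in that
  inner integral.
\<close>

lemma nn_integral_lborel_shear:
  assumes [measurable]: "f \<in> borel_measurable (borel :: (real ^ 'n) measure)" and "m \<noteq> n"
  shows "(\<integral>\<^sup>+x. f (\<chi> i. if i = m then x $ m + x $ n else x $ i) \<partial>lborel) = (\<integral>\<^sup>+x. f x \<partial>lborel)"
proof -
  interpret product_sigma_finite "\<lambda>_::'n. lborel :: real measure" ..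
  have U: "(UNIV :: 'n set) = insert m (UNIV - {m})" by auto
  have [measurable]: "(vec_lambda :: _ \<Rightarrow> real ^ 'n) \<in> PiM UNIV (\<lambda>_. lborel) \<rightarrow>\<^sub>M borel"
    by (simp cong: measurable_cong_sets sets_PiM_cong)
  have [measurable]: "(\<lambda>y. vec_lambda (x(m := y)) :: real^'n) \<in> borel \<rightarrow>\<^sub>M borel" for x
  proof (rule borel_measurable_vec_lambda)
    show "(\<lambda>y. (x(m := y)) i) \<in> borel_measurable borel" for i by (cases "i = m") auto
  qed
  have split: "(\<integral>\<^sup>+x. g x \<partial>lborel) = (\<integral>\<^sup>+x. \<integral>\<^sup>+y. g (vec_lambda (x(m := y))) \<partial>lborel \<partial>PiM (UNIV - {m}) (\<lambda>_. lborel))"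
    if [measurable]: "g \<in> borel_measurable (borel :: (real ^ 'n) measure)" for g
    unfolding nn_integral_lborel_vec[OF that]
    by (subst U, subst product_nn_integral_insert) (auto simp flip: U)
  have shear_eq: "f (\<chi> i. if i = m then vec_lambda (x(m := y)) $ m + vec_lambda (x(m := y)) $ n
       else vec_lambda (x(m := y)) $ i) = f (vec_lambda (x(m := x n + 1 * y)))" for x :: "'n \<Rightarrow> real" and y
    using \<open>m \<noteq> n\<close> by (intro arg_cong[of _ _ f]) (auto simp: vec_eq_iff)
  have "(\<integral>\<^sup>+y. f (vec_lambda (x(m := x n + 1 * y))) \<partial>lborel) = (\<integral>\<^sup>+y. f (vec_lambda (x(m := y))) \<partial>lborel)" for x :: "'n \<Rightarrow> real"
    using nn_integral_real_affine[of "\<lambda>y. f (vec_lambda (x(m := y)))" 1 "x n"] by simp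
  with shear_eq show ?thesis
    by (subst (1 2) split) (simp_all cong del: if_weak_cong)
qed

lemma nn_integral_lborel_transpose:
  assumes [measurable]: "f \<in> borel_measurable (borel :: (real ^ 'n) measure)"
  shows "(\<integral>\<^sup>+x. f (\<chi> i. x $ Transposition.transpose m n i) \<partial>lborel) = (\<integral>\<^sup>+x. f x \<partial>lborel)"
proof -
  let ?t = "Transposition.transpose m n"
  let ?h = "\<lambda>x::real^'n. \<chi> i. x $ ?t i"
  have "lborel = distr lborel borel ?h"
  proof (rule lborel_eqI)
    fix l u :: "real ^ 'n" assume le: "\<And>b. b \<in> Basis \<Longrightarrow> l \<bullet> b \<le> u \<bullet> b"
    have le': "l $ i \<le> u $ i" for i
      using le[of "axis i 1"] by (simp add: inner_axis)
    have "?h -` box l u = box (?h l) (?h u)"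
    proof (intro set_eqI iffI)
      fix x assume "x \<in> ?h -` box l u"
      then have "l $ ?t i < x $ ?t (?t i) \<and> x $ ?t (?t i) < u $ ?t i" for i
        by (simp only: vimage_eq mem_box_cart vec_lambda_beta)
      then show "x \<in> box (?h l) (?h u)"
        by (simp add: mem_box_cart)
    next
      fix x assume "x \<in> box (?h l) (?h u)"
      then have "l $ ?t (?t i) < x $ ?t i \<and> x $ ?t i < u $ ?t (?t i)" for i
        by (simp only: mem_box_cart vec_lambda_beta)
      then show "x \<in> ?h -` box l u"
        by (simp add: mem_box_cart)
    qed
    then have "emeasure (distr lborel borel ?h) (box l u) = emeasure lborel (box (?h l) (?h u))"
      by (simp add: emeasure_distr)
    also have "\<dots> = ennreal (\<Prod>b\<in>Basis. (?h u - ?h l) \<bullet> b)"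
      by (rule emeasure_lborel_box) (auto simp: Basis_vec_def inner_axis le')
    also have "(Basis :: (real^'n) set) = (\<lambda>i::'n. axis i 1)`UNIV"
      by (rule Basis_vec_eq_range)
    also have "(\<Prod>b\<in>(\<lambda>i::'n. axis i 1)`UNIV. (?h u - ?h l) \<bullet> b) = (\<Prod>i\<in>UNIV. (u - l) $ ?t i)"
      by (subst prod.reindex) (auto simp: inj_on_def axis_eq_axis inner_axis)
    also have "\<dots> = (\<Prod>i\<in>UNIV. (u - l) $ i)"
      by (rule prod.reindex_bij_betw) (rule bij_transpose)
    also have "\<dots> = (\<Prod>b\<in>(\<lambda>i::'n. axis i 1)`UNIV. (u - l) \<bullet> b)"
      by (subst prod.reindex) (auto simp: inj_on_def axis_eq_axis inner_axis)
    finally show "emeasure (distr lborel borel ?h) (box l u) = (\<Prod>b\<in>Basis. (u - l) \<bullet> b)"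
      by (simp add: Basis_vec_eq_range)
  qed simp
  then have "(\<integral>\<^sup>+x. f x \<partial>lborel) = (\<integral>\<^sup>+x. f x \<partial>distr lborel borel ?h)"
    by simp
  then show ?thesis by (simp add: nn_integral_distr)
qed

text \<open>
  Both sides are multiplicative in \<open>A\<close>, so it suffices to treat the elementary matrices. The index type carries
  no well-order here: the determinant of a shear is obtained as a row operation, not as that of a triangular
  matrix.
\<close>

lemma nn_integral_lborel_linear:
  fixes A :: "real ^ 'n ^ 'n"
  assumes "f \<in> borel_measurable borel" and "det A \<noteq> 0"
  shows "ennreal \<bar>det A\<bar> * (\<integral>\<^sup>+x. f (A *v x) \<partial>lborel) = (\<integral>\<^sup>+x. f x \<partial>lborel)"
proof -
  let ?P = "\<lambda>A :: real^'n^'n. det A \<noteq> 0 \<longrightarrow> (\<forall>f \<in> borel_measurable borel.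
    ennreal \<bar>det A\<bar> * (\<integral>\<^sup>+x. f (A *v x) \<partial>lborel) = (\<integral>\<^sup>+x. f x \<partial>lborel))"
  have "?P A"
  proof (rule induct_matrix_elementary_alt[where P = ?P])
    fix A B :: "real^'n^'n" assume IH: "?P A" "?P B"
    show "?P (A ** B)"
    proof (intro impI ballI)
      fix f :: "real^'n \<Rightarrow> ennreal" assume d: "det (A ** B) \<noteq> 0" and [measurable]: "f \<in> borel_measurable borel"
      have "ennreal \<bar>det (A ** B)\<bar> * (\<integral>\<^sup>+x. f (A ** B *v x) \<partial>lborel) =
        ennreal \<bar>det A\<bar> * (ennreal \<bar>det B\<bar> * (\<integral>\<^sup>+x. (\<lambda>x. f (A *v x)) (B *v x) \<partial>lborel))"
        by (simp add: det_mul abs_mult ennreal_mult mult.assoc matrix_vector_mul_assoc)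
      also have "\<dots> = ennreal \<bar>det A\<bar> * (\<integral>\<^sup>+x. f (A *v x) \<partial>lborel)"
      proof -
        have "(\<lambda>x. f (A *v x)) \<in> borel_measurable borel" by measurable
        moreover have "\<forall>g \<in> borel_measurable borel.
            ennreal \<bar>det B\<bar> * (\<integral>\<^sup>+x. g (B *v x) \<partial>lborel) = (\<integral>\<^sup>+x. g x \<partial>lborel)"
          using IH(2) d by (auto simp: det_mul)
        ultimately have "ennreal \<bar>det B\<bar> * (\<integral>\<^sup>+x. (\<lambda>x. f (A *v x)) (B *v x) \<partial>lborel) = (\<integral>\<^sup>+x. f (A *v x) \<partial>lborel)"
          by (rule bspec[rotated])
        then show ?thesis by (simp only:)
      qed
      also have "\<dots> = (\<integral>\<^sup>+x. f x \<partial>lborel)"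
        using IH(1) d by (auto simp: det_mul)
      finally show "ennreal \<bar>det (A ** B)\<bar> * (\<integral>\<^sup>+x. f (A ** B *v x) \<partial>lborel) = (\<integral>\<^sup>+x. f x \<partial>lborel)" .
    qed
  next
    fix A :: "real^'n^'n" and i assume "row i A = 0"
    then show "?P A" using det_zero_row(2) by blast
  next
    fix A :: "real^'n^'n" assume diag: "\<And>i j. i \<noteq> j \<Longrightarrow> A $ i $ j = 0"
    show "?P A"
    proof (intro impI ballI)
      fix f :: "real^'n \<Rightarrow> ennreal" assume d: "det A \<noteq> 0" and [measurable]: "f \<in> borel_measurable borel"
      \<comment> \<open>The scaling lemma for \<open>lborel\<close> indexes the factors by basis vectors instead of coordinates.\<close>
      define c where "c b = A $ (THE i. b = axis i 1) $ (THE i. b = axis i 1)" for b :: "real^'n"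
      have c: "c (axis i 1) = A $ i $ i" for i
        by (simp add: c_def axis_eq_axis)
      have nz: "A $ i $ i \<noteq> 0" for i
        using d diag by (simp add: det_diagonal)
      have "lborel = density (distr lborel borel (\<lambda>x. 0 + (\<Sum>j\<in>Basis. (c j * (x \<bullet> j)) *\<^sub>R j)))
          (\<lambda>_. ennreal (\<Prod>j\<in>Basis. \<bar>c j\<bar>))"
        by (rule lborel_affine_euclidean) (auto simp: Basis_vec_def c nz)
      also have "(\<lambda>x. 0 + (\<Sum>j\<in>Basis. (c j * (x \<bullet> j)) *\<^sub>R j)) = (*v) A"
      proof
        fix x :: "real^'n"
        have "0 + (\<Sum>j\<in>Basis. (c j * (x \<bullet> j)) *\<^sub>R j) = (\<Sum>j\<in>(\<lambda>i::'n. axis i 1)`UNIV. (c j * (x \<bullet> j)) *\<^sub>R j)"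
          by (simp add: Basis_vec_eq_range)
        also have "\<dots> = (\<Sum>i\<in>UNIV. (A $ i $ i * x $ i) *\<^sub>R axis i 1)"
          by (subst sum.reindex) (auto simp: inj_on_def axis_eq_axis inner_axis c)
        also have "\<dots> = A *v x"
        proof -
          have "(\<Sum>j\<in>UNIV. A $ k $ j * x $ j) = (\<Sum>j\<in>UNIV. if j = k then A $ k $ k * x $ k else 0)" for k
            by (rule sum.cong) (auto simp: diag)
          then show ?thesis
            by (simp add: vec_eq_iff matrix_vector_mult_def axis_def if_distrib cong: if_cong)
        qed
        finally show "0 + (\<Sum>j\<in>Basis. (c j * (x \<bullet> j)) *\<^sub>R j) = A *v x" .
      qed
      also have "(\<Prod>j\<in>Basis. \<bar>c j\<bar>) = (\<Prod>j\<in>(\<lambda>i::'n. axis i 1)`UNIV. \<bar>c j\<bar>)"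
        by (simp add: Basis_vec_eq_range)
      also have "\<dots> = \<bar>det A\<bar>"
        by (subst prod.reindex) (auto simp: inj_on_def axis_eq_axis c det_diagonal diag abs_prod)
      finally have *: "lborel = density (distr lborel borel ((*v) A)) (\<lambda>_. ennreal \<bar>det A\<bar>)" .
      show "ennreal \<bar>det A\<bar> * (\<integral>\<^sup>+x. f (A *v x) \<partial>lborel) = (\<integral>\<^sup>+x. f x \<partial>lborel)"
        by (subst (2) *) (simp add: nn_integral_density nn_integral_distr nn_integral_cmult)
    qed
  next
    fix m n :: 'n assume "m \<noteq> n"
    let ?A = "(\<chi> i j. mat 1 $ i $ Transposition.transpose m n j) :: real^'n^'n"
    have "?A *v x = (\<chi> i. x $ Transposition.transpose m n i)" for x
    proof -
      have "(\<Sum>j\<in>UNIV. (if i = Transposition.transpose m n j then 1 else 0) * x $ j) =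
         (\<Sum>j\<in>UNIV. if j = Transposition.transpose m n i then x $ Transposition.transpose m n i else 0)" for i
        by (rule sum.cong) auto
      then show ?thesis by (simp add: vec_eq_iff matrix_vector_mult_def mat_def)
    qed
    moreover have "\<bar>det ?A\<bar> = 1"
      by (simp add: det_permute_columns permutes_swap_id sign_swap_id abs_mult)
    ultimately show "?P ?A"
      by (simp add: nn_integral_lborel_transpose)
  next
    fix m n :: 'n assume mn: "m \<noteq> n"
    let ?A = "(\<chi> i j. of_bool (i = m \<and> j = n \<or> i = j)) :: real^'n^'n"
    have "?A *v x = (\<chi> i. if i = m then x $ m + x $ n else x $ i)" for x
    proof -
      have "(\<Sum>j\<in>UNIV. of_bool (i = m \<and> j = n \<or> i = j) * x $ j) =
         (\<Sum>j\<in>UNIV. (if j = i then x $ i else 0) + (if i = m then (if j = n then x $ n else 0) else 0))" for i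
        using mn by (intro sum.cong) auto
      then show ?thesis by (simp add: vec_eq_iff matrix_vector_mult_def sum.distrib)
    qed
    moreover have "det ?A = 1"
    proof -
      have "?A = (\<chi> k. if k = m then row m (mat 1) + 1 *s row n (mat 1) else row k (mat 1))"
        using mn by (auto simp: vec_eq_iff row_def mat_def)
      then show ?thesis
        using det_row_operation[OF mn, of "mat 1" 1] by simp
    qed
    ultimately show "?P ?A"
      using mn by (simp add: nn_integral_lborel_shear)
  qed
  then show ?thesis using assms by blast
qed

lemma nn_integral_lborel_affine:
  fixes A :: "real ^ 'n ^ 'n"
  assumes [measurable]: "f \<in> borel_measurable borel" and "det A \<noteq> 0"
  shows "ennreal \<bar>det A\<bar> * (\<integral>\<^sup>+x. f (a + A *v x) \<partial>lborel) = (\<integral>\<^sup>+x. f x \<partial>lborel)"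
proof -
  have "(\<integral>\<^sup>+x. f x \<partial>lborel) = (\<integral>\<^sup>+x. f x \<partial>distr lborel borel ((+) a))"
    by (simp add: lborel_distr_plus)
  also have "\<dots> = (\<integral>\<^sup>+x. f (a + x) \<partial>lborel)"
    by (simp add: nn_integral_distr)
  finally show ?thesis
    using nn_integral_lborel_linear[of "\<lambda>x. f (a + x)" A] assms by simp
qed

section \<open>Standard Gaussian vectors\<close>

definition std_gaussian :: "(real ^ 'n) measure" where
  "std_gaussian = distr (PiM UNIV (\<lambda>_. density lborel std_normal_density)) borel vec_lambda"

definition splice :: "'n set \<Rightarrow> real ^ 'n \<Rightarrow> real ^ 'n \<Rightarrow> real ^ 'n" where
  "splice J z z' = (\<chi> p. if p \<in> J then z $ p else z' $ p)"

lemma splice_nth [simp]: "splice J z z' $ p = (if p \<in> J then z $ p else z' $ p)"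
  by (simp add: splice_def)

lemma borel_measurable_splice [measurable (raw)]:
  "f \<in> borel_measurable M \<Longrightarrow> g \<in> borel_measurable M \<Longrightarrow> (\<lambda>x. splice J (f x) (g x)) \<in> borel_measurable M"
  unfolding splice_def by (rule borel_measurable_vec_lambda) auto

lemma measurable_vec_lambda_PiM_normal [measurable]:
  "(vec_lambda :: _ \<Rightarrow> real ^ 'n) \<in> PiM UNIV (\<lambda>_. density lborel std_normal_density) \<rightarrow>\<^sub>M borel"
  by (simp cong: measurable_cong_sets sets_PiM_cong)

lemma prob_space_std_normal: "prob_space (density lborel std_normal_density)"
  by (rule prob_space_normal_density) simp

lemma sets_std_gaussian [simp, measurable_cong]: "sets std_gaussian = sets borel"
  by (simp add: std_gaussian_def)

lemma space_std_gaussian [simp]: "space std_gaussian = UNIV"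
  by (simp add: std_gaussian_def)

lemma prob_space_std_gaussian: "prob_space std_gaussian"
  unfolding std_gaussian_def
  by (intro prob_space.prob_space_distr prob_space_PiM prob_space_std_normal) measurable

text \<open>
  The product definition gives independence, the density gives the behaviour under linear maps.
\<close>

lemma std_gaussian_eq_density:
  "(std_gaussian :: (real ^ 'n) measure) =
     density lborel (\<lambda>x. ennreal (exp (- (x \<bullet> x) / 2) / sqrt (2 * pi) ^ CARD('n)))"
proof -
  interpret L: product_sigma_finite "\<lambda>_::'n. lborel :: real measure" ..
  interpret product_sigma_finite "\<lambda>_::'n. density lborel std_normal_density"
    by (intro product_sigma_finite.intro prob_space_imp_sigma_finite prob_space_std_normal)
  have [measurable]: "(vec_lambda :: _ \<Rightarrow> real ^ 'n) \<in> PiM UNIV (\<lambda>_. lborel) \<rightarrow>\<^sub>M borel"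
    by (simp cong: measurable_cong_sets sets_PiM_cong)
  have "density (PiM UNIV (\<lambda>_. lborel)) (\<lambda>x::'n\<Rightarrow>real. \<Prod>i\<in>UNIV. ennreal (std_normal_density (x i))) =
     PiM UNIV (\<lambda>_. density lborel std_normal_density)"
  proof (rule PiM_eqI)
    fix A :: "'n \<Rightarrow> real set" assume A: "\<And>i. i \<in> UNIV \<Longrightarrow> A i \<in> sets (density lborel std_normal_density)"
    have [measurable]: "A i \<in> sets borel" for i using A by simp
    have ind: "(\<Prod>i\<in>UNIV. ennreal (std_normal_density (x i))) * indicator (PiE UNIV A) x
       = (\<Prod>i\<in>UNIV. ennreal (std_normal_density (x i)) * indicator (A i) (x i))" for x
      by (auto simp: indicator_def prod.distrib PiE_iff)
    have "emeasure (density (PiM UNIV (\<lambda>_. lborel)) (\<lambda>x::'n\<Rightarrow>real. \<Prod>i\<in>UNIV. ennreal (std_normal_density (x i)))) (PiE UNIV A)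
      = (\<integral>\<^sup>+x. (\<Prod>i\<in>UNIV. ennreal (std_normal_density (x i)) * indicator (A i) (x i)) \<partial>PiM UNIV (\<lambda>_. lborel))"
      by (subst emeasure_density) (auto intro!: sets_PiM_I_finite simp: ind)
    also have "\<dots> = (\<Prod>i\<in>UNIV. \<integral>\<^sup>+x. ennreal (std_normal_density x) * indicator (A i) x \<partial>lborel)"
      by (rule L.product_nn_integral_prod) auto
    also have "\<dots> = (\<Prod>i\<in>UNIV. emeasure (density lborel std_normal_density) (A i))"
      by (simp add: emeasure_density)
    finally show "emeasure (density (PiM UNIV (\<lambda>_. lborel)) (\<lambda>x::'n\<Rightarrow>real. \<Prod>i\<in>UNIV. ennreal (std_normal_density (x i)))) (PiE UNIV A)
      = (\<Prod>i\<in>UNIV. emeasure (density lborel std_normal_density) (A i))" .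
  qed (auto cong: sets_PiM_cong)
  then have "(std_gaussian :: (real^'n) measure) =
     distr (density (PiM UNIV (\<lambda>_. lborel)) (\<lambda>x::'n\<Rightarrow>real. \<Prod>i\<in>UNIV. ennreal (std_normal_density (vec_lambda x $ i)))) borel vec_lambda"
    by (simp add: std_gaussian_def)
  also have "\<dots> = density (distr (PiM UNIV (\<lambda>_. lborel)) borel vec_lambda) (\<lambda>x. \<Prod>i\<in>UNIV. ennreal (std_normal_density (x $ i)))"
    by (rule density_distr[symmetric]) measurable
  also have "\<dots> = density lborel (\<lambda>x. \<Prod>i\<in>UNIV. ennreal (std_normal_density (x $ i)))"
    by (simp add: lborel_vec_eq_distr_PiM[symmetric])
  also have "\<dots> = density lborel (\<lambda>x. ennreal (exp (- (x \<bullet> x) / 2) / sqrt (2 * pi) ^ CARD('n)))"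
  proof (intro arg_cong2[of _ _ _ _ density] ext refl)
    fix x :: "real^'n"
    have "(\<Prod>i\<in>UNIV. ennreal (std_normal_density (x $ i))) = ennreal (\<Prod>i\<in>UNIV. std_normal_density (x $ i))"
      by (rule prod_ennreal) simp
    also have "(\<Prod>i\<in>UNIV. std_normal_density (x $ i)) = exp (\<Sum>i\<in>UNIV. - (x $ i)\<^sup>2 / 2) / sqrt (2 * pi) ^ CARD('n)"
      by (simp add: std_normal_density_def prod.distrib exp_sum prod_dividef)
    also have "(\<Sum>i\<in>UNIV. - (x $ i)\<^sup>2 / 2) = - (x \<bullet> x) / 2"
      by (simp add: inner_vec_def power2_eq_square sum_divide_distrib sum_negf)
    finally show "(\<Prod>i\<in>UNIV. ennreal (std_normal_density (x $ i))) = ennreal (exp (- (x \<bullet> x) / 2) / sqrt (2 * pi) ^ CARD('n))" .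
  qed
  finally show ?thesis .
qed

lemma matrix_inv_unique:
  fixes A :: "real ^ 'n ^ 'n"
  assumes "A ** B = mat 1"
  shows "matrix_inv A = B"
proof -
  have BA: "B ** A = mat 1" using assms matrix_left_right_inverse by blast
  have "A ** matrix_inv A = mat 1 \<and> matrix_inv A ** A = mat 1"
    unfolding matrix_inv_def by (rule someI[of _ B]) (simp add: assms BA)
  then have "B ** (A ** matrix_inv A) = B" by (simp add: matrix_mul_rid)
  then show ?thesis by (simp add: matrix_mul_assoc BA matrix_mul_lid)
qed

text \<open>
  In the quadratic form of the density, \<open>(L L\<^sup>T)\<^sup>-\<^sup>1\<close> turns \<open>x = a + L z\<close> into \<open>z \<bullet> z\<close>, and the square root of
  \<open>det (L L\<^sup>T)\<close> is the Jacobian \<open>\<bar>det L\<bar>\<close>. Since \<open>L\<close> may be any invertible square root of the covariance, \<open>L\<close> can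
  be replaced by \<open>L V\<close> with \<open>V\<close> orthogonal.
\<close>

lemma gaussian_measure_eq_distr:
  fixes L :: "real ^ 'n ^ 'n"
  assumes "invertible L"
  shows "gaussian_measure a (L ** transpose L) = distr std_gaussian borel (\<lambda>z. a + L *v z)"
proof (rule measure_eqI)
  show "sets (gaussian_measure a (L ** transpose L)) = sets (distr std_gaussian borel (\<lambda>z. a + L *v z))"
    by (simp add: gaussian_measure_def)
  fix X assume "X \<in> sets (gaussian_measure a (L ** transpose L))"
  then have [measurable]: "X \<in> sets borel" by (simp add: gaussian_measure_def)
  obtain K where LK: "L ** K = mat 1" "K ** L = mat 1"
    using assms by (auto simp: invertible_def)
  have dL: "det L \<noteq> 0" using assms invertible_det_nz by blast
  have inv: "matrix_inv (L ** transpose L) = transpose K ** K"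
  proof (rule matrix_inv_unique)
    have "(L ** transpose L) ** (transpose K ** K) = L ** transpose (K ** L) ** K"
      by (simp add: matrix_transpose_mul matrix_mul_assoc)
    then show "(L ** transpose L) ** (transpose K ** K) = mat 1"
      by (simp add: LK transpose_mat)
  qed
  have quad: "(L *v z) \<bullet> (matrix_inv (L ** transpose L) *v (L *v z)) = z \<bullet> z" for z
  proof -
    have "(L *v z) \<bullet> (matrix_inv (L ** transpose L) *v (L *v z)) = (K *v (L *v z)) \<bullet> (K *v (L *v z))"
      by (simp add: inv dot_lmul_matrix[symmetric] matrix_vector_mul_assoc[symmetric] del: matrix_vector_mul_assoc)
         (metis dot_lmul_matrix inner_commute)
    then show ?thesis by (simp add: matrix_vector_mul_assoc LK)
  qed
  have sqrt_det: "sqrt ((2 * pi) ^ CARD('n) * det (L ** transpose L)) = sqrt (2 * pi) ^ CARD('n) * \<bar>det L\<bar>"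
    by (simp add: det_mul real_sqrt_mult real_sqrt_power power_mult_distrib)
  have cancel_det: "\<bar>det L\<bar> * (e / (c * \<bar>det L\<bar>)) = e / c" for e c :: real
    using dL by simp
  let ?g = "\<lambda>x. ennreal (exp (- ((x - a) \<bullet> (matrix_inv (L ** transpose L) *v (x - a))) / 2) / sqrt ((2 * pi) ^ CARD('n) * det (L ** transpose L)))"
  have "emeasure (gaussian_measure a (L ** transpose L)) X = (\<integral>\<^sup>+x. ?g x * indicator X x \<partial>lborel)"
    unfolding gaussian_measure_def by (rule emeasure_density) measurable
  also have "\<dots> = ennreal \<bar>det L\<bar> * (\<integral>\<^sup>+z. ?g (a + L *v z) * indicator X (a + L *v z) \<partial>lborel)"
    by (rule nn_integral_lborel_affine[symmetric, OF _ dL]) measurable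
  also have "\<dots> = (\<integral>\<^sup>+z. ennreal \<bar>det L\<bar> * (?g (a + L *v z) * indicator X (a + L *v z)) \<partial>lborel)"
    by (rule nn_integral_cmult[symmetric]) measurable
  also have "\<dots> = (\<integral>\<^sup>+z. ennreal (exp (- (z \<bullet> z) / 2) / sqrt (2 * pi) ^ CARD('n)) * indicator X (a + L *v z) \<partial>lborel)"
    by (simp only: mult.assoc[symmetric] ennreal_mult'[symmetric] abs_ge_zero sqrt_det quad add_diff_cancel_left' cancel_det)
  also have "\<dots> = (\<integral>\<^sup>+z. indicator X (a + L *v z) \<partial>std_gaussian)"
    unfolding std_gaussian_eq_density by (rule nn_integral_density[symmetric]) measurable
  also have "\<dots> = emeasure (distr std_gaussian borel (\<lambda>z. a + L *v z)) X"
    by (simp add: nn_integral_indicator[symmetric] nn_integral_distr del: nn_integral_indicator)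
  finally show "emeasure (gaussian_measure a (L ** transpose L)) X = emeasure (distr std_gaussian borel (\<lambda>z. a + L *v z)) X" .
qed

text \<open>
  Each coordinate of the spliced vector is drawn from one of two independent copies, and coordinates are
  independent.
\<close>

lemma std_gaussian_splice:
  "distr (std_gaussian \<Otimes>\<^sub>M std_gaussian) borel (\<lambda>(z, z'). splice J z z') = (std_gaussian :: (real ^ 'n) measure)"
proof -
  let ?N = "density lborel (\<lambda>x. ennreal (std_normal_density x))"
  let ?Q = "PiM (UNIV :: 'n set) (\<lambda>_. ?N)"
  let ?c = "\<lambda>(x :: 'n \<Rightarrow> real, y) i. if i \<in> J then x i else y i"
  interpret N: prob_space ?N by (rule prob_space_std_normal)
  interpret product_sigma_finite "\<lambda>_::'n. ?N" ..
  interpret Q: prob_space ?Q by (intro prob_space_PiM N.prob_space_axioms)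
  have [measurable]: "?c \<in> ?Q \<Otimes>\<^sub>M ?Q \<rightarrow>\<^sub>M ?Q"
    unfolding split_beta' by (rule measurable_PiM_single') (auto simp: space_PiM)
  have "distr (?Q \<Otimes>\<^sub>M ?Q) ?Q ?c = ?Q"
  proof (rule PiM_eqI)
    fix A :: "'n \<Rightarrow> real set" assume A: "\<And>i. i \<in> UNIV \<Longrightarrow> A i \<in> sets ?N"
    have *: "?c -` PiE UNIV A \<inter> space (?Q \<Otimes>\<^sub>M ?Q) =
       PiE UNIV (\<lambda>i. if i \<in> J then A i else UNIV) \<times> PiE UNIV (\<lambda>i. if i \<in> J then UNIV else A i)"
      by (auto simp: space_pair_measure space_PiM PiE_iff split: if_splits)
    have "emeasure (distr (?Q \<Otimes>\<^sub>M ?Q) ?Q ?c) (PiE UNIV A) =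
      (\<Prod>i\<in>UNIV. emeasure ?N (if i \<in> J then A i else UNIV)) * (\<Prod>i\<in>UNIV. emeasure ?N (if i \<in> J then UNIV else A i))"
    proof -
      have "PiE UNIV (\<lambda>i. if i \<in> J then A i else UNIV) \<in> sets ?Q"
        "PiE UNIV (\<lambda>i. if i \<in> J then UNIV else A i) \<in> sets ?Q" "PiE UNIV A \<in> sets ?Q"
        using A by (auto intro!: sets_PiM_I_finite)
      then show ?thesis
        using A by (subst emeasure_distr) (auto simp: * Q.emeasure_pair_measure_Times emeasure_PiM)
    qed
    also have "\<dots> = (\<Prod>i\<in>UNIV. emeasure ?N (A i))"
      using N.emeasure_space_1 by (simp add: prod.distrib[symmetric] if_distrib cong: if_cong)
    finally show "emeasure (distr (?Q \<Otimes>\<^sub>M ?Q) ?Q ?c) (PiE UNIV A) = (\<Prod>i\<in>UNIV. emeasure ?N (A i))" .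
  qed auto
  then have "std_gaussian = distr (distr (?Q \<Otimes>\<^sub>M ?Q) ?Q ?c) borel (vec_lambda :: _ \<Rightarrow> real^'n)"
    by (simp add: std_gaussian_def)
  also have "\<dots> = distr (?Q \<Otimes>\<^sub>M ?Q) borel (\<lambda>(x, y). splice J (vec_lambda x) (vec_lambda y))"
    by (subst distr_distr) (auto simp: comp_def split_beta' splice_def vec_eq_iff intro!: distr_cong)
  also have "\<dots> = distr (distr (?Q \<Otimes>\<^sub>M ?Q) (borel \<Otimes>\<^sub>M borel) (\<lambda>(x, y). (vec_lambda x, vec_lambda y))) borel
      (\<lambda>(z, z'). splice J z z')"
    by (subst distr_distr) (auto simp: comp_def split_beta')
  also have "distr (?Q \<Otimes>\<^sub>M ?Q) (borel \<Otimes>\<^sub>M borel) (\<lambda>(x, y). (vec_lambda x, vec_lambda y)) =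
     (std_gaussian \<Otimes>\<^sub>M std_gaussian :: ((real^'n) \<times> (real^'n)) measure)"
    unfolding std_gaussian_def
    by (rule pair_measure_distr[symmetric])
       (auto intro!: prob_space_imp_sigma_finite Q.prob_space_distr)
  finally show ?thesis by simp
qed

lemma distr_std_gaussian_nth:
  "distr (std_gaussian :: (real ^ 'n) measure) borel (\<lambda>z. z $ p) = density lborel std_normal_density"
proof -
  let ?N = "density lborel (\<lambda>x. ennreal (std_normal_density x))"
  have "distr (std_gaussian :: (real ^ 'n) measure) borel (\<lambda>z. z $ p) = distr (PiM UNIV (\<lambda>_. ?N)) ?N (\<lambda>x. x p)"
    unfolding std_gaussian_def by (subst distr_distr) (auto simp: comp_def intro!: distr_cong)
  also have "\<dots> = ?N" by (rule distr_PiM_component) (auto simp: prob_space_std_normal)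
  finally show ?thesis .
qed

lemma std_gaussian_moments:
  fixes p :: "'n::finite"
  shows "integrable std_gaussian (\<lambda>z::real^'n. (z $ p)\<^sup>2)" "(\<integral>z. (z $ p)\<^sup>2 \<partial>std_gaussian) = 1"
    and "integrable std_gaussian (\<lambda>z::real^'n. z $ p)" "(\<integral>z. z $ p \<partial>std_gaussian) = 0"
proof -
  have 2: "integrable (density lborel std_normal_density) (\<lambda>x. x\<^sup>2)" "(\<integral>x. x\<^sup>2 \<partial>density lborel std_normal_density) = 1"
    using integrable_std_normal_moment[of 2] integral_std_normal_moment_even[of 1]
    by (simp_all add: integrable_real_density integral_real_density)
  have 1: "integrable (density lborel std_normal_density) (\<lambda>x. x)" "(\<integral>x. x \<partial>density lborel std_normal_density) = 0"
    using integrable_std_normal_moment[of 1] integral_std_normal_moment_odd[of 0]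
    by (simp_all add: integrable_real_density integral_real_density)
  show "integrable std_gaussian (\<lambda>z::real^'n. (z $ p)\<^sup>2)" "(\<integral>z. (z $ p)\<^sup>2 \<partial>std_gaussian) = 1"
    using 2 unfolding distr_std_gaussian_nth[of p, symmetric]
    by (simp_all add: integrable_distr_eq integral_distr)
  show "integrable std_gaussian (\<lambda>z::real^'n. z $ p)" "(\<integral>z. z $ p \<partial>std_gaussian) = 0"
    using 1 unfolding distr_std_gaussian_nth[of p, symmetric]
    by (simp_all add: integrable_distr_eq integral_distr)
qed

section \<open>Resampling and regular conditional laws\<close>

text \<open>
  \<open>c x x'\<close> is thought of as keeping one part of \<open>x\<close> and taking the rest from an independent copy \<open>x'\<close>. This
  invariance replaces any explicit splitting of the space into a past and a future factor.
\<close>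

definition resampling :: "'a measure \<Rightarrow> ('a \<Rightarrow> 'a \<Rightarrow> 'a) \<Rightarrow> bool" where
  "resampling Q c \<longleftrightarrow> (\<lambda>(x, x'). c x x') \<in> Q \<Otimes>\<^sub>M Q \<rightarrow>\<^sub>M Q \<and> distr (Q \<Otimes>\<^sub>M Q) Q (\<lambda>(x, x'). c x x') = Q"

lemma nn_integral_resampling:
  assumes "prob_space Q" "resampling Q c" and [measurable]: "f \<in> borel_measurable Q"
  shows "(\<integral>\<^sup>+x. \<integral>\<^sup>+x'. f (c x x') \<partial>Q \<partial>Q) = (\<integral>\<^sup>+x. f x \<partial>Q)"
proof -
  interpret prob_space Q by fact
  have c[measurable]: "(\<lambda>(x, x'). c x x') \<in> Q \<Otimes>\<^sub>M Q \<rightarrow>\<^sub>M Q" and d: "distr (Q \<Otimes>\<^sub>M Q) Q (\<lambda>(x, x'). c x x') = Q"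
    using assms(2) by (auto simp: resampling_def)
  have "(\<integral>\<^sup>+x. f x \<partial>Q) = (\<integral>\<^sup>+x. f ((\<lambda>(x, x'). c x x') x) \<partial>(Q \<Otimes>\<^sub>M Q))"
    by (subst d[symmetric]) (rule nn_integral_distr, measurable)
  also have "\<dots> = (\<integral>\<^sup>+x. \<integral>\<^sup>+x'. f (c x x') \<partial>Q \<partial>Q)"
    by (subst nn_integral_fst[symmetric]) auto
  finally show ?thesis ..
qed

lemma resamplingI:
  assumes "prob_space Q" and [measurable]: "(\<lambda>(x, x'). c x x') \<in> Q \<Otimes>\<^sub>M Q \<rightarrow>\<^sub>M Q"
    and eq: "\<And>f. f \<in> borel_measurable Q \<Longrightarrow> (\<integral>\<^sup>+x. \<integral>\<^sup>+x'. f (c x x') \<partial>Q \<partial>Q) = (\<integral>\<^sup>+x. f x \<partial>Q)"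
  shows "resampling Q c"
proof -
  interpret prob_space Q by fact
  have "distr (Q \<Otimes>\<^sub>M Q) Q (\<lambda>(x, x'). c x x') = Q"
  proof (rule measure_eqI)
    fix A assume "A \<in> sets (distr (Q \<Otimes>\<^sub>M Q) Q (\<lambda>(x, x'). c x x'))"
    then have [measurable]: "A \<in> sets Q" by simp
    have "emeasure (distr (Q \<Otimes>\<^sub>M Q) Q (\<lambda>(x, x'). c x x')) A = (\<integral>\<^sup>+x. indicator A ((\<lambda>(x, x'). c x x') x) \<partial>(Q \<Otimes>\<^sub>M Q))"
      by (simp add: nn_integral_indicator[symmetric] nn_integral_distr del: nn_integral_indicator)
    also have "\<dots> = (\<integral>\<^sup>+x. \<integral>\<^sup>+x'. indicator A (c x x') \<partial>Q \<partial>Q)"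
      by (subst nn_integral_fst[symmetric]) auto
    also have "\<dots> = emeasure Q A"
      by (simp add: eq)
    finally show "emeasure (distr (Q \<Otimes>\<^sub>M Q) Q (\<lambda>(x, x'). c x x')) A = emeasure Q A" .
  qed simp
  then show ?thesis by (simp add: resampling_def)
qed

lemma emeasure_eq_nn_integral_indicators:
  assumes [measurable]: "X \<in> P \<rightarrow>\<^sub>M MX" "Y \<in> P \<rightarrow>\<^sub>M MY" "A \<in> sets MX" "B \<in> sets MY"
  shows "emeasure P {w \<in> space P. X w \<in> A \<and> Y w \<in> B} = (\<integral>\<^sup>+w. indicator A (X w) * indicator B (Y w) \<partial>P)"
proof -
  have "emeasure P {w \<in> space P. X w \<in> A \<and> Y w \<in> B} = (\<integral>\<^sup>+w. indicator {w \<in> space P. X w \<in> A \<and> Y w \<in> B} w \<partial>P)"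
    by (rule nn_integral_indicator[symmetric]) measurable
  also have "\<dots> = (\<integral>\<^sup>+w. indicator A (X w) * indicator B (Y w) \<partial>P)"
    by (rule nn_integral_cong) (simp add: indicator_def)
  finally show ?thesis .
qed

text \<open>
  In the fourfold integral the inner two variables of the two factors have to be interchanged.
\<close>

lemma resampling_pair:
  assumes Q: "prob_space Q" "resampling Q c" and R: "prob_space R" "resampling R e"
  shows "resampling (Q \<Otimes>\<^sub>M R) (\<lambda>(x, y) (x', y'). (c x x', e y y'))"
proof (rule resamplingI)
  interpret Q: prob_space Q by fact
  interpret R: prob_space R by fact
  interpret QR: pair_prob_space Q R ..
  interpret RQ: pair_sigma_finite R Q ..
  have [measurable]: "(\<lambda>(x, x'). c x x') \<in> Q \<Otimes>\<^sub>M Q \<rightarrow>\<^sub>M Q" "(\<lambda>(x, x'). e x x') \<in> R \<Otimes>\<^sub>M R \<rightarrow>\<^sub>M R"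
    using assms by (auto simp: resampling_def)
  show "prob_space (Q \<Otimes>\<^sub>M R)" by (rule prob_space_pair) fact+
  show "(\<lambda>(p, p'). (\<lambda>(x, y) (x', y'). (c x x', e y y')) p p') \<in> (Q \<Otimes>\<^sub>M R) \<Otimes>\<^sub>M (Q \<Otimes>\<^sub>M R) \<rightarrow>\<^sub>M Q \<Otimes>\<^sub>M R"
    unfolding split_beta' by measurable
  fix f :: "_ \<Rightarrow> ennreal" assume [measurable]: "f \<in> borel_measurable (Q \<Otimes>\<^sub>M R)"
  have "(\<integral>\<^sup>+p. f p \<partial>(Q \<Otimes>\<^sub>M R)) = (\<integral>\<^sup>+x. \<integral>\<^sup>+y. f (x, y) \<partial>R \<partial>Q)"
    by (rule R.nn_integral_fst[symmetric]) measurable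
  also have "\<dots> = (\<integral>\<^sup>+x. \<integral>\<^sup>+x'. \<integral>\<^sup>+y. f (c x x', y) \<partial>R \<partial>Q \<partial>Q)"
    by (rule nn_integral_resampling[OF Q, symmetric]) measurable
  also have "\<dots> = (\<integral>\<^sup>+x. \<integral>\<^sup>+x'. \<integral>\<^sup>+y. \<integral>\<^sup>+y'. f (c x x', e y y') \<partial>R \<partial>R \<partial>Q \<partial>Q)"
  proof (rule nn_integral_cong, rule nn_integral_cong)
    fix x x' assume [measurable]: "x \<in> space Q" "x' \<in> space Q"
    have "c x x' \<in> space Q"
      using measurable_space[of "\<lambda>(x, x'). c x x'" "Q \<Otimes>\<^sub>M Q" Q "(x, x')"] \<open>x \<in> space Q\<close> \<open>x' \<in> space Q\<close> by (auto simp: space_pair_measure)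
    then show "(\<integral>\<^sup>+y. f (c x x', y) \<partial>R) = (\<integral>\<^sup>+y. \<integral>\<^sup>+y'. f (c x x', e y y') \<partial>R \<partial>R)"
      by (intro nn_integral_resampling[OF R, symmetric]) measurable
  qed
  also have "\<dots> = (\<integral>\<^sup>+x. \<integral>\<^sup>+y. \<integral>\<^sup>+x'. \<integral>\<^sup>+y'. f (c x x', e y y') \<partial>R \<partial>Q \<partial>R \<partial>Q)"
    by (intro nn_integral_cong RQ.Fubini') measurable
  also have "\<dots> = (\<integral>\<^sup>+x. \<integral>\<^sup>+y. \<integral>\<^sup>+p'. f (c x (fst p'), e y (snd p')) \<partial>(Q \<Otimes>\<^sub>M R) \<partial>R \<partial>Q)"
    by (intro nn_integral_cong, subst R.nn_integral_fst[symmetric]) auto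
  also have "\<dots> = (\<integral>\<^sup>+p. \<integral>\<^sup>+p'. f (c (fst p) (fst p'), e (snd p) (snd p')) \<partial>(Q \<Otimes>\<^sub>M R) \<partial>(Q \<Otimes>\<^sub>M R))"
    by (subst R.nn_integral_fst[symmetric]) auto
  finally show "(\<integral>\<^sup>+p. \<integral>\<^sup>+p'. f ((\<lambda>(x, y) (x', y'). (c x x', e y y')) p p') \<partial>(Q \<Otimes>\<^sub>M R) \<partial>(Q \<Otimes>\<^sub>M R)) = (\<integral>\<^sup>+p. f p \<partial>(Q \<Otimes>\<^sub>M R))"
    by (simp add: split_beta')
qed

lemma resampling_distr:
  assumes Q: "prob_space Q" "resampling Q c"
    and g[measurable]: "g \<in> Q \<rightarrow>\<^sub>M R" and e[measurable]: "(\<lambda>(y, y'). e y y') \<in> R \<Otimes>\<^sub>M R \<rightarrow>\<^sub>M R"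
    and eq: "\<And>x x'. x \<in> space Q \<Longrightarrow> x' \<in> space Q \<Longrightarrow> g (c x x') = e (g x) (g x')"
  shows "resampling (distr Q R g) e"
proof (rule resamplingI)
  interpret Q: prob_space Q by fact
  show "prob_space (distr Q R g)" by (rule Q.prob_space_distr) fact
  then interpret D: prob_space "distr Q R g" .
  show "(\<lambda>(y, y'). e y y') \<in> distr Q R g \<Otimes>\<^sub>M distr Q R g \<rightarrow>\<^sub>M distr Q R g"
    by measurable
  fix f :: "_ \<Rightarrow> ennreal" assume "f \<in> borel_measurable (distr Q R g)"
  then have [measurable]: "f \<in> borel_measurable R" by simp
  have "(\<integral>\<^sup>+y. \<integral>\<^sup>+y'. f (e y y') \<partial>distr Q R g \<partial>distr Q R g) = (\<integral>\<^sup>+x. \<integral>\<^sup>+y'. f (e (g x) y') \<partial>distr Q R g \<partial>Q)"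
    by (rule nn_integral_distr) measurable
  also have "\<dots> = (\<integral>\<^sup>+x. \<integral>\<^sup>+x'. f (e (g x) (g x')) \<partial>Q \<partial>Q)"
    using measurable_space[OF g] by (intro nn_integral_cong nn_integral_distr) measurable
  also have "\<dots> = (\<integral>\<^sup>+x. \<integral>\<^sup>+x'. f (g (c x x')) \<partial>Q \<partial>Q)"
    by (intro nn_integral_cong) (simp add: eq)
  also have "\<dots> = (\<integral>\<^sup>+x. f (g x) \<partial>Q)"
    by (rule nn_integral_resampling[OF Q]) measurable
  also have "\<dots> = (\<integral>\<^sup>+y. f y \<partial>distr Q R g)"
    by (rule nn_integral_distr[symmetric]) measurable
  finally show "(\<integral>\<^sup>+y. \<integral>\<^sup>+y'. f (e y y') \<partial>distr Q R g \<partial>distr Q R g) = (\<integral>\<^sup>+y. f y \<partial>distr Q R g)" .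
qed

text \<open>
  If resampling keeps \<open>X\<close>, and \<open>Y\<close> after resampling is a function of \<open>X\<close> and the independent copy, then
  conditioning on \<open>X\<close> just freezes the first argument of that function.
\<close>

lemma regular_cond_law_resampling:
  assumes Q: "prob_space Q" "resampling Q c"
    and X[measurable]: "X \<in> Q \<rightarrow>\<^sub>M MX" and Y[measurable]: "Y \<in> Q \<rightarrow>\<^sub>M MY"
    and G[measurable]: "(\<lambda>(u, z'). G u z') \<in> MX \<Otimes>\<^sub>M Q \<rightarrow>\<^sub>M MY"
    and Xc: "\<And>z z'. z \<in> space Q \<Longrightarrow> z' \<in> space Q \<Longrightarrow> X (c z z') = X z"
    and Yc: "\<And>z z'. z \<in> space Q \<Longrightarrow> z' \<in> space Q \<Longrightarrow> Y (c z z') = G (X z) z'"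
  shows "regular_cond_law Q X MX Y MY (\<lambda>u. distr Q MY (G u))"
  unfolding regular_cond_law_def
proof (intro conjI ballI X Y)
  interpret Q: prob_space Q by fact
  have "(\<lambda>_. Q) \<in> MX \<rightarrow>\<^sub>M prob_algebra Q"
    by (simp add: space_prob_algebra Q)
  then show kappa: "(\<lambda>u. distr Q MY (G u)) \<in> MX \<rightarrow>\<^sub>M prob_algebra MY"
    by (rule measurable_distr_prob_space2) fact
  fix A B assume A[measurable]: "A \<in> sets MX" and B[measurable]: "B \<in> sets MY"
  have "emeasure Q {w \<in> space Q. X w \<in> A \<and> Y w \<in> B} = (\<integral>\<^sup>+z. indicator A (X z) * indicator B (Y z) \<partial>Q)"
    by (rule emeasure_eq_nn_integral_indicators) measurable
  also have "\<dots> = (\<integral>\<^sup>+z. \<integral>\<^sup>+z'. indicator A (X (c z z')) * indicator B (Y (c z z')) \<partial>Q \<partial>Q)"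
    by (rule nn_integral_resampling[OF Q, symmetric]) measurable
  also have "\<dots> = (\<integral>\<^sup>+z. \<integral>\<^sup>+z'. indicator A (X z) * indicator B (G (X z) z') \<partial>Q \<partial>Q)"
    by (intro nn_integral_cong) (simp add: Xc Yc)
  also have "\<dots> = (\<integral>\<^sup>+z. emeasure (distr Q MY (G (X z))) B * indicator A (X z) \<partial>Q)"
  proof (rule nn_integral_cong)
    fix z assume "z \<in> space Q"
    then have "X z \<in> space MX" by (rule measurable_space[OF X])
    from measurable_Pair2[OF G this] have [measurable]: "G (X z) \<in> Q \<rightarrow>\<^sub>M MY" by simp
    have "(\<integral>\<^sup>+z'. indicator A (X z) * indicator B (G (X z) z') \<partial>Q) = indicator A (X z) * (\<integral>\<^sup>+y. indicator B y \<partial>distr Q MY (G (X z)))"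
    proof -
      have "(\<integral>\<^sup>+y. indicator B y \<partial>distr Q MY (G (X z))) = (\<integral>\<^sup>+z'. indicator B (G (X z) z') \<partial>Q)"
        by (rule nn_integral_distr) measurable
      then show ?thesis
        by (simp only:) (rule nn_integral_cmult, measurable)
    qed
    then show "(\<integral>\<^sup>+z'. indicator A (X z) * indicator B (G (X z) z') \<partial>Q) = emeasure (distr Q MY (G (X z))) B * indicator A (X z)"
      by (simp add: mult.commute)
  qed
  also have "\<dots> = (\<integral>\<^sup>+u. emeasure (distr Q MY (G u)) B * indicator A u \<partial>distr Q MX X)"
  proof (rule nn_integral_distr[symmetric])
    from measurable_compose[OF measurable_prob_algebraD[OF kappa] measurable_emeasure_subprob_algebra[OF B]]
    have [measurable]: "(\<lambda>u. emeasure (distr Q MY (G u)) B) \<in> borel_measurable MX" .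
    show "(\<lambda>u. emeasure (distr Q MY (G u)) B * indicator A u) \<in> borel_measurable (distr Q MX X)"
      by measurable
  qed fact
  finally show "emeasure Q {w \<in> space Q. X w \<in> A \<and> Y w \<in> B} =
      (\<integral>\<^sup>+u. emeasure (distr Q MY (G u)) B * indicator A u \<partial>distr Q MX X)" .
qed

lemma regular_cond_law_distr:
  assumes [measurable]: "g \<in> Q \<rightarrow>\<^sub>M R" "X \<in> R \<rightarrow>\<^sub>M MX" "Y \<in> R \<rightarrow>\<^sub>M MY"
    and r: "regular_cond_law Q (\<lambda>w. X (g w)) MX (\<lambda>w. Y (g w)) MY \<kappa>"
  shows "regular_cond_law (distr Q R g) X MX Y MY \<kappa>"
  unfolding regular_cond_law_def
proof (intro conjI ballI)
  show "X \<in> distr Q R g \<rightarrow>\<^sub>M MX" "Y \<in> distr Q R g \<rightarrow>\<^sub>M MY" by measurable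
  show "\<kappa> \<in> MX \<rightarrow>\<^sub>M prob_algebra MY" using r by (simp add: regular_cond_law_def)
  fix A B assume [measurable]: "A \<in> sets MX" "B \<in> sets MY"
  have "emeasure (distr Q R g) {w \<in> space (distr Q R g). X w \<in> A \<and> Y w \<in> B} = emeasure Q {w \<in> space Q. X (g w) \<in> A \<and> Y (g w) \<in> B}"
    by (subst emeasure_distr) (auto intro!: arg_cong[of _ _ "emeasure Q"] dest: measurable_space[OF assms(1)])
  also have "\<dots> = (\<integral>\<^sup>+u. emeasure (\<kappa> u) B * indicator A u \<partial>distr Q MX (\<lambda>w. X (g w)))"
    using r by (simp add: regular_cond_law_def)
  also have "distr Q MX (\<lambda>w. X (g w)) = distr (distr Q R g) MX X"
    by (simp add: distr_distr comp_def)
  finally show "emeasure (distr Q R g) {w \<in> space (distr Q R g). X w \<in> A \<and> Y w \<in> B} =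
      (\<integral>\<^sup>+u. emeasure (\<kappa> u) B * indicator A u \<partial>distr (distr Q R g) MX X)" .
qed

text \<open>
  The defining identity on rectangles extends to all integrands, because rectangles form an intersection-stable
  generator of the product. This is what allows \<open>Y\<close> to be integrated out of a function that mixes \<open>X\<close> and \<open>Y\<close>.
\<close>

lemma nn_integral_regular_cond_law:
  assumes P: "prob_space P" and r: "regular_cond_law P X MX Y MY \<kappa>"
    and f[measurable]: "f \<in> borel_measurable (MX \<Otimes>\<^sub>M MY)"
  shows "(\<integral>\<^sup>+w. f (X w, Y w) \<partial>P) = (\<integral>\<^sup>+w. \<integral>\<^sup>+y. f (X w, y) \<partial>\<kappa> (X w) \<partial>P)"
proof -
  interpret prob_space P by fact
  have X[measurable]: "X \<in> P \<rightarrow>\<^sub>M MX" and Y[measurable]: "Y \<in> P \<rightarrow>\<^sub>M MY" and k: "\<kappa> \<in> MX \<rightarrow>\<^sub>M prob_algebra MY"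
    using r by (auto simp: regular_cond_law_def)
  have k'[measurable]: "\<kappa> \<in> MX \<rightarrow>\<^sub>M subprob_algebra MY" by (rule measurable_prob_algebraD[OF k])
  have sets_k: "sets (\<kappa> x) = sets MY" if "x \<in> space MX" for x
    using measurable_space[OF k that] by (simp add: space_prob_algebra)
  let ?K = "\<lambda>x. distr (\<kappa> x) (MX \<Otimes>\<^sub>M MY) (\<lambda>y. (x, y))"
  have K: "?K \<in> MX \<rightarrow>\<^sub>M prob_algebra (MX \<Otimes>\<^sub>M MY)"
    by (rule measurable_distr_prob_space2[OF k]) measurable
  have K'[measurable]: "?K \<in> distr P MX X \<rightarrow>\<^sub>M subprob_algebra (MX \<Otimes>\<^sub>M MY)"
    using measurable_prob_algebraD[OF K] by simp
  have ne: "space MX \<noteq> {}" using not_empty measurable_space[OF X] by blast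
  have eq: "distr P (MX \<Otimes>\<^sub>M MY) (\<lambda>w. (X w, Y w)) = distr P MX X \<bind> ?K"
  proof (rule measure_eqI_generator_eq[OF Int_stable_pair_measure_generator[of MX MY]])
    show "{a \<times> b |a b. a \<in> sets MX \<and> b \<in> sets MY} \<subseteq> Pow (space MX \<times> space MY)"
      by (auto dest: sets.sets_into_space)
    show "sets (distr P (MX \<Otimes>\<^sub>M MY) (\<lambda>w. (X w, Y w))) = sigma_sets (space MX \<times> space MY) {a \<times> b |a b. a \<in> sets MX \<and> b \<in> sets MY}"
      by (simp add: sets_pair_measure)
    have "sets (distr P MX X \<bind> ?K) = sets (MX \<Otimes>\<^sub>M MY)"
      using ne by (intro sets_bind) auto
    then show "sets (distr P MX X \<bind> ?K) = sigma_sets (space MX \<times> space MY) {a \<times> b |a b. a \<in> sets MX \<and> b \<in> sets MY}"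
      by (simp add: sets_pair_measure)
    show "range (\<lambda>_::nat. space MX \<times> space MY) \<subseteq> {a \<times> b |a b. a \<in> sets MX \<and> b \<in> sets MY}" by auto
    show "(\<Union>i::nat. space MX \<times> space MY) = space MX \<times> space MY" by auto
    interpret D: prob_space "distr P (MX \<Otimes>\<^sub>M MY) (\<lambda>w. (X w, Y w))" by (rule prob_space_distr) measurable
    show "emeasure (distr P (MX \<Otimes>\<^sub>M MY) (\<lambda>w. (X w, Y w))) (space MX \<times> space MY) \<noteq> \<infinity>" by simp
    fix Z assume "Z \<in> {a \<times> b |a b. a \<in> sets MX \<and> b \<in> sets MY}"
    then obtain A B where Z: "Z = A \<times> B" and A[measurable]: "A \<in> sets MX" and B[measurable]: "B \<in> sets MY" by auto
    have "emeasure (distr P (MX \<Otimes>\<^sub>M MY) (\<lambda>w. (X w, Y w))) Z = emeasure P {w \<in> space P. X w \<in> A \<and> Y w \<in> B}"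
      unfolding Z by (subst emeasure_distr) (auto intro!: arg_cong[of _ _ "emeasure P"])
    also have "\<dots> = (\<integral>\<^sup>+x. emeasure (\<kappa> x) B * indicator A x \<partial>distr P MX X)"
      using r by (simp add: regular_cond_law_def)
    also have "\<dots> = (\<integral>\<^sup>+x. emeasure (?K x) Z \<partial>distr P MX X)"
    proof (rule nn_integral_cong)
      fix x assume "x \<in> space (distr P MX X)"
      then have x: "x \<in> space MX" by simp
      have m: "(\<lambda>y. (x, y)) \<in> \<kappa> x \<rightarrow>\<^sub>M MX \<Otimes>\<^sub>M MY"
        using x by (simp add: measurable_cong_sets[OF sets_k[OF x] refl])
      have "space (\<kappa> x) = space MY" by (rule sets_eq_imp_space_eq[OF sets_k[OF x]])
      with sets.sets_into_space[OF B] have "(\<lambda>y. (x, y)) -` Z \<inter> space (\<kappa> x) = (if x \<in> A then B else {})"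
        by (auto simp: Z)
      then show "emeasure (\<kappa> x) B * indicator A x = emeasure (?K x) Z"
        using m by (subst emeasure_distr) (auto simp: Z)
    qed
    also have "\<dots> = emeasure (distr P MX X \<bind> ?K) Z"
      by (rule emeasure_bind[symmetric, OF _ K']) (auto simp: Z ne)
    finally show "emeasure (distr P (MX \<Otimes>\<^sub>M MY) (\<lambda>w. (X w, Y w))) Z = emeasure (distr P MX X \<bind> ?K) Z" .
  qed
  have "(\<integral>\<^sup>+w. f (X w, Y w) \<partial>P) = (\<integral>\<^sup>+z. f z \<partial>distr P (MX \<Otimes>\<^sub>M MY) (\<lambda>w. (X w, Y w)))"
    by (rule nn_integral_distr[symmetric]) measurable
  also have "\<dots> = (\<integral>\<^sup>+x. \<integral>\<^sup>+z. f z \<partial>?K x \<partial>distr P MX X)"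
    unfolding eq by (rule nn_integral_bind[OF f K'])
  also have "\<dots> = (\<integral>\<^sup>+w. \<integral>\<^sup>+z. f z \<partial>?K (X w) \<partial>P)"
    by (rule nn_integral_distr[OF X measurable_compose[OF K' nn_integral_measurable_subprob_algebra[OF f]]])
  also have "\<dots> = (\<integral>\<^sup>+w. \<integral>\<^sup>+y. f (X w, y) \<partial>\<kappa> (X w) \<partial>P)"
  proof (rule nn_integral_cong)
    fix w assume "w \<in> space P"
    then have x: "X w \<in> space MX" by (rule measurable_space[OF X])
    have m: "(\<lambda>y. (X w, y)) \<in> \<kappa> (X w) \<rightarrow>\<^sub>M MX \<Otimes>\<^sub>M MY"
      using x by (simp add: measurable_cong_sets[OF sets_k[OF x] refl])
    show "(\<integral>\<^sup>+z. f z \<partial>?K (X w)) = (\<integral>\<^sup>+y. f (X w, y) \<partial>\<kappa> (X w))"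
      by (rule nn_integral_distr[OF m]) measurable
  qed
  finally show ?thesis .
qed

text \<open>
  \<open>P\<close> describes two processes with joint past \<open>X\<close> and joint future \<open>Y\<close>; \<open>u\<close> and \<open>v\<close> select one of the processes,
  whose law is described by \<open>Q\<close>, \<open>U\<close>, \<open>V\<close>. By \<open>proj\<close>, the future of that process depends on the joint past only
  through its own past. So the conditional law of \<open>h\<close> given the joint past is a function \<open>\<phi>\<close> of the own past,
  and independence under \<open>Q\<close> makes \<open>\<phi>\<close> constant.
\<close>

lemma product_law_of_joint_kernel:
  fixes h :: "'u \<times> 'v \<Rightarrow> real"
  assumes P: "prob_space P" and Q: "prob_space Q"
    and rP: "regular_cond_law P X MX Y MY p" and rQ: "regular_cond_law Q U MU V MV n"
    and u[measurable]: "u \<in> MX \<rightarrow>\<^sub>M MU" and v[measurable]: "v \<in> MY \<rightarrow>\<^sub>M MV"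
    and marg: "distr P MU (\<lambda>w. u (X w)) = distr Q MU U"
    and proj: "AE w in P. distr (p (X w)) MV v = n (u (X w))"
    and h[measurable]: "h \<in> borel_measurable (MU \<Otimes>\<^sub>M MV)"
    and indep: "distr Q (MU \<Otimes>\<^sub>M borel) (\<lambda>w. (U w, h (U w, V w))) = distr Q MU U \<Otimes>\<^sub>M distr Q borel (\<lambda>w. h (U w, V w))"
  shows "distr P (MX \<Otimes>\<^sub>M borel) (\<lambda>w. (X w, h (u (X w), v (Y w)))) = distr P MX X \<Otimes>\<^sub>M distr P borel (\<lambda>w. h (u (X w), v (Y w)))"
proof -
  interpret P: prob_space P by fact
  interpret Q: prob_space Q by fact
  have X[measurable]: "X \<in> P \<rightarrow>\<^sub>M MX" and Y[measurable]: "Y \<in> P \<rightarrow>\<^sub>M MY" and p: "p \<in> MX \<rightarrow>\<^sub>M prob_algebra MY"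
    using rP by (auto simp: regular_cond_law_def)
  have U[measurable]: "U \<in> Q \<rightarrow>\<^sub>M MU" and V[measurable]: "V \<in> Q \<rightarrow>\<^sub>M MV" and n: "n \<in> MU \<rightarrow>\<^sub>M prob_algebra MV"
    using rQ by (auto simp: regular_cond_law_def)
  have [measurable]: "n \<in> MU \<rightarrow>\<^sub>M subprob_algebra MV" by (rule measurable_prob_algebraD[OF n])
  have sets_p: "sets (p x) = sets MY" if "x \<in> space MX" for x
    using measurable_space[OF p that] by (simp add: space_prob_algebra)
  let ?H = "\<lambda>w. h (u (X w), v (Y w))"
  have key: "emeasure P {w \<in> space P. X w \<in> A \<and> ?H w \<in> B} =
      emeasure P {w \<in> space P. X w \<in> A} * emeasure Q {w \<in> space Q. h (U w, V w) \<in> B}"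
    if A[measurable]: "A \<in> sets MX" and B[measurable]: "B \<in> sets borel" for A and B :: "real set"
  proof -
    define c where "c = emeasure Q {w \<in> space Q. h (U w, V w) \<in> B}"
    define \<phi> where "\<phi> x = (\<integral>\<^sup>+y. indicator B (h (x, y)) \<partial>n x)" for x
    have [measurable]: "\<phi> \<in> borel_measurable MU"
      unfolding \<phi>_def by (rule nn_integral_measurable_subprob_algebra2[where N = MV]) measurable
    interpret D: prob_space "distr Q MU U" by (rule Q.prob_space_distr) measurable
    have "AE x in distr Q MU U. \<phi> x = c"
    proof (rule D.density_unique_finite_measure)
      fix C assume "C \<in> sets (distr Q MU U)"
      then have C[measurable]: "C \<in> sets MU" by simp
      have "(\<integral>\<^sup>+x. \<phi> x * indicator C x \<partial>distr Q MU U) = (\<integral>\<^sup>+w. \<phi> (U w) * indicator C (U w) \<partial>Q)"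
        by (rule nn_integral_distr) measurable
      also have "\<dots> = (\<integral>\<^sup>+w. \<integral>\<^sup>+y. indicator B (h (U w, y)) * indicator C (U w) \<partial>n (U w) \<partial>Q)"
      proof (rule nn_integral_cong)
        fix w assume "w \<in> space Q"
        then have x: "U w \<in> space MU" by (rule measurable_space[OF U])
        then have s: "sets (n (U w)) = sets MV"
          using measurable_space[OF n x] by (simp add: space_prob_algebra)
        have [measurable]: "(\<lambda>y. h (U w, y)) \<in> borel_measurable (n (U w))"
          unfolding measurable_cong_sets[OF s refl] using x by measurable
        show "\<phi> (U w) * indicator C (U w) = (\<integral>\<^sup>+y. indicator B (h (U w, y)) * indicator C (U w) \<partial>n (U w))"
          unfolding \<phi>_def by (rule nn_integral_multc[symmetric]) measurable
      qed
      also have "\<dots> = (\<integral>\<^sup>+w. indicator B (h (U w, V w)) * indicator C (U w) \<partial>Q)"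
        using nn_integral_regular_cond_law[OF Q rQ, of "\<lambda>(x, y). indicator B (h (x, y)) * indicator C x"]
        by simp
      also have "\<dots> = emeasure Q {w \<in> space Q. h (U w, V w) \<in> B \<and> U w \<in> C}"
        by (rule emeasure_eq_nn_integral_indicators[symmetric]) measurable
      also have "\<dots> = emeasure (distr Q (MU \<Otimes>\<^sub>M borel) (\<lambda>w. (U w, h (U w, V w)))) (C \<times> B)"
        by (subst emeasure_distr) (auto intro!: arg_cong[of _ _ "emeasure Q"])
      also have "\<dots> = emeasure Q (U -` C \<inter> space Q) * emeasure Q ((\<lambda>w. h (U w, V w)) -` B \<inter> space Q)"
      proof -
        interpret DH: prob_space "distr Q borel (\<lambda>w. h (U w, V w))" by (rule Q.prob_space_distr) measurable
        show ?thesis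
          unfolding indep by (subst DH.emeasure_pair_measure_Times) (auto simp: emeasure_distr)
      qed
      also have "\<dots> = (\<integral>\<^sup>+x. c * indicator C x \<partial>distr Q MU U)"
        by (subst nn_integral_cmult_indicator) (auto simp: emeasure_distr c_def mult.commute vimage_def Int_def conj_commute)
      finally show "(\<integral>\<^sup>+x. \<phi> x * indicator C x \<partial>distr Q MU U) = (\<integral>\<^sup>+x. c * indicator C x \<partial>distr Q MU U)" .
    qed auto
    then have "AE x in distr P MU (\<lambda>w. u (X w)). \<phi> x = c" by (simp only: marg)
    then have ae: "AE w in P. \<phi> (u (X w)) = c"
      by (rule AE_distrD[rotated]) measurable
    have "emeasure P {w \<in> space P. X w \<in> A \<and> ?H w \<in> B} = (\<integral>\<^sup>+w. indicator A (X w) * indicator B (h (u (X w), v (Y w))) \<partial>P)"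
      by (rule emeasure_eq_nn_integral_indicators) measurable
    also have "\<dots> = (\<integral>\<^sup>+w. \<integral>\<^sup>+y. indicator A (X w) * indicator B (h (u (X w), v y)) \<partial>p (X w) \<partial>P)"
      using nn_integral_regular_cond_law[OF P rP, of "\<lambda>(x, y). indicator A x * indicator B (h (u x, v y))"]
      by simp
    also have "\<dots> = (\<integral>\<^sup>+w. c * indicator A (X w) \<partial>P)"
    proof (rule nn_integral_cong_AE, use ae proj AE_space in eventually_elim)
      fix w assume ph: "\<phi> (u (X w)) = c" and pr: "distr (p (X w)) MV v = n (u (X w))" and w: "w \<in> space P"
      have x: "X w \<in> space MX" using w by (rule measurable_space[OF X])
      note s = measurable_cong_sets[OF sets_p[OF x] refl]
      have v': "v \<in> p (X w) \<rightarrow>\<^sub>M MV" by (simp add: s)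
      have ux: "u (X w) \<in> space MU" using x by (rule measurable_space[OF u])
      then have h': "(\<lambda>y. indicator B (h (u (X w), y)) :: ennreal) \<in> borel_measurable MV" by measurable
      have "c = (\<integral>\<^sup>+y. indicator B (h (u (X w), y)) \<partial>distr (p (X w)) MV v)"
        using ph by (simp add: \<phi>_def pr)
      also have "\<dots> = (\<integral>\<^sup>+y. indicator B (h (u (X w), v y)) \<partial>p (X w))"
        by (rule nn_integral_distr[OF v']) (use h' in simp)
      finally have "c = (\<integral>\<^sup>+y. indicator B (h (u (X w), v y)) \<partial>p (X w))" .
      then show "(\<integral>\<^sup>+y. indicator A (X w) * indicator B (h (u (X w), v y)) \<partial>p (X w)) = c * indicator A (X w)"
        using measurable_compose[OF v' h'] by (simp add: nn_integral_cmult mult.commute)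
    qed
    also have "\<dots> = c * emeasure P {w \<in> space P. X w \<in> A}"
    proof -
      have "(\<integral>\<^sup>+w. c * indicator A (X w) \<partial>P) = c * (\<integral>\<^sup>+w. indicator A (X w) \<partial>P)"
        by (rule nn_integral_cmult) measurable
      also have "(\<integral>\<^sup>+w. indicator A (X w) \<partial>P) = emeasure P {w \<in> space P. X w \<in> A}"
        using emeasure_eq_nn_integral_indicators[OF X X A A] by (simp add: indicator_inter_arith[symmetric])
      finally show ?thesis .
    qed
    finally show ?thesis by (simp add: c_def mult.commute)
  qed
  have Hm[measurable]: "?H \<in> borel_measurable P" by measurable
  show ?thesis
  proof (rule pair_measure_eqI[symmetric])
    interpret DX: prob_space "distr P MX X" by (rule P.prob_space_distr) measurable
    interpret DH: prob_space "distr P borel ?H" by (rule P.prob_space_distr) measurable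
    show "sigma_finite_measure (distr P MX X)" "sigma_finite_measure (distr P borel ?H)" ..
    show "sets (distr P MX X \<Otimes>\<^sub>M distr P borel ?H) = sets (distr P (MX \<Otimes>\<^sub>M borel) (\<lambda>w. (X w, ?H w)))"
      by (simp cong: sets_pair_measure_cong)
    fix A B assume "A \<in> sets (distr P MX X)" "B \<in> sets (distr P borel ?H)"
    then have [measurable]: "A \<in> sets MX" "B \<in> sets borel" by auto
    have H: "emeasure P {w \<in> space P. ?H w \<in> B} = emeasure Q {w \<in> space Q. h (U w, V w) \<in> B}"
    proof -
      have "{w \<in> space P. ?H w \<in> B} = {w \<in> space P. X w \<in> space MX \<and> ?H w \<in> B}"
        "{w \<in> space P. X w \<in> space MX} = space P"
        using measurable_space[OF X] by auto
      then show ?thesis using key[of "space MX" B] by (simp add: P.emeasure_space_1)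
    qed
    have "emeasure (distr P MX X) A * emeasure (distr P borel ?H) B =
       emeasure P {w \<in> space P. X w \<in> A} * emeasure P {w \<in> space P. ?H w \<in> B}"
      by (simp add: emeasure_distr vimage_def Int_def conj_commute)
    also have "\<dots> = emeasure P {w \<in> space P. X w \<in> A \<and> ?H w \<in> B}"
      by (simp add: H key)
    also have "\<dots> = emeasure (distr P (MX \<Otimes>\<^sub>M borel) (\<lambda>w. (X w, ?H w))) (A \<times> B)"
      by (subst emeasure_distr) (auto intro!: arg_cong[of _ _ "emeasure P"])
    finally show "emeasure (distr P MX X) A * emeasure (distr P borel ?H) B =
       emeasure (distr P (MX \<Otimes>\<^sub>M borel) (\<lambda>w. (X w, ?H w))) (A \<times> B)" .
  qed
qed

lemma indep_var_of_product_law: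
  fixes f :: "'x \<Rightarrow> real"
  assumes P: "prob_space P" and [measurable]: "X \<in> P \<rightarrow>\<^sub>M MX" "H \<in> borel_measurable P" "f \<in> borel_measurable MX"
    and indep: "distr P (MX \<Otimes>\<^sub>M borel) (\<lambda>w. (X w, H w)) = distr P MX X \<Otimes>\<^sub>M distr P borel H"
  shows "prob_space.indep_var P borel (\<lambda>w. f (X w)) borel H"
proof -
  interpret P: prob_space P by fact
  interpret DH: prob_space "distr P borel H" by (rule P.prob_space_distr) measurable
  have "distr P borel (\<lambda>w. f (X w)) \<Otimes>\<^sub>M distr P borel H = distr (distr P MX X) borel f \<Otimes>\<^sub>M distr (distr P borel H) borel (\<lambda>x. x)"
    by (simp add: distr_distr comp_def)
  also have "\<dots> = distr (distr P MX X \<Otimes>\<^sub>M distr P borel H) (borel \<Otimes>\<^sub>M borel) (\<lambda>(x, y). (f x, y))"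
    by (rule pair_measure_distr)
      (auto simp: distr_distr comp_def DH.sigma_finite_measure_axioms)
  also have "\<dots> = distr P (borel \<Otimes>\<^sub>M borel) (\<lambda>w. (f (X w), H w))"
    unfolding indep[symmetric] by (simp add: distr_distr comp_def)
  finally show ?thesis
    unfolding P.indep_var_distribution_eq by simp
qed

section \<open>Relative entropy\<close>

lemma nn_integral_pos_minus_neg:
  fixes f :: "'a \<Rightarrow> real"
  assumes "integrable M f"
  shows "enn2ereal (\<integral>\<^sup>+x. ennreal (f x) \<partial>M) - enn2ereal (\<integral>\<^sup>+x. ennreal (- f x) \<partial>M) = ereal (\<integral>x. f x \<partial>M)"
proof -
  have fin: "(\<integral>\<^sup>+x. ennreal (f x) \<partial>M) < top" "(\<integral>\<^sup>+x. ennreal (- f x) \<partial>M) < top"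
    using assms unfolding real_integrable_def by (auto simp: top.not_eq_extremum)
  have "enn2ereal t = ereal (enn2real t)" if "t < top" for t
    using that by (cases t) (auto simp: enn2ereal_ennreal)
  from this[OF fin(1)] this[OF fin(2)] show ?thesis
    using real_lebesgue_integral_def[OF assms] by simp
qed

lemma entropy_density_exp_1: "entropy_density (exp 1) R P x = ln (enn2real (RN_deriv R P x))"
  by (simp add: entropy_density_def log_def)

lemma kl_div_density:
  fixes g :: "'a \<Rightarrow> real"
  assumes R: "sigma_finite_measure R" and [measurable]: "g \<in> borel_measurable R"
    and P: "P = density R (\<lambda>x. ennreal (exp (g x)))" and int: "integrable P g"
  shows "kl_div P R = ereal (\<integral>x. g x \<partial>P)"
proof -
  interpret R: sigma_finite_measure R by fact
  have ac: "absolutely_continuous R P"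
    unfolding P by (rule absolutely_continuousI_density) measurable
  have "density R (RN_deriv R P) = P"
    by (rule R.density_RN_deriv[OF ac]) (simp add: P)
  then have "density R (RN_deriv R P) = density R (\<lambda>x. ennreal (exp (g x)))"
    by (simp add: P)
  then have "AE x in R. RN_deriv R P x = ennreal (exp (g x))"
    by (intro R.density_unique) measurable
  then have "AE x in R. entropy_density (exp 1) R P x = g x"
    by eventually_elim (simp add: entropy_density_exp_1)
  then have ae: "AE x in P. entropy_density (exp 1) R P x = g x"
    unfolding P by (subst AE_density) auto
  have "(\<integral>\<^sup>+x. ennreal (entropy_density (exp 1) R P x) \<partial>P) = (\<integral>\<^sup>+x. ennreal (g x) \<partial>P)"
    by (rule nn_integral_cong_AE) (use ae in eventually_elim, simp)
  moreover have "(\<integral>\<^sup>+x. ennreal (- entropy_density (exp 1) R P x) \<partial>P) = (\<integral>\<^sup>+x. ennreal (- g x) \<partial>P)"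
    by (rule nn_integral_cong_AE) (use ae in eventually_elim, simp)
  ultimately show ?thesis
    using ac nn_integral_pos_minus_neg[OF int] by (simp add: kl_div_def)
qed

text \<open>
  The easy half of the Donsker-Varadhan formula. With \<open>f\<close> the density of \<open>P\<close>, the inequality
  \<open>ln t \<le> t - 1\<close> at \<open>t = exp g / f\<close> gives \<open>ln f \<ge> g + 1 - exp g / f\<close>, and the last term has \<open>P\<close>-integral at most 1.
  The integrable minorant also shows that the negative part of \<open>ln f\<close> has finite integral, so that the entropy
  is the integral of \<open>ln f\<close> or \<open>\<infinity>\<close>.
\<close>

lemma kl_div_ge:
  fixes g :: "'a \<Rightarrow> real"
  assumes R: "sigma_finite_measure R" and P: "prob_space P" and sets: "sets P = sets R"
    and g[measurable]: "g \<in> borel_measurable R" and int: "integrable P g"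
    and le1: "(\<integral>\<^sup>+x. ennreal (exp (g x)) \<partial>R) \<le> 1"
  shows "ereal (\<integral>x. g x \<partial>P) \<le> kl_div P R"
proof (cases "absolutely_continuous R P")
  case False
  then show ?thesis by (simp add: kl_div_def)
next
  case ac: True
  interpret R: sigma_finite_measure R by fact
  interpret P: prob_space P by fact
  note [measurable_cong] = sets
  define D where "D = RN_deriv R P"
  have [measurable]: "D \<in> borel_measurable R" by (simp add: D_def)
  have PD: "P = density R D"
    unfolding D_def by (rule R.density_RN_deriv[OF ac sets, symmetric])
  have fin: "AE x in R. D x \<noteq> \<infinity>"
    unfolding D_def by (rule R.RN_deriv_finite[OF P.sigma_finite_measure_axioms ac sets])
  define f where "f x = enn2real (D x)" for x
  have [measurable]: "f \<in> borel_measurable R" unfolding f_def by measurable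
  have pos: "AE x in P. 0 < f x"
  proof -
    have "AE x in R. 0 < D x \<longrightarrow> 0 < f x"
      using fin by eventually_elim (auto simp: f_def enn2real_positive_iff less_top)
    then show ?thesis unfolding PD by (subst AE_density) auto
  qed
  define r where "r x = exp (g x) / f x" for x
  have [measurable]: "r \<in> borel_measurable R" unfolding r_def by measurable
  have r_nonneg: "0 \<le> r x" for x by (simp add: r_def f_def)
  have "(\<integral>\<^sup>+x. ennreal (r x) \<partial>P) = (\<integral>\<^sup>+x. D x * ennreal (r x) \<partial>R)"
    unfolding PD by (rule nn_integral_density) measurable
  also have "\<dots> \<le> (\<integral>\<^sup>+x. ennreal (exp (g x)) \<partial>R)"
  proof (rule nn_integral_mono_AE, use fin in eventually_elim)
    fix x assume "D x \<noteq> \<infinity>"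
    then have "D x = ennreal (f x)" by (simp add: f_def less_top)
    then have "D x * ennreal (r x) = ennreal (f x * r x)"
      by (simp add: ennreal_mult r_nonneg f_def)
    also have "f x * r x \<le> exp (g x)" by (simp add: r_def)
    finally show "D x * ennreal (r x) \<le> ennreal (exp (g x))" by (simp add: ennreal_leI)
  qed
  also note le1
  finally have r_le: "(\<integral>\<^sup>+x. ennreal (r x) \<partial>P) \<le> 1" .
  have r_int: "integrable P r"
    by (rule integrableI_nonneg) (use r_nonneg r_le in \<open>auto intro: le_less_trans\<close>)
  have r_le1: "(\<integral>x. r x \<partial>P) \<le> 1"
  proof -
    have "ennreal (\<integral>x. r x \<partial>P) \<le> ennreal 1"
      using nn_integral_eq_integral[OF r_int] r_nonneg r_le by simp
    then show ?thesis by (subst (asm) ennreal_le_iff) auto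
  qed
  define h where "h x = g x + 1 - r x" for x
  have h_int: "integrable P h" unfolding h_def using int r_int by simp
  have h_ge: "(\<integral>x. g x \<partial>P) \<le> (\<integral>x. h x \<partial>P)"
    unfolding h_def using int r_int r_le1 by (simp add: P.prob_space)
  let ?l = "entropy_density (exp 1) R P"
  have l: "?l x = ln (f x)" for x by (simp add: entropy_density_exp_1 f_def D_def)
  have [measurable]: "?l \<in> borel_measurable P"
    using measurable_entropy_density[of "exp 1" R P] by simp
  have lh: "AE x in P. h x \<le> ?l x"
    using pos
  proof eventually_elim
    fix x assume "0 < f x"
    then have "ln (exp (g x) / f x) \<le> exp (g x) / f x - 1"
      by (intro ln_le_minus_one) simp
    with \<open>0 < f x\<close> show "h x \<le> ?l x"
      by (simp add: l h_def r_def ln_div)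
  qed
  have neg_fin: "(\<integral>\<^sup>+x. ennreal (- ?l x) \<partial>P) < \<infinity>"
  proof -
    have "(\<integral>\<^sup>+x. ennreal (- ?l x) \<partial>P) \<le> (\<integral>\<^sup>+x. ennreal (- h x) \<partial>P)"
      by (rule nn_integral_mono_AE) (use lh in eventually_elim, auto intro: ennreal_leI)
    also have "\<dots> < \<infinity>"
      using h_int unfolding real_integrable_def by (auto simp: less_top)
    finally show ?thesis .
  qed
  show ?thesis
  proof (cases "(\<integral>\<^sup>+x. ennreal (?l x) \<partial>P) = \<infinity>")
    case True
    then show ?thesis using ac neg_fin by (simp add: kl_div_def)
  next
    case False
    then have l_int: "integrable P ?l"
      using neg_fin by (auto simp: real_integrable_def)
    have "(\<integral>x. h x \<partial>P) \<le> (\<integral>x. ?l x \<partial>P)"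
      by (rule integral_mono_AE[OF h_int l_int lh])
    then show ?thesis
      using h_ge nn_integral_pos_minus_neg[OF l_int] ac by (simp add: kl_div_def)
  qed
qed

section \<open>Correlated Gaussian pairs\<close>

definition corr_map :: "('n \<Rightarrow> real) \<Rightarrow> real ^ 'n \<Rightarrow> real ^ 'n \<Rightarrow> real ^ 'n" where
  "corr_map d z w = (\<chi> p. d p * z $ p + sqrt (1 - (d p)\<^sup>2) * w $ p)"

definition corr_gaussian :: "('n \<Rightarrow> real) \<Rightarrow> ((real ^ 'n) \<times> (real ^ 'n)) measure" where
  "corr_gaussian d = distr (std_gaussian \<Otimes>\<^sub>M std_gaussian) (borel \<Otimes>\<^sub>M borel) (\<lambda>(z, w). (z, corr_map d z w))"

text \<open>
  The sum over the coordinates of the log-density of a bivariate normal law with standard marginals and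
  correlation \<open>d p\<close>, relative to the product of its marginals.
\<close>

definition corr_log_density :: "('n \<Rightarrow> real) \<Rightarrow> (real ^ 'n) \<times> (real ^ 'n) \<Rightarrow> real" where
  "corr_log_density d = (\<lambda>(z, y). \<Sum>p\<in>UNIV. - ln (1 - (d p)\<^sup>2) / 2
      - ((d p)\<^sup>2 * (z $ p)\<^sup>2 - 2 * d p * (z $ p * y $ p) + (d p)\<^sup>2 * (y $ p)\<^sup>2) / (2 * (1 - (d p)\<^sup>2)))"

lemma borel_measurable_corr_map [measurable (raw)]:
  "f \<in> borel_measurable M \<Longrightarrow> g \<in> borel_measurable M \<Longrightarrow> (\<lambda>x. corr_map d (f x) (g x)) \<in> borel_measurable M"
  unfolding corr_map_def by (rule borel_measurable_vec_lambda) (intro borel_measurable_add borel_measurable_times borel_measurable_const borel_measurable_vec_nth_comp)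

lemma borel_measurable_corr_log_density [measurable]:
  "corr_log_density d \<in> borel_measurable (borel \<Otimes>\<^sub>M borel)"
  unfolding corr_log_density_def split_beta' by measurable

lemma sets_corr_gaussian [simp, measurable_cong]: "sets (corr_gaussian d) = sets (borel \<Otimes>\<^sub>M borel)"
  by (simp add: corr_gaussian_def)

lemma prob_space_std_gaussian_pair: "prob_space (std_gaussian \<Otimes>\<^sub>M std_gaussian)"
  by (intro prob_space_pair prob_space_std_gaussian)

lemma prob_space_corr_gaussian: "prob_space (corr_gaussian d)"
  unfolding corr_gaussian_def
  by (rule prob_space.prob_space_distr[OF prob_space_std_gaussian_pair]) measurable

lemma resampling_std_gaussian: "resampling std_gaussian (splice J)"
  unfolding resampling_def
proof
  show "(\<lambda>(z, z'). splice J z z') \<in> std_gaussian \<Otimes>\<^sub>M std_gaussian \<rightarrow>\<^sub>M std_gaussian"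
    by measurable
  show "distr (std_gaussian \<Otimes>\<^sub>M std_gaussian) std_gaussian (\<lambda>(z, z'). splice J z z') = std_gaussian"
    by (subst (4) std_gaussian_splice[symmetric, of J]) (rule distr_cong, auto)
qed

lemma resampling_corr_gaussian:
  "resampling (corr_gaussian d) (\<lambda>(x, y) (x', y'). (splice J x x', splice J y y'))"
  unfolding corr_gaussian_def
  by (rule resampling_distr[OF prob_space_std_gaussian_pair
        resampling_pair[OF prob_space_std_gaussian resampling_std_gaussian[of J] prob_space_std_gaussian resampling_std_gaussian[of J]]])
     (auto simp: split_beta' corr_map_def vec_eq_iff)

text \<open>
  Both sides are integrals against the conditional law of the second component given that the first one is \<open>z\<close>.
  The substitution \<open>y = d z + sqrt (1 - d\<^sup>2) w\<close> is affine in \<open>w\<close>, and completing the square in each coordinate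
  turns the product of the densities into the standard Gaussian density of \<open>w\<close>.
\<close>

lemma nn_integral_corr_map:
  assumes d: "\<And>p. \<bar>d p\<bar> < 1" and [measurable]: "h \<in> borel_measurable borel"
  shows "(\<integral>\<^sup>+w. h (corr_map d z w) \<partial>std_gaussian) =
     (\<integral>\<^sup>+y. ennreal (exp (corr_log_density d (z, y))) * h y \<partial>(std_gaussian :: (real ^ 'n) measure))"
proof -
  have d1: "0 < 1 - (d p)\<^sup>2" for p
    using d[of p] by (simp add: abs_square_less_1)
  have divide_through: "Y / 2 + Q / (2 * c) = W / 2" if "0 < c" "c * Y + Q = c * W" for c Y Q W :: real
    using that by (simp add: field_simps)
  let ?\<phi> = "\<lambda>x :: real ^ 'n. ennreal (exp (- (x \<bullet> x) / 2) / sqrt (2 * pi) ^ CARD('n))"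
  define m :: "real ^ 'n" where "m = (\<chi> p. d p * z $ p)"
  define S :: "real ^ 'n ^ 'n" where "S = (\<chi> i j. if i = j then sqrt (1 - (d i)\<^sup>2) else 0)"
  have mS: "m + S *v w = corr_map d z w" for w
    by (simp add: vec_eq_iff m_def S_def corr_map_def matrix_vector_mult_def if_distrib[of "\<lambda>a. a * _"] cong: if_cong)
  have detS: "det S = (\<Prod>p\<in>UNIV. sqrt (1 - (d p)\<^sup>2))"
    by (subst det_diagonal) (auto simp: S_def)
  have detS_pos: "0 < det S"
    unfolding detS by (rule prod_pos) (use d1 in auto)
  have detS_exp: "det S = exp (\<Sum>p\<in>UNIV. ln (1 - (d p)\<^sup>2) / 2)"
    unfolding detS exp_sum[OF finite]
  proof (rule prod.cong[OF refl])
    fix p show "sqrt (1 - (d p)\<^sup>2) = exp (ln (1 - (d p)\<^sup>2) / 2)"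
      using d1[of p] ln_sqrt[OF less_imp_le[OF d1[of p]]] by (metis exp_ln real_sqrt_gt_zero)
  qed
  have expo: "(\<Sum>p\<in>UNIV. ln (1 - (d p)\<^sup>2) / 2) + (- (corr_map d z w \<bullet> corr_map d z w) / 2 + corr_log_density d (z, corr_map d z w))
      = - (w \<bullet> w) / 2" for w
  proof -
    have "ln (1 - (d p)\<^sup>2) / 2 + (- (corr_map d z w $ p)\<^sup>2 / 2 + (- ln (1 - (d p)\<^sup>2) / 2
      - ((d p)\<^sup>2 * (z $ p)\<^sup>2 - 2 * d p * (z $ p * corr_map d z w $ p) + (d p)\<^sup>2 * (corr_map d z w $ p)\<^sup>2) / (2 * (1 - (d p)\<^sup>2))))
      = - (w $ p)\<^sup>2 / 2" for p
    proof -
      define y where "y = corr_map d z w $ p"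
      have y: "y - d p * z $ p = sqrt (1 - (d p)\<^sup>2) * w $ p"
        by (simp add: y_def corr_map_def)
      have "(y - d p * z $ p)\<^sup>2 = (1 - (d p)\<^sup>2) * (w $ p)\<^sup>2"
        unfolding y power_mult_distrib using d1[of p] by simp
      then have "(1 - (d p)\<^sup>2) * y\<^sup>2 + ((d p)\<^sup>2 * (z $ p)\<^sup>2 - 2 * d p * (z $ p * y) + (d p)\<^sup>2 * y\<^sup>2) = (1 - (d p)\<^sup>2) * (w $ p)\<^sup>2"
        by (simp add: power2_eq_square algebra_simps)
      then have "y\<^sup>2 / 2 + ((d p)\<^sup>2 * (z $ p)\<^sup>2 - 2 * d p * (z $ p * y) + (d p)\<^sup>2 * y\<^sup>2) / (2 * (1 - (d p)\<^sup>2)) = (w $ p)\<^sup>2 / 2"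
        by (rule divide_through[OF d1])
      then show ?thesis unfolding y_def[symmetric] by linarith
    qed
    then have "(\<Sum>p\<in>UNIV. ln (1 - (d p)\<^sup>2) / 2 + (- (corr_map d z w $ p)\<^sup>2 / 2 + (- ln (1 - (d p)\<^sup>2) / 2
      - ((d p)\<^sup>2 * (z $ p)\<^sup>2 - 2 * d p * (z $ p * corr_map d z w $ p) + (d p)\<^sup>2 * (corr_map d z w $ p)\<^sup>2) / (2 * (1 - (d p)\<^sup>2)))))
      = (\<Sum>p\<in>UNIV. - (w $ p)\<^sup>2 / 2)" by simp
    then show ?thesis
      unfolding corr_log_density_def inner_vec_def prod.case sum.distrib
      by (simp only: inner_real_def power2_eq_square sum_negf[symmetric] sum_divide_distrib minus_divide_left)
  qed
  \<comment> \<open>Jacobian times transformed densities equals the standard Gaussian density of \<open>w\<close>.\<close>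
  have pw: "ennreal \<bar>det S\<bar> * (?\<phi> (m + S *v w) * (ennreal (exp (corr_log_density d (z, m + S *v w))) * h (m + S *v w))) = ?\<phi> w * h (corr_map d z w)" for w
  proof -
    have "\<bar>det S\<bar> * (exp (- (corr_map d z w \<bullet> corr_map d z w) / 2) / sqrt (2 * pi) ^ CARD('n)) * exp (corr_log_density d (z, corr_map d z w))
       = exp ((\<Sum>p\<in>UNIV. ln (1 - (d p)\<^sup>2) / 2) + (- (corr_map d z w \<bullet> corr_map d z w) / 2 + corr_log_density d (z, corr_map d z w))) / sqrt (2 * pi) ^ CARD('n)"
      using detS_pos by (simp only: exp_add detS_exp[symmetric]) simp
    then show ?thesis
      unfolding mS expo
      by (simp add: mult.assoc[symmetric] ennreal_mult'[symmetric] del: times_divide_eq_right times_divide_eq_left)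
  qed
  have "(\<integral>\<^sup>+y. ennreal (exp (corr_log_density d (z, y))) * h y \<partial>std_gaussian) =
     (\<integral>\<^sup>+y. ?\<phi> y * (ennreal (exp (corr_log_density d (z, y))) * h y) \<partial>lborel)"
    unfolding std_gaussian_eq_density by (rule nn_integral_density) measurable
  also have "\<dots> = ennreal \<bar>det S\<bar> * (\<integral>\<^sup>+w. ?\<phi> (m + S *v w) * (ennreal (exp (corr_log_density d (z, m + S *v w))) * h (m + S *v w)) \<partial>lborel)"
    by (rule nn_integral_lborel_affine[symmetric]) (use detS_pos in \<open>measurable, simp\<close>)
  also have "\<dots> = (\<integral>\<^sup>+w. ennreal \<bar>det S\<bar> * (?\<phi> (m + S *v w) * (ennreal (exp (corr_log_density d (z, m + S *v w))) * h (m + S *v w))) \<partial>lborel)"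
    by (rule nn_integral_cmult[symmetric]) measurable
  also have "\<dots> = (\<integral>\<^sup>+w. ?\<phi> w * h (corr_map d z w) \<partial>lborel)"
    by (simp only: pw)
  also have "\<dots> = (\<integral>\<^sup>+w. h (corr_map d z w) \<partial>std_gaussian)"
    unfolding std_gaussian_eq_density by (rule nn_integral_density[symmetric]) measurable
  finally show ?thesis ..
qed

lemma corr_gaussian_eq_density:
  fixes d :: "'n::finite \<Rightarrow> real"
  assumes d: "\<And>p. \<bar>d p\<bar> < 1"
  shows "corr_gaussian d = density (std_gaussian \<Otimes>\<^sub>M std_gaussian) (\<lambda>x. ennreal (exp (corr_log_density d x)))"
proof (rule measure_eqI)
  interpret N: prob_space "std_gaussian :: (real ^ 'n) measure" by (rule prob_space_std_gaussian)
  have sets_pair[measurable_cong, simp]: "sets (std_gaussian \<Otimes>\<^sub>M std_gaussian) = sets (borel \<Otimes>\<^sub>M borel :: ((real^'n) \<times> (real^'n)) measure)"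
    by (intro sets_pair_measure_cong) simp_all
  show "sets (corr_gaussian d) = sets (density (std_gaussian \<Otimes>\<^sub>M std_gaussian) (\<lambda>x. ennreal (exp (corr_log_density d x))))"
    by simp
  fix A assume "A \<in> sets (corr_gaussian d)"
  then have A[measurable]: "A \<in> sets (borel \<Otimes>\<^sub>M borel)" by simp
  have "emeasure (corr_gaussian d) A = (\<integral>\<^sup>+x. indicator A ((\<lambda>(z, w). (z, corr_map d z w)) x) \<partial>(std_gaussian \<Otimes>\<^sub>M std_gaussian))"
    unfolding corr_gaussian_def
    by (simp add: nn_integral_indicator[symmetric] nn_integral_distr del: nn_integral_indicator)
  also have "\<dots> = (\<integral>\<^sup>+z. \<integral>\<^sup>+w. indicator A (z, corr_map d z w) \<partial>std_gaussian \<partial>std_gaussian)"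
    by (subst N.nn_integral_fst[symmetric]) auto
  also have "\<dots> = (\<integral>\<^sup>+z. \<integral>\<^sup>+y. ennreal (exp (corr_log_density d (z, y))) * indicator A (z, y) \<partial>std_gaussian \<partial>std_gaussian)"
    by (rule nn_integral_cong, rule nn_integral_corr_map[OF d]) measurable
  also have "\<dots> = (\<integral>\<^sup>+x. ennreal (exp (corr_log_density d x)) * indicator A x \<partial>(std_gaussian \<Otimes>\<^sub>M std_gaussian))"
    by (subst N.nn_integral_fst[symmetric]) auto
  also have "\<dots> = emeasure (density (std_gaussian \<Otimes>\<^sub>M std_gaussian) (\<lambda>x. ennreal (exp (corr_log_density d x)))) A"
    by (rule emeasure_density[symmetric]) simp_all
  finally show "emeasure (corr_gaussian d) A = emeasure (density (std_gaussian \<Otimes>\<^sub>M std_gaussian) (\<lambda>x. ennreal (exp (corr_log_density d x)))) A" .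
qed

lemma distr_fst_corr_gaussian:
  fixes d :: "'n::finite \<Rightarrow> real"
  shows "distr (corr_gaussian d) borel fst = std_gaussian"
proof -
  interpret N: prob_space "std_gaussian :: (real ^ 'n) measure" by (rule prob_space_std_gaussian)
  have "distr (corr_gaussian d) borel fst = distr (std_gaussian \<Otimes>\<^sub>M std_gaussian) std_gaussian (fst :: (real ^ 'n) \<times> (real ^ 'n) \<Rightarrow> _)"
    unfolding corr_gaussian_def by (subst distr_distr) (auto simp: comp_def split_beta' intro!: distr_cong)
  also have "\<dots> = std_gaussian"
    by (rule N.distr_pair_fst)
  finally show ?thesis .
qed

text \<open>
  The definition favours the first component, but the density is symmetric, so both marginals agree.
\<close>

lemma corr_gaussian_coupling:
  fixes d :: "'n::finite \<Rightarrow> real"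
  assumes d: "\<And>p. \<bar>d p\<bar> < 1"
  shows "corr_gaussian d \<in> couplings std_gaussian std_gaussian"
proof -
  interpret N: prob_space "std_gaussian :: (real ^ 'n) measure" by (rule prob_space_std_gaussian)
  interpret NN: pair_sigma_finite "std_gaussian :: (real ^ 'n) measure" "std_gaussian :: (real ^ 'n) measure" ..
  have sets_pair[measurable_cong, simp]: "sets (std_gaussian \<Otimes>\<^sub>M std_gaussian) = sets (borel \<Otimes>\<^sub>M borel :: ((real^'n) \<times> (real^'n)) measure)"
    by (intro sets_pair_measure_cong) simp_all
  let ?NN = "std_gaussian \<Otimes>\<^sub>M std_gaussian :: ((real ^ 'n) \<times> (real ^ 'n)) measure"
  let ?swap = "\<lambda>(x :: real ^ 'n, y :: real ^ 'n). (y, x)"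
  have sym: "corr_log_density d (y, x) = corr_log_density d (x, y)" for x y
    unfolding corr_log_density_def by (simp add: algebra_simps)
  have "corr_gaussian d = density (distr ?NN ?NN ?swap) (\<lambda>x. ennreal (exp (corr_log_density d x)))"
    using corr_gaussian_eq_density[OF d] NN.distr_pair_swap by simp
  also have "\<dots> = distr (density ?NN (\<lambda>x. ennreal (exp (corr_log_density d (?swap x))))) ?NN ?swap"
    by (rule density_distr) measurable
  also have "\<dots> = distr (corr_gaussian d) ?NN ?swap"
    by (simp add: corr_gaussian_eq_density[OF d] split_beta' sym)
  finally have swap: "corr_gaussian d = distr (corr_gaussian d) ?NN ?swap" .
  have "distr (corr_gaussian d) borel snd = distr (corr_gaussian d) borel fst"
    by (subst swap) (simp add: distr_distr comp_def split_beta')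
  then have "distr (corr_gaussian d) std_gaussian snd = std_gaussian" "distr (corr_gaussian d) std_gaussian fst = std_gaussian"
    using distr_fst_corr_gaussian[of d] by (simp_all cong: distr_cong)
  then show ?thesis
    by (simp add: couplings_def prob_space_corr_gaussian)
qed

section \<open>Second moments of Gaussian couplings\<close>

lemma has_bochner_integral_distr_iff:
  assumes [measurable]: "g \<in> M \<rightarrow>\<^sub>M R" "f \<in> borel_measurable R"
  shows "has_bochner_integral (distr M R g) f x \<longleftrightarrow> has_bochner_integral M (\<lambda>w. f (g w) :: real) x"
  by (simp add: has_bochner_integral_iff integrable_distr_eq integral_distr)

lemma integrable_mult_of_squares:
  fixes f g :: "'a \<Rightarrow> real"
  assumes [measurable]: "f \<in> borel_measurable M" "g \<in> borel_measurable M"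
    and "integrable M (\<lambda>x. (f x)\<^sup>2)" "integrable M (\<lambda>x. (g x)\<^sup>2)"
  shows "integrable M (\<lambda>x. f x * g x)"
proof (rule Bochner_Integration.integrable_bound)
  show "integrable M (\<lambda>x. (f x)\<^sup>2 + (g x)\<^sup>2)" using assms by simp
  show "AE x in M. norm (f x * g x) \<le> norm ((f x)\<^sup>2 + (g x)\<^sup>2)"
  proof (rule AE_I2)
    fix x
    have "0 \<le> (\<bar>f x\<bar> - \<bar>g x\<bar>)\<^sup>2" by simp
    then have "2 * (\<bar>f x\<bar> * \<bar>g x\<bar>) \<le> (f x)\<^sup>2 + (g x)\<^sup>2"
      by (simp add: power2_diff)
    moreover have "0 \<le> \<bar>f x\<bar> * \<bar>g x\<bar>" by simp
    ultimately have "\<bar>f x\<bar> * \<bar>g x\<bar> \<le> (f x)\<^sup>2 + (g x)\<^sup>2" by linarith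
    then show "norm (f x * g x) \<le> norm ((f x)\<^sup>2 + (g x)\<^sup>2)"
      by (simp add: abs_mult)
  qed
qed measurable

lemma couplings_std_gaussianD:
  assumes "P \<in> couplings std_gaussian std_gaussian"
  shows "prob_space P" "sets P = sets (borel \<Otimes>\<^sub>M borel)"
    "distr P borel fst = std_gaussian" "distr P borel snd = std_gaussian"
proof -
  have "sets (std_gaussian \<Otimes>\<^sub>M std_gaussian) = sets (borel \<Otimes>\<^sub>M borel)"
    by (intro sets_pair_measure_cong) simp_all
  moreover have "distr P std_gaussian fst = distr P borel fst" "distr P std_gaussian snd = distr P borel snd"
    by (auto intro!: distr_cong)
  ultimately show "prob_space P" "sets P = sets (borel \<Otimes>\<^sub>M borel)"
    "distr P borel fst = std_gaussian" "distr P borel snd = std_gaussian"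
    using assms unfolding couplings_def by auto
qed

lemma has_bochner_integral_coupling:
  fixes f :: "real ^ 'n \<Rightarrow> real"
  assumes P: "P \<in> couplings std_gaussian std_gaussian" and f: "has_bochner_integral std_gaussian f x"
  shows "has_bochner_integral P (\<lambda>u. f (fst u)) x" "has_bochner_integral P (\<lambda>u. f (snd u)) x"
proof -
  note D = couplings_std_gaussianD[OF P]
  note [measurable_cong] = D(2)
  have [measurable]: "f \<in> borel_measurable borel"
    using borel_measurable_has_bochner_integral[OF f] by simp
  show "has_bochner_integral P (\<lambda>u. f (fst u)) x"
    using f D(3) has_bochner_integral_distr_iff[of fst P borel f x] by simp
  show "has_bochner_integral P (\<lambda>u. f (snd u)) x"
    using f D(4) has_bochner_integral_distr_iff[of snd P borel f x] by simp
qed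

lemma integrable_coupling_mult:
  fixes P :: "((real ^ 'n) \<times> (real ^ 'n)) measure"
  assumes P: "P \<in> couplings std_gaussian std_gaussian"
  shows "integrable P (\<lambda>u. fst u $ p * snd u $ q)"
proof (rule integrable_mult_of_squares)
  note [measurable_cong] = couplings_std_gaussianD(2)[OF P]
  show "(\<lambda>u. fst u $ p) \<in> borel_measurable P" "(\<lambda>u. snd u $ q) \<in> borel_measurable P" by measurable
  have "has_bochner_integral (std_gaussian :: (real ^ 'n) measure) (\<lambda>z. (z $ r)\<^sup>2) 1" for r
    using std_gaussian_moments[of r] by (simp add: has_bochner_integral_iff)
  from has_bochner_integral_coupling[OF P this]
  show "integrable P (\<lambda>u. (fst u $ p)\<^sup>2)" "integrable P (\<lambda>u. (snd u $ q)\<^sup>2)"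
    by (auto simp: has_bochner_integral_iff)
qed

text \<open>
  Makes the independent pair an instance of the correlated one, so that facts on couplings apply to it.
\<close>

lemma corr_gaussian_zero: "corr_gaussian (\<lambda>_::'n::finite. 0) = std_gaussian \<Otimes>\<^sub>M std_gaussian"
proof -
  have "(\<lambda>(z :: real ^ 'n, w). (z, corr_map (\<lambda>_. 0) z w)) = (\<lambda>x. x)"
    by (auto simp: corr_map_def)
  then have "corr_gaussian (\<lambda>_::'n::finite. 0) = distr (std_gaussian \<Otimes>\<^sub>M std_gaussian) (borel \<Otimes>\<^sub>M borel) (\<lambda>x. x)"
    unfolding corr_gaussian_def by simp
  also have "\<dots> = std_gaussian \<Otimes>\<^sub>M std_gaussian"
    by (rule distr_id2) (intro sets_pair_measure_cong, simp_all)
  finally show ?thesis .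
qed

lemma std_gaussian_pair_coupling:
  "std_gaussian \<Otimes>\<^sub>M std_gaussian \<in> couplings (std_gaussian :: (real ^ 'n) measure) (std_gaussian :: (real ^ 'n) measure)"
  using corr_gaussian_coupling[of "\<lambda>_::'n. 0"] by (simp add: corr_gaussian_zero)

lemma has_bochner_integral_std_gaussian_pair:
  "has_bochner_integral ((std_gaussian :: (real ^ 'n) measure) \<Otimes>\<^sub>M (std_gaussian :: (real ^ 'n) measure))
     (\<lambda>u. fst u $ p * snd u $ q) 0"
proof -
  interpret N: prob_space "std_gaussian :: (real ^ 'n) measure" by (rule prob_space_std_gaussian)
  interpret NN: pair_sigma_finite "std_gaussian :: (real ^ 'n) measure" "std_gaussian :: (real ^ 'n) measure" ..
  have int: "integrable (std_gaussian \<Otimes>\<^sub>M std_gaussian) (\<lambda>u :: (real ^ 'n) \<times> (real ^ 'n). fst u $ p * snd u $ q)"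
    by (rule integrable_coupling_mult[OF std_gaussian_pair_coupling])
  have "(\<integral>u. fst u $ p * snd u $ q \<partial>((std_gaussian :: (real ^ 'n) measure) \<Otimes>\<^sub>M (std_gaussian :: (real ^ 'n) measure))) = 0"
    by (subst NN.integral_fst'[OF int, symmetric]) (simp add: std_gaussian_moments)
  with int show ?thesis by (simp add: has_bochner_integral_iff)
qed

lemma has_bochner_integral_std_gaussian_nth:
  "has_bochner_integral std_gaussian (\<lambda>z :: real ^ 'n. z $ p) 0"
  using std_gaussian_moments[of p] by (simp add: has_bochner_integral_iff)

text \<open>
  Resampling all coordinates but \<open>p\<close> makes \<open>z $ p\<close> and \<open>z $ q\<close> components of independent copies.
\<close>

lemma has_bochner_integral_std_gaussian_mult:
  "has_bochner_integral std_gaussian (\<lambda>z :: real ^ 'n. z $ p * z $ q) (if p = q then 1 else 0)"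
proof (cases "p = q")
  case True
  then show ?thesis
    using std_gaussian_moments[of p] by (simp add: has_bochner_integral_iff power2_eq_square)
next
  case False
  have "has_bochner_integral (std_gaussian \<Otimes>\<^sub>M std_gaussian)
      (\<lambda>w. (\<lambda>z :: real ^ 'n. z $ p * z $ q) ((\<lambda>(z, z'). splice {p} z z') w)) 0"
    using has_bochner_integral_std_gaussian_pair[of p q] False by (simp add: split_beta')
  then have "has_bochner_integral (distr (std_gaussian \<Otimes>\<^sub>M std_gaussian) borel (\<lambda>(z, z'). splice {p} z z'))
      (\<lambda>z :: real ^ 'n. z $ p * z $ q) 0"
    by (subst has_bochner_integral_distr_iff) auto
  with False show ?thesis by (simp add: std_gaussian_splice)
qed

lemma corr_gaussian_correlation:
  fixes d :: "'n::finite \<Rightarrow> real"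
  assumes "\<And>p. \<bar>d p\<bar> < 1"
  shows "(\<integral>u. fst u $ p * snd u $ p \<partial>corr_gaussian d) = d p"
proof -
  let ?N2 = "std_gaussian \<Otimes>\<^sub>M std_gaussian :: ((real ^ 'n) \<times> (real ^ 'n)) measure"
  have 1: "has_bochner_integral ?N2 (\<lambda>u. fst u $ p * fst u $ p) 1"
    using has_bochner_integral_coupling(1)[OF std_gaussian_pair_coupling has_bochner_integral_std_gaussian_mult[of p p]] by simp
  have "has_bochner_integral ?N2 (\<lambda>u. d p * (fst u $ p * fst u $ p) + sqrt (1 - (d p)\<^sup>2) * (fst u $ p * snd u $ p)) (d p * 1 + sqrt (1 - (d p)\<^sup>2) * 0)"
    by (intro has_bochner_integral_add has_bochner_integral_mult_right 1 has_bochner_integral_std_gaussian_pair)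
  then have "has_bochner_integral ?N2 (\<lambda>w. (\<lambda>u. fst u $ p * snd u $ p) ((\<lambda>(z, w). (z, corr_map d z w)) w)) (d p)"
    by (simp add: split_beta' corr_map_def algebra_simps)
  then have "has_bochner_integral (corr_gaussian d) (\<lambda>u. fst u $ p * snd u $ p) (d p)"
    unfolding corr_gaussian_def by (subst has_bochner_integral_distr_iff) auto
  then show ?thesis by (simp add: has_bochner_integral_iff)
qed

text \<open>
  The squares integrate to 1 under every coupling, so only the mixed moments are left, and they enter linearly.
\<close>

lemma has_bochner_integral_corr_log_density:
  fixes d :: "'n::finite \<Rightarrow> real"
  assumes P: "P \<in> couplings std_gaussian std_gaussian" and d: "\<And>p. \<bar>d p\<bar> < 1"
  shows "has_bochner_integral P (corr_log_density d)
    (\<Sum>p\<in>UNIV. - ln (1 - (d p)\<^sup>2) / 2 + d p * ((\<integral>u. fst u $ p * snd u $ p \<partial>P) - d p) / (1 - (d p)\<^sup>2))"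
proof -
  interpret prob_space P by (rule couplings_std_gaussianD[OF P])
  define r where "r p = (\<integral>u. fst u $ p * snd u $ p \<partial>P)" for p
  have sq: "has_bochner_integral std_gaussian (\<lambda>z :: real ^ 'n. (z $ p)\<^sup>2) 1" for p
    using has_bochner_integral_std_gaussian_mult[of p p] by (simp add: power2_eq_square)
  have r: "has_bochner_integral P (\<lambda>u. fst u $ p * snd u $ p) (r p)" for p
    unfolding r_def by (intro has_bochner_integral_integrable integrable_coupling_mult P)
  have c: "has_bochner_integral P (\<lambda>_. x) x" for x :: real
    by (simp add: has_bochner_integral_iff prob_space)
  have "has_bochner_integral P (\<lambda>u. \<Sum>p\<in>UNIV. - ln (1 - (d p)\<^sup>2) / 2
      - ((d p)\<^sup>2 * (fst u $ p)\<^sup>2 - 2 * d p * (fst u $ p * snd u $ p) + (d p)\<^sup>2 * (snd u $ p)\<^sup>2) / (2 * (1 - (d p)\<^sup>2)))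
      (\<Sum>p\<in>UNIV. - ln (1 - (d p)\<^sup>2) / 2 - ((d p)\<^sup>2 * 1 - 2 * d p * r p + (d p)\<^sup>2 * 1) / (2 * (1 - (d p)\<^sup>2)))"
    by (intro has_bochner_integral_sum has_bochner_integral_diff has_bochner_integral_add
        has_bochner_integral_divide_zero has_bochner_integral_mult_right r c
        has_bochner_integral_coupling[OF P sq])
  also have "(\<Sum>p\<in>UNIV. - ln (1 - (d p)\<^sup>2) / 2 - ((d p)\<^sup>2 * 1 - 2 * d p * r p + (d p)\<^sup>2 * 1) / (2 * (1 - (d p)\<^sup>2)))
    = (\<Sum>p\<in>UNIV. - ln (1 - (d p)\<^sup>2) / 2 + d p * (r p - d p) / (1 - (d p)\<^sup>2))"
  proof (rule sum.cong[OF refl])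
    fix p
    have "1 - (d p)\<^sup>2 \<noteq> 0" using d[of p] abs_square_less_1[of "d p"] by linarith
    then show "- ln (1 - (d p)\<^sup>2) / 2 - ((d p)\<^sup>2 * 1 - 2 * d p * r p + (d p)\<^sup>2 * 1) / (2 * (1 - (d p)\<^sup>2))
      = - ln (1 - (d p)\<^sup>2) / 2 + d p * (r p - d p) / (1 - (d p)\<^sup>2)"
      by (simp add: divide_simps) (simp add: power2_eq_square algebra_simps)
  qed
  finally show ?thesis
    unfolding corr_log_density_def split_beta' r_def .
qed

lemma has_bochner_integral_transport_cost:
  fixes L M :: "real ^ 'n ^ 'n" and c :: "real ^ 'n"
  assumes P: "P \<in> couplings std_gaussian std_gaussian"
  shows "has_bochner_integral P (\<lambda>u. (norm (c + L *v fst u - M *v snd u))\<^sup>2)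
    ((norm c)\<^sup>2 + trace (L ** transpose L) + trace (M ** transpose M)
      - 2 * (\<Sum>q\<in>UNIV. \<Sum>r\<in>UNIV. (transpose M ** L) $ r $ q * (\<integral>u. fst u $ q * snd u $ r \<partial>P)))"
proof -
  interpret prob_space P by (rule couplings_std_gaussianD[OF P])
  define e where "e q r = (\<integral>u. fst u $ q * snd u $ r \<partial>P)" for q r
  have e: "has_bochner_integral P (\<lambda>u. fst u $ q * snd u $ r) (e q r)" for q r
    unfolding e_def by (intro has_bochner_integral_integrable integrable_coupling_mult P)
  have const: "has_bochner_integral P (\<lambda>_. x) x" for x :: real
    by (simp add: has_bochner_integral_iff prob_space)
  have lin: "has_bochner_integral std_gaussian (\<lambda>z. (K *v z) $ k) 0" for K :: "real ^ 'n ^ 'n" and k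
  proof -
    have "has_bochner_integral std_gaussian (\<lambda>z. \<Sum>q\<in>UNIV. K $ k $ q * z $ q) (\<Sum>q\<in>UNIV. K $ k $ q * 0)"
      by (intro has_bochner_integral_sum has_bochner_integral_mult_right has_bochner_integral_std_gaussian_nth)
    then show ?thesis by (simp add: matrix_vector_mult_def)
  qed
  have quad: "has_bochner_integral std_gaussian (\<lambda>z. ((K *v z) $ k)\<^sup>2) (\<Sum>q\<in>UNIV. (K $ k $ q)\<^sup>2)" for K :: "real ^ 'n ^ 'n" and k
  proof -
    have "has_bochner_integral std_gaussian (\<lambda>z. \<Sum>q\<in>UNIV. \<Sum>r\<in>UNIV. (K $ k $ q * K $ k $ r) * (z $ q * z $ r))
      (\<Sum>q\<in>UNIV. \<Sum>r\<in>UNIV. (K $ k $ q * K $ k $ r) * (if q = r then 1 else 0))"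
      by (intro has_bochner_integral_sum has_bochner_integral_mult_right has_bochner_integral_std_gaussian_mult)
    moreover have "(\<Sum>q\<in>UNIV. \<Sum>r\<in>UNIV. (K $ k $ q * K $ k $ r) * (z $ q * z $ r)) = ((K *v z) $ k)\<^sup>2" for z
      by (simp add: matrix_vector_mult_def power2_eq_square sum_product mult_ac)
    ultimately show ?thesis by (simp add: power2_eq_square if_distrib cong: if_cong)
  qed
  have cross: "has_bochner_integral P (\<lambda>u. (L *v fst u) $ k * (M *v snd u) $ k) (\<Sum>q\<in>UNIV. \<Sum>r\<in>UNIV. (L $ k $ q * M $ k $ r) * e q r)" for k
  proof -
    have "has_bochner_integral P (\<lambda>u. \<Sum>q\<in>UNIV. \<Sum>r\<in>UNIV. (L $ k $ q * M $ k $ r) * (fst u $ q * snd u $ r))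
      (\<Sum>q\<in>UNIV. \<Sum>r\<in>UNIV. (L $ k $ q * M $ k $ r) * e q r)"
      by (intro has_bochner_integral_sum has_bochner_integral_mult_right e)
    moreover have "(\<Sum>q\<in>UNIV. \<Sum>r\<in>UNIV. (L $ k $ q * M $ k $ r) * (fst u $ q * snd u $ r)) = (L *v fst u) $ k * (M *v snd u) $ k" for u
      by (simp add: matrix_vector_mult_def sum_product mult_ac)
    ultimately show ?thesis by simp
  qed
  have "has_bochner_integral P
     (\<lambda>u. \<Sum>k\<in>UNIV. (c $ k)\<^sup>2 + (2 * c $ k) * (L *v fst u) $ k - (2 * c $ k) * (M *v snd u) $ k
        + ((L *v fst u) $ k)\<^sup>2 + ((M *v snd u) $ k)\<^sup>2 - 2 * ((L *v fst u) $ k * (M *v snd u) $ k))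
     (\<Sum>k\<in>UNIV. (c $ k)\<^sup>2 + (2 * c $ k) * 0 - (2 * c $ k) * 0
        + (\<Sum>q\<in>UNIV. (L $ k $ q)\<^sup>2) + (\<Sum>q\<in>UNIV. (M $ k $ q)\<^sup>2)
        - 2 * (\<Sum>q\<in>UNIV. \<Sum>r\<in>UNIV. (L $ k $ q * M $ k $ r) * e q r))"
    by (intro has_bochner_integral_sum has_bochner_integral_diff has_bochner_integral_add
        has_bochner_integral_mult_right const cross has_bochner_integral_coupling[OF P lin] has_bochner_integral_coupling[OF P quad])
  moreover have "(\<Sum>k\<in>UNIV. (c $ k)\<^sup>2 + (2 * c $ k) * (L *v fst u) $ k - (2 * c $ k) * (M *v snd u) $ k
        + ((L *v fst u) $ k)\<^sup>2 + ((M *v snd u) $ k)\<^sup>2 - 2 * ((L *v fst u) $ k * (M *v snd u) $ k))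
      = (norm (c + L *v fst u - M *v snd u))\<^sup>2" for u
    unfolding power2_norm_eq_inner inner_vec_def
    by (rule sum.cong) (simp_all add: power2_eq_square algebra_simps)
  moreover have "(\<Sum>k\<in>UNIV. (c $ k)\<^sup>2 + (2 * c $ k) * 0 - (2 * c $ k) * 0
        + (\<Sum>q\<in>UNIV. (L $ k $ q)\<^sup>2) + (\<Sum>q\<in>UNIV. (M $ k $ q)\<^sup>2)
        - 2 * (\<Sum>q\<in>UNIV. \<Sum>r\<in>UNIV. (L $ k $ q * M $ k $ r) * e q r))
      = (norm c)\<^sup>2 + trace (L ** transpose L) + trace (M ** transpose M)
      - 2 * (\<Sum>q\<in>UNIV. \<Sum>r\<in>UNIV. (transpose M ** L) $ r $ q * e q r)"
  proof -
    have tr: "trace (K ** transpose K) = (\<Sum>k\<in>UNIV. \<Sum>q\<in>UNIV. (K $ k $ q)\<^sup>2)" for K :: "real ^ 'n ^ 'n"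
      by (simp add: trace_def matrix_matrix_mult_def transpose_def power2_eq_square)
    have "(\<Sum>q\<in>UNIV. \<Sum>r\<in>UNIV. (transpose M ** L) $ r $ q * e q r) = (\<Sum>q\<in>UNIV. \<Sum>r\<in>UNIV. \<Sum>k\<in>UNIV. (L $ k $ q * M $ k $ r) * e q r)"
      by (simp add: matrix_matrix_mult_def transpose_def sum_distrib_right sum_distrib_left mult_ac)
    also have "\<dots> = (\<Sum>q\<in>UNIV. \<Sum>k\<in>UNIV. \<Sum>r\<in>UNIV. (L $ k $ q * M $ k $ r) * e q r)"
      by (rule sum.cong[OF refl], rule sum.swap)
    also have "\<dots> = (\<Sum>k\<in>UNIV. \<Sum>q\<in>UNIV. \<Sum>r\<in>UNIV. (L $ k $ q * M $ k $ r) * e q r)"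
      by (rule sum.swap)
    finally have cr: "(\<Sum>k\<in>UNIV. \<Sum>q\<in>UNIV. \<Sum>r\<in>UNIV. (L $ k $ q * M $ k $ r) * e q r)
      = (\<Sum>q\<in>UNIV. \<Sum>r\<in>UNIV. (transpose M ** L) $ r $ q * e q r)" ..
    have nc: "(norm c)\<^sup>2 = (\<Sum>k\<in>UNIV. (c $ k)\<^sup>2)"
      unfolding power2_norm_eq_inner inner_vec_def by (simp add: power2_eq_square)
    show ?thesis
      unfolding tr nc cr[symmetric] by (simp add: sum.distrib sum_subtractf sum_distrib_left)
  qed
  ultimately show ?thesis unfolding e_def by simp
qed

section \<open>Causal isomorphisms\<close>

definition vanishes_upto :: "'t::{finite,linorder} \<Rightarrow> real ^ ('t \<times> 'd::finite) \<Rightarrow> bool" where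
  "vanishes_upto t z \<longleftrightarrow> (\<forall>p. fst p \<le> t \<longrightarrow> z $ p = 0)"

text \<open>
  Block lower triangular matrices with block lower triangular inverse, described by what they do to
  vectors. In this form closure under products and inverses is immediate.
\<close>

definition causal_iso :: "real ^ ('t::{finite,linorder} \<times> 'd::finite) ^ ('t \<times> 'd) \<Rightarrow> bool" where
  "causal_iso K \<longleftrightarrow> (\<forall>t z. vanishes_upto t (K *v z) \<longleftrightarrow> vanishes_upto t z)"

lemma causal_iso_mult: "causal_iso K \<Longrightarrow> causal_iso K' \<Longrightarrow> causal_iso (K ** K')"
  by (simp add: causal_iso_def matrix_vector_mul_assoc[symmetric] del: matrix_vector_mul_assoc)

lemma causal_iso_inverse:
  assumes "causal_iso K" "K ** K' = mat 1"
  shows "causal_iso K'"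
  unfolding causal_iso_def
proof (intro allI)
  fix t z
  have "K *v (K' *v z) = z" by (simp add: matrix_vector_mul_assoc assms(2))
  then show "vanishes_upto t (K' *v z) \<longleftrightarrow> vanishes_upto t z"
    using assms(1) unfolding causal_iso_def by metis
qed

lemma causal_iso_invertible:
  fixes K :: "real ^ ('t::{finite,linorder} \<times> 'd::finite) ^ ('t \<times> 'd)"
  assumes "causal_iso K"
  shows "invertible K"
proof -
  have "x = 0" if "K *v x = 0" for x
  proof -
    have "vanishes_upto (Max UNIV) (K *v x)" by (simp add: that vanishes_upto_def)
    then have "vanishes_upto (Max UNIV) x" using assms by (simp add: causal_iso_def)
    then show ?thesis by (simp add: vanishes_upto_def vec_eq_iff)
  qed
  then show ?thesis
    unfolding invertible_left_inverse matrix_left_invertible_ker by blast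
qed

lemma causal_iso_agree:
  assumes "causal_iso K" "\<And>p. fst p \<le> t \<Longrightarrow> z $ p = z' $ p" "fst p \<le> t"
  shows "(K *v z) $ p = (K *v z') $ p"
proof -
  have "vanishes_upto t (z - z')" using assms(2) by (simp add: vanishes_upto_def)
  then have "vanishes_upto t (K *v (z - z'))" using assms(1) by (simp add: causal_iso_def)
  then have "(K *v (z - z')) $ p = 0" using assms(3) unfolding vanishes_upto_def by blast
  then show ?thesis by (simp add: matrix_vector_mult_diff_distrib)
qed

text \<open>
  If \<open>z\<close> has a nonzero entry up to time \<open>t\<close>, then at the lexicographically first such entry \<open>L z\<close> equals the
  diagonal entry of \<open>L\<close> times that entry.
\<close>

lemma cholesky_causal_iso:
  fixes A L :: "real ^ ('t::{finite,linorder} \<times> 'd::{finite,linorder}) ^ ('t \<times> 'd)"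
  assumes "cholesky A L"
  shows "causal_iso L"
  unfolding causal_iso_def
proof (intro allI iffI)
  have low: "L $ (s, i) $ (t, j) = 0" if "s < t \<or> s = t \<and> i < j" for s i t j
    using assms that unfolding cholesky_def by blast
  have pos: "0 < L $ p $ p" for p
    using assms unfolding cholesky_def by blast
  fix t :: 't and z :: "real ^ ('t \<times> 'd)"
  {
    assume z: "vanishes_upto t z"
    have "L $ p $ q * z $ q = 0" if "fst p \<le> t" for p q
    proof (cases "fst q \<le> t")
      case True
      then show ?thesis using z unfolding vanishes_upto_def by (metis mult_zero_right)
    next
      case False
      then have "fst p < fst q" using that by simp
      then show ?thesis using low[of "fst p" "fst q" "snd p" "snd q"] by simp
    qed
    then show "vanishes_upto t (L *v z)"
      unfolding vanishes_upto_def matrix_vector_mult_def vec_lambda_beta by (blast intro: sum.neutral)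
  next
    assume Lz: "vanishes_upto t (L *v z)"
    show "vanishes_upto t z"
    proof (rule ccontr)
      assume "\<not> vanishes_upto t z"
      define T where "T = {s. s \<le> t \<and> (\<exists>i. z $ (s, i) \<noteq> 0)}"
      have "T \<noteq> {}" using \<open>\<not> vanishes_upto t z\<close> unfolding T_def vanishes_upto_def by fastforce
      define s where "s = Min T"
      have "s \<in> T" unfolding s_def by (rule Min_in) (use \<open>T \<noteq> {}\<close> in auto)
      have smin: "s \<le> s'" if "s' \<in> T" for s' unfolding s_def by (rule Min_le) (use that in auto)
      define I where "I = {i. z $ (s, i) \<noteq> 0}"
      have "I \<noteq> {}" using \<open>s \<in> T\<close> by (auto simp: T_def I_def)
      define i where "i = Min I"
      have "i \<in> I" unfolding i_def by (rule Min_in) (use \<open>I \<noteq> {}\<close> in auto)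
      have imin: "i \<le> j" if "j \<in> I" for j unfolding i_def by (rule Min_le) (use that in auto)
      have "L $ (s, i) $ q * z $ q = (if q = (s, i) then L $ (s, i) $ (s, i) * z $ (s, i) else 0)" for q
      proof (cases "L $ (s, i) $ q = 0 \<or> z $ q = 0 \<or> q = (s, i)")
        case False
        obtain s' j where q: "q = (s', j)" by force
        have 1: "\<not> s < s'" "\<not> (s = s' \<and> i < j)" using low[of s s' i j] False q by auto
        then have "s' \<in> T" using False q \<open>s \<in> T\<close> by (auto simp: T_def)
        with smin 1 have "s = s'" by force
        then have "j \<in> I" using False q by (simp add: I_def)
        with imin 1 \<open>s = s'\<close> have "i = j" by force
        with \<open>s = s'\<close> q False show ?thesis by simp
      qed auto
      then have "(\<Sum>q\<in>UNIV. L $ (s, i) $ q * z $ q) = (\<Sum>q\<in>UNIV. if q = (s, i) then L $ (s, i) $ (s, i) * z $ (s, i) else 0)"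
        by (rule sum.cong[OF refl])
      also have "\<dots> = L $ (s, i) $ (s, i) * z $ (s, i)"
        by (simp only: sum.delta finite UNIV_I if_True)
      finally have "(\<Sum>q\<in>UNIV. L $ (s, i) $ q * z $ q) = L $ (s, i) $ (s, i) * z $ (s, i)" .
      then have "(L *v z) $ (s, i) = L $ (s, i) $ (s, i) * z $ (s, i)"
        by (simp add: matrix_vector_mult_def)
      moreover have "(L *v z) $ (s, i) = 0" using Lz \<open>s \<in> T\<close> by (auto simp: vanishes_upto_def T_def)
      ultimately show False using pos[of "(s, i)"] \<open>i \<in> I\<close> by (simp add: I_def)
    qed
  }
qed

lemma sum_over_block:
  fixes f :: "'t::finite \<times> 'd::finite \<Rightarrow> real"
  shows "(\<Sum>q\<in>UNIV. if fst q = s then f q else 0) = (\<Sum>j\<in>UNIV. f (s, j))"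
proof -
  have "(\<Sum>q\<in>UNIV. if fst q = s then f q else 0) = (\<Sum>t\<in>UNIV. \<Sum>j\<in>UNIV. if t = s then f (t, j) else 0)"
    unfolding sum.cartesian_product UNIV_Times_UNIV by (rule sum.cong) auto
  also have "\<dots> = (\<Sum>t\<in>UNIV. if t = s then (\<Sum>j\<in>UNIV. f (t, j)) else 0)"
    by (intro sum.cong) auto
  finally show ?thesis by simp
qed

lemma block_diag_mult_nth:
  "(block_diag U ** K) $ (s, i) $ q = (\<Sum>j\<in>UNIV. U s $ i $ j * K $ (s, j) $ q)"
  "(K ** block_diag U) $ p $ (s, i) = (\<Sum>j\<in>UNIV. K $ p $ (s, j) * U s $ j $ i)"
proof -
  have "(block_diag U ** K) $ (s, i) $ q = (\<Sum>r\<in>UNIV. if fst r = s then U s $ i $ snd r * K $ r $ q else 0)"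
    by (simp add: matrix_matrix_mult_def block_diag_def) (rule sum.cong, auto)
  then show "(block_diag U ** K) $ (s, i) $ q = (\<Sum>j\<in>UNIV. U s $ i $ j * K $ (s, j) $ q)"
    by (simp add: sum_over_block)
  have "(K ** block_diag U) $ p $ (s, i) = (\<Sum>r\<in>UNIV. if fst r = s then K $ p $ r * U s $ snd r $ i else 0)"
    by (simp add: matrix_matrix_mult_def block_diag_def) (rule sum.cong, auto)
  then show "(K ** block_diag U) $ p $ (s, i) = (\<Sum>j\<in>UNIV. K $ p $ (s, j) * U s $ j $ i)"
    by (simp add: sum_over_block)
qed

lemma block_mult_block_diag:
  "block (block_diag U ** K) s t = U s ** block K s t"
  "block (K ** block_diag U) s t = block K s t ** U t"
  by (simp_all only: block_def vec_eq_iff vec_lambda_beta block_diag_mult_nth) (simp_all add: matrix_matrix_mult_def)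

lemma transpose_block_diag: "transpose (block_diag U) = block_diag (\<lambda>t. transpose (U t))"
  by (auto simp: vec_eq_iff transpose_def block_diag_def)

lemma block_diag_orthogonal:
  assumes "\<And>t. orthogonal_matrix (U t)"
  shows "transpose (block_diag U) ** block_diag U = mat 1" "block_diag U ** transpose (block_diag U) = mat 1"
proof -
  have "block_diag (\<lambda>t. transpose (U t)) ** block_diag U = mat 1"
  proof -
    have "(block_diag (\<lambda>t. transpose (U t)) ** block_diag U) $ (s, i) $ (t, k) = (mat 1 :: real^('a\<times>'b)^('a\<times>'b)) $ (s, i) $ (t, k)" for s i t k
    proof (cases "s = t")
      case True
      have "transpose (U s) ** U s = mat 1" using assms[of s] by (simp add: orthogonal_matrix)
      then have "(transpose (U s) ** U s) $ i $ k = (mat 1 :: real^'b^'b) $ i $ k" by simp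
      with True show ?thesis
        unfolding block_diag_mult_nth(1) by (simp add: matrix_matrix_mult_def block_diag_def mat_def)
    next
      case False
      then show ?thesis unfolding block_diag_mult_nth(1) by (simp add: block_diag_def mat_def)
    qed
    then show ?thesis unfolding vec_eq_iff by (metis prod.exhaust)
  qed
  then show "transpose (block_diag U) ** block_diag U = mat 1" by (simp add: transpose_block_diag)
  then show "block_diag U ** transpose (block_diag U) = mat 1" by (simp add: matrix_left_right_inverse)
qed

lemma vanishes_upto_block_diag: "vanishes_upto t z \<Longrightarrow> vanishes_upto t (block_diag U *v z)"
  unfolding vanishes_upto_def
proof (intro allI impI)
  fix p :: "'a \<times> 'b" assume z: "\<forall>p. fst p \<le> t \<longrightarrow> z $ p = 0" and "fst p \<le> t"
  then have "z $ q = 0" if "fst p = fst q" for q using that by metis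
  then have "block_diag U $ p $ q * z $ q = 0" for q
    by (cases "fst p = fst q") (auto simp: block_diag_def)
  then show "(block_diag U *v z) $ p = 0" by (simp add: matrix_vector_mult_def sum.neutral del: mult_eq_0_iff)
qed

lemma causal_iso_block_diag:
  assumes "\<And>t. orthogonal_matrix (U t)"
  shows "causal_iso (block_diag U)"
  unfolding causal_iso_def
proof (intro allI iffI)
  fix t z assume "vanishes_upto t (block_diag U *v z)"
  then have "vanishes_upto t (block_diag (\<lambda>t. transpose (U t)) *v (block_diag U *v z))"
    by (rule vanishes_upto_block_diag)
  then show "vanishes_upto t z"
    using block_diag_orthogonal(1)[of U, OF assms] by (simp add: matrix_vector_mul_assoc transpose_block_diag)
qed (rule vanishes_upto_block_diag)

section \<open>Conditional laws of Gaussian paths\<close>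

lemma measurable_past [measurable]: "past t \<in> borel \<rightarrow>\<^sub>M past_space t"
  unfolding past_def past_space_def by (rule measurable_restrict) simp

lemma measurable_future [measurable]: "future t \<in> borel \<rightarrow>\<^sub>M future_space t"
  unfolding future_def future_space_def by (rule measurable_restrict) simp

text \<open>
  Glues a past and a future back to a path. Where only the past matters, the arbitrary filler \<open>future t 0\<close> is used
  as the second argument.
\<close>

definition path_of :: "'t::{finite,linorder} \<Rightarrow> ('t \<times> 'd::finite \<Rightarrow> real) \<Rightarrow> ('t \<times> 'd \<Rightarrow> real) \<Rightarrow> real ^ ('t \<times> 'd)" where
  "path_of t u v = (\<chi> p. if fst p \<le> t then u p else v p)"

lemma path_of_past_future [simp]: "path_of t (past t x) (future t x) = x"
  by (simp add: path_of_def past_def future_def vec_eq_iff restrict_def not_le)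

lemma path_of_past_nth: "fst p \<le> t \<Longrightarrow> path_of t (past t x) v $ p = x $ p"
  by (cases p) (simp add: path_of_def past_def)

lemma past_eqI: "(\<And>p. fst p \<le> t \<Longrightarrow> x $ p = y $ p) \<Longrightarrow> past t x = past t y"
  by (auto simp: past_def restrict_def)

lemma measurable_path_of [measurable]:
  "(\<lambda>w. path_of t (fst w) (snd w)) \<in> past_space t \<Otimes>\<^sub>M future_space t \<rightarrow>\<^sub>M borel"
  unfolding path_of_def
proof (rule borel_measurable_vec_lambda)
  fix p :: "'a \<times> 'b"
  show "(\<lambda>w. if fst p \<le> t then fst w p else snd w p) \<in> borel_measurable (past_space t \<Otimes>\<^sub>M future_space t)"
  proof (cases "fst p \<le> t")
    case True
    then have "p \<in> {..t} \<times> UNIV" by (cases p) auto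
    then have "(\<lambda>u. u p) \<in> borel_measurable (past_space t)"
      unfolding past_space_def by (rule measurable_component_singleton)
    from measurable_compose[OF measurable_fst this] True show ?thesis by simp
  next
    case False
    then have "p \<in> {t<..} \<times> UNIV" by (cases p) auto
    then have "(\<lambda>u. u p) \<in> borel_measurable (future_space t)"
      unfolding future_space_def by (rule measurable_component_singleton)
    from measurable_compose[OF measurable_snd this] False show ?thesis by simp
  qed
qed

lemma measurable_path_of_past [measurable (raw)]:
  assumes "f \<in> M \<rightarrow>\<^sub>M past_space t"
  shows "(\<lambda>w. path_of t (f w) (future t 0)) \<in> borel_measurable M"
proof -
  have "(\<lambda>w. (f w, future t 0)) \<in> M \<rightarrow>\<^sub>M past_space t \<Otimes>\<^sub>M future_space t"
    using assms measurable_space[OF measurable_future[of t], of 0] by (intro measurable_Pair measurable_const) auto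
  from measurable_compose[OF this measurable_path_of] show ?thesis by simp
qed

text \<open>
  Recovers the whitened coordinates up to time \<open>t\<close> from the past \<open>u\<close>, and draws those after \<open>t\<close> from \<open>z'\<close>.
\<close>

definition resampled_future :: "real ^ ('t::{finite,linorder} \<times> 'd::finite) \<Rightarrow> real ^ ('t \<times> 'd) ^ ('t \<times> 'd) \<Rightarrow> 't \<Rightarrow>
    ('t \<times> 'd \<Rightarrow> real) \<Rightarrow> real ^ ('t \<times> 'd) \<Rightarrow> ('t \<times> 'd \<Rightarrow> real)" where
  "resampled_future a L t u z' =
     future t (a + L *v splice {p. fst p \<le> t} (matrix_inv L *v (path_of t u (future t 0) - a)) z')"

lemma measurable_resampled_future [measurable (raw)]:
  assumes [measurable]: "f \<in> M \<rightarrow>\<^sub>M past_space t" "g \<in> borel_measurable M"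
  shows "(\<lambda>w. resampled_future a L t (f w) (g w)) \<in> M \<rightarrow>\<^sub>M future_space t"
  unfolding resampled_future_def by measurable

lemma matrix_inv_mult:
  fixes L :: "real ^ 'n ^ 'n"
  assumes "invertible L"
  shows "L ** matrix_inv L = mat 1" "matrix_inv L ** L = mat 1"
proof -
  obtain K where K: "L ** K = mat 1" "K ** L = mat 1" using assms by (auto simp: invertible_def)
  then show "L ** matrix_inv L = mat 1" "matrix_inv L ** L = mat 1"
    by (simp_all add: matrix_inv_unique[OF K(1)])
qed

lemma causal_iso_matrix_inv:
  fixes L :: "real ^ ('t::{finite,linorder} \<times> 'd::finite) ^ ('t \<times> 'd)"
  assumes "causal_iso L"
  shows "causal_iso (matrix_inv L)"
  by (rule causal_iso_inverse[OF assms matrix_inv_mult(1)[OF causal_iso_invertible[OF assms]]])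

lemma matrix_inv_vector:
  fixes L :: "real ^ 'n ^ 'n"
  assumes "invertible L"
  shows "matrix_inv L *v (L *v z) = z" "L *v (matrix_inv L *v z) = z"
  by (simp_all add: matrix_vector_mul_assoc matrix_inv_mult[OF assms])

lemma past_splice:
  assumes "causal_iso L"
  shows "past t (a + L *v splice {p. fst p \<le> t} z z') = past t (a + L *v z)"
  by (rule past_eqI) (simp, rule causal_iso_agree[OF assms], auto)

text \<open>
  The whitened coordinates up to \<open>t\<close> depend on the past only, because \<open>matrix_inv L\<close> is causal; the filler after \<open>t\<close>
  does not reach them.
\<close>

lemma future_splice:
  assumes L: "causal_iso L"
  shows "future t (a + L *v splice {p. fst p \<le> t} z z') = resampled_future a L t (past t (a + L *v z)) z'"
proof -
  let ?x = "a + L *v z"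
  have "(matrix_inv L *v (path_of t (past t ?x) (future t 0) - a)) $ p = z $ p" if "fst p \<le> t" for p
  proof -
    have "(matrix_inv L *v (path_of t (past t ?x) (future t 0) - a)) $ p = (matrix_inv L *v (?x - a)) $ p"
      by (rule causal_iso_agree[OF causal_iso_matrix_inv[OF L] _ that]) (simp add: path_of_past_nth)
    then show ?thesis by (simp add: matrix_inv_vector[OF causal_iso_invertible[OF L]])
  qed
  then have "splice {p. fst p \<le> t} (matrix_inv L *v (path_of t (past t ?x) (future t 0) - a)) z' = splice {p. fst p \<le> t} z z'"
    by (simp add: vec_eq_iff)
  then show ?thesis by (simp add: resampled_future_def)
qed

lemma regular_cond_law_gaussian:
  assumes L: "causal_iso L"
  shows "regular_cond_law (distr std_gaussian borel (\<lambda>z. a + L *v z)) (past t) (past_space t) (future t) (future_space t)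
    (\<lambda>u. distr std_gaussian (future_space t) (resampled_future a L t u))"
proof (rule regular_cond_law_distr)
  show "regular_cond_law std_gaussian (\<lambda>w. past t (a + L *v w)) (past_space t) (\<lambda>w. future t (a + L *v w)) (future_space t)
    (\<lambda>u. distr std_gaussian (future_space t) (resampled_future a L t u))"
    by (rule regular_cond_law_resampling[OF prob_space_std_gaussian resampling_std_gaussian[of "{p. fst p \<le> t}"]])
      (simp_all add: past_splice[OF L] future_splice[OF L])
qed measurable

definition affine_pair :: "real ^ 'n \<Rightarrow> real ^ 'n ^ 'n \<Rightarrow> real ^ 'n \<Rightarrow> real ^ 'n ^ 'n \<Rightarrow>
    (real ^ 'n) \<times> (real ^ 'n) \<Rightarrow> (real ^ 'n) \<times> (real ^ 'n)" where
  "affine_pair a L b M = (\<lambda>(z, w). (a + L *v z, b + M *v w))"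

lemma measurable_affine_pair [measurable]:
  "affine_pair a L b M \<in> borel \<Otimes>\<^sub>M borel \<rightarrow>\<^sub>M borel \<Otimes>\<^sub>M borel"
  unfolding affine_pair_def split_beta' by measurable

lemma regular_cond_law_corr_gaussian:
  assumes L: "causal_iso L" and M: "causal_iso M"
  shows "regular_cond_law (distr (corr_gaussian d) (borel \<Otimes>\<^sub>M borel) (affine_pair a L b M))
    (\<lambda>(x, y). (past t x, past t y)) (past_space t \<Otimes>\<^sub>M past_space t)
    (\<lambda>(x, y). (future t x, future t y)) (future_space t \<Otimes>\<^sub>M future_space t)
    (\<lambda>(u, v). distr (corr_gaussian d) (future_space t \<Otimes>\<^sub>M future_space t)
      (\<lambda>(z', w'). (resampled_future a L t u z', resampled_future b M t v w')))"
    (is "regular_cond_law _ ?X ?MX ?Y ?MY ?K")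
proof (rule regular_cond_law_distr)
  have K: "?K = (\<lambda>uv. distr (corr_gaussian d) ?MY ((\<lambda>uv z. (resampled_future a L t (fst uv) (fst z), resampled_future b M t (snd uv) (snd z))) uv))"
    by (simp add: split_beta' fun_eq_iff)
  show "regular_cond_law (corr_gaussian d) (\<lambda>w. ?X (affine_pair a L b M w)) ?MX (\<lambda>w. ?Y (affine_pair a L b M w)) ?MY ?K"
    unfolding K
    by (rule regular_cond_law_resampling[OF prob_space_corr_gaussian resampling_corr_gaussian[of d "{p. fst p \<le> t}"]])
      (auto simp: affine_pair_def split_beta' past_splice[OF L] future_splice[OF L] past_splice[OF M] future_splice[OF M])
qed measurable

lemma sets_pair_measure_distr_borel: "sets (distr P borel f \<Otimes>\<^sub>M distr Q borel g) = sets (borel \<Otimes>\<^sub>M borel)"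
  by (intro sets_pair_measure_cong) simp_all

text \<open>
  The conditional law of the pair of futures is the image of \<^term>\<open>corr_gaussian d\<close> under a map acting on each
  component separately. The components of \<^term>\<open>corr_gaussian d\<close> are standard Gaussian, so this image has the
  conditional laws of the two processes as marginals, for every pair of pasts.
\<close>

lemma affine_corr_gaussian_bicausal:
  fixes L M :: "real ^ ('t::{finite,linorder} \<times> 'd::finite) ^ ('t \<times> 'd)"
  assumes L: "causal_iso L" and M: "causal_iso M" and d: "\<And>p. \<bar>d p\<bar> < 1"
  shows "distr (corr_gaussian d) (borel \<Otimes>\<^sub>M borel) (affine_pair a L b M) \<in>
    bicausal_couplings (distr std_gaussian borel (\<lambda>z. a + L *v z)) (distr std_gaussian borel (\<lambda>z. b + M *v z))"
    (is "?\<pi> \<in> bicausal_couplings ?\<mu> ?\<nu>")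
proof -
  note C = couplings_std_gaussianD[OF corr_gaussian_coupling[of d, OF d]]
  interpret C: prob_space "corr_gaussian d" by (rule C(1))
  have fst_law: "distr (corr_gaussian d) N (\<lambda>u. f (fst u)) = distr std_gaussian N f" if "f \<in> borel \<rightarrow>\<^sub>M N" for f and N :: "'x measure"
    using that by (subst C(3)[symmetric]) (simp add: distr_distr comp_def)
  have snd_law: "distr (corr_gaussian d) N (\<lambda>u. f (snd u)) = distr std_gaussian N f" if "f \<in> borel \<rightarrow>\<^sub>M N" for f and N :: "'x measure"
    using that by (subst C(4)[symmetric]) (simp add: distr_distr comp_def)
  have "distr ?\<pi> ?\<mu> fst = distr ?\<pi> borel fst" "distr ?\<pi> ?\<nu> snd = distr ?\<pi> borel snd"
    by (auto intro!: distr_cong)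
  moreover have "distr ?\<pi> borel fst = ?\<mu>" "distr ?\<pi> borel snd = ?\<nu>"
    using fst_law[of "\<lambda>z. a + L *v z" borel] snd_law[of "\<lambda>z. b + M *v z" borel]
    by (simp_all add: distr_distr comp_def affine_pair_def split_beta')
  moreover have "prob_space ?\<pi>" by (rule C.prob_space_distr) measurable
  ultimately have "?\<pi> \<in> couplings ?\<mu> ?\<nu>"
    by (simp add: couplings_def sets_pair_measure_distr_borel)
  moreover have "\<exists>m n p.
     regular_cond_law ?\<mu> (past t) (past_space t) (future t) (future_space t) m \<and>
     regular_cond_law ?\<nu> (past t) (past_space t) (future t) (future_space t) n \<and>
     regular_cond_law ?\<pi>
       (\<lambda>(x, y). (past t x, past t y)) (past_space t \<Otimes>\<^sub>M past_space t)
       (\<lambda>(x, y). (future t x, future t y)) (future_space t \<Otimes>\<^sub>M future_space t) p \<and>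
     (AE (x, y) in ?\<pi>. p (past t x, past t y) \<in> couplings (m (past t x)) (n (past t y)))" for t
  proof (intro exI conjI)
    show "regular_cond_law ?\<mu> (past t) (past_space t) (future t) (future_space t)
        (\<lambda>u. distr std_gaussian (future_space t) (resampled_future a L t u))"
      by (rule regular_cond_law_gaussian[OF L])
    show "regular_cond_law ?\<nu> (past t) (past_space t) (future t) (future_space t)
        (\<lambda>u. distr std_gaussian (future_space t) (resampled_future b M t u))"
      by (rule regular_cond_law_gaussian[OF M])
    show "regular_cond_law ?\<pi> (\<lambda>(x, y). (past t x, past t y)) (past_space t \<Otimes>\<^sub>M past_space t)
       (\<lambda>(x, y). (future t x, future t y)) (future_space t \<Otimes>\<^sub>M future_space t)
       (\<lambda>(u, v). distr (corr_gaussian d) (future_space t \<Otimes>\<^sub>M future_space t)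
         (\<lambda>(z', w'). (resampled_future a L t u z', resampled_future b M t v w')))"
      by (rule regular_cond_law_corr_gaussian[OF L M])
    have rf: "resampled_future c K t (past t x) \<in> borel \<rightarrow>\<^sub>M future_space t" for c x and K :: "real ^ ('t \<times> 'd) ^ ('t \<times> 'd)"
      using measurable_space[OF measurable_past[of t], of x] by (intro measurable_resampled_future) auto
    have coup: "distr (corr_gaussian d) (future_space t \<Otimes>\<^sub>M future_space t)
         (\<lambda>(z', w'). (resampled_future a L t (past t x) z', resampled_future b M t (past t y) w'))
       \<in> couplings (distr std_gaussian (future_space t) (resampled_future a L t (past t x)))
          (distr std_gaussian (future_space t) (resampled_future b M t (past t y)))" for x y
    proof -
      let ?f = "resampled_future a L t (past t x)" and ?g = "resampled_future b M t (past t y)"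
      note [measurable] = rf[of a L x] rf[of b M y]
      let ?D = "distr (corr_gaussian d) (future_space t \<Otimes>\<^sub>M future_space t) (\<lambda>(z', w'). (?f z', ?g w'))"
      have "prob_space ?D" by (rule C.prob_space_distr) (simp add: split_beta')
      moreover have "distr ?D (distr std_gaussian (future_space t) ?f) fst = distr ?D (future_space t) fst"
        "distr ?D (distr std_gaussian (future_space t) ?g) snd = distr ?D (future_space t) snd"
        by (auto intro!: distr_cong)
      moreover have "distr ?D (future_space t) fst = distr std_gaussian (future_space t) ?f"
        "distr ?D (future_space t) snd = distr std_gaussian (future_space t) ?g"
        using fst_law[of ?f] snd_law[of ?g] by (simp_all add: distr_distr comp_def split_beta')
      ultimately show ?thesis
        by (simp add: couplings_def cong: sets_pair_measure_cong)
    qed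
    show "AE (x, y) in ?\<pi>. (\<lambda>(u, v). distr (corr_gaussian d) (future_space t \<Otimes>\<^sub>M future_space t)
         (\<lambda>(z', w'). (resampled_future a L t u z', resampled_future b M t v w'))) (past t x, past t y)
       \<in> couplings (distr std_gaussian (future_space t) (resampled_future a L t (past t x)))
          (distr std_gaussian (future_space t) (resampled_future b M t (past t y)))"
      using coup by (intro AE_I2) (simp add: split_beta')
  qed
  ultimately show ?thesis unfolding bicausal_couplings_def by blast
qed

section \<open>Bicausal couplings decorrelate distinct times\<close>

text \<open>
  The whitened coordinate \<open>q\<close> lies after time \<open>t\<close>, so resampling the coordinates after \<open>t\<close> replaces it by that of
  an independent copy and leaves the past unchanged.
\<close>

lemma innovation_indep_past:
  fixes a :: "real ^ ('t::{finite,linorder} \<times> 'd::finite)"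
  assumes L: "causal_iso L" and q: "t < fst q"
  defines "\<mu> \<equiv> distr std_gaussian borel (\<lambda>z. a + L *v z)"
    and "h \<equiv> \<lambda>x. (matrix_inv L *v (x - a)) $ q"
  shows "distr \<mu> (past_space t \<Otimes>\<^sub>M borel) (\<lambda>x. (past t x, h x)) = distr \<mu> (past_space t) (past t) \<Otimes>\<^sub>M distr \<mu> borel h"
proof -
  interpret N: prob_space "std_gaussian :: (real ^ ('t \<times> 'd)) measure" by (rule prob_space_std_gaussian)
  let ?N = "std_gaussian :: (real ^ ('t \<times> 'd)) measure"
  let ?F = "\<lambda>z. past t (a + L *v z)"
  have nq: "\<not> fst q \<le> t" using q by simp
  have inv: "matrix_inv L *v (L *v z) = z" for z
    by (rule matrix_inv_vector(1)[OF causal_iso_invertible[OF L]])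
  have [measurable]: "h \<in> borel_measurable borel" unfolding h_def by measurable
  have "distr \<mu> (past_space t \<Otimes>\<^sub>M borel) (\<lambda>x. (past t x, h x)) = distr ?N (past_space t \<Otimes>\<^sub>M borel) (\<lambda>z. (?F z, z $ q))"
    unfolding \<mu>_def by (subst distr_distr) (auto simp: comp_def h_def inv)
  also have "\<dots> = distr (distr (?N \<Otimes>\<^sub>M ?N) borel (\<lambda>(z, z'). splice {p. fst p \<le> t} z z')) (past_space t \<Otimes>\<^sub>M borel) (\<lambda>z. (?F z, z $ q))"
    by (simp only: std_gaussian_splice)
  also have "\<dots> = distr (?N \<Otimes>\<^sub>M ?N) (past_space t \<Otimes>\<^sub>M borel) (\<lambda>(z, z'). (?F z, z' $ q))"
    by (subst distr_distr) (auto simp: comp_def split_beta' past_splice[OF L] nq)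
  also have "\<dots> = distr ?N (past_space t) ?F \<Otimes>\<^sub>M distr ?N borel (\<lambda>z. z $ q)"
    by (rule pair_measure_distr[symmetric]) (auto intro!: prob_space_imp_sigma_finite N.prob_space_distr)
  also have "distr ?N (past_space t) ?F = distr \<mu> (past_space t) (past t)"
    unfolding \<mu>_def by (subst distr_distr) (auto simp: comp_def)
  also have "distr ?N borel (\<lambda>z. z $ q) = distr \<mu> borel h"
    unfolding \<mu>_def by (subst distr_distr) (auto simp: comp_def h_def inv)
  finally show ?thesis .
qed

text \<open>
  The projection \<open>e\<close> picks one of the two paths of a coupling. It is a parameter because causality is needed in
  both directions, with \<open>e = fst\<close> and \<open>e = snd\<close>.
\<close>

lemma innovation_indep_joint_past:
  fixes \<pi> :: "'w measure" and e :: "'w \<Rightarrow> real ^ ('t::{finite,linorder} \<times> 'd::finite)" and a :: "real ^ ('t \<times> 'd)"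
  assumes L: "causal_iso L" and q: "t < fst q"
  defines "\<mu> \<equiv> distr std_gaussian borel (\<lambda>z. a + L *v z)"
    and "h \<equiv> \<lambda>x. (matrix_inv L *v (x - a)) $ q"
  assumes \<pi>: "prob_space \<pi>" and rp: "regular_cond_law \<pi> X MX Y MY p"
    and rm: "regular_cond_law \<mu> (past t) (past_space t) (future t) (future_space t) m"
    and u: "u \<in> MX \<rightarrow>\<^sub>M past_space t" and v: "v \<in> MY \<rightarrow>\<^sub>M future_space t"
    and e[measurable]: "e \<in> borel_measurable \<pi>" and law: "distr \<pi> borel e = \<mu>"
    and ue: "\<And>w. u (X w) = past t (e w)" and ve: "\<And>w. v (Y w) = future t (e w)"
    and proj: "AE w in \<pi>. distr (p (X w)) (future_space t) v = m (past t (e w))"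
  shows "distr \<pi> (MX \<Otimes>\<^sub>M borel) (\<lambda>w. (X w, h (e w))) = distr \<pi> MX X \<Otimes>\<^sub>M distr \<pi> borel (\<lambda>w. h (e w))"
proof -
  interpret N: prob_space "std_gaussian :: (real ^ ('t \<times> 'd)) measure" by (rule prob_space_std_gaussian)
  let ?h = "\<lambda>w. h (path_of t (fst w) (snd w))"
  have [measurable]: "h \<in> borel_measurable borel" unfolding h_def by measurable
  have \<mu>: "prob_space \<mu>" unfolding \<mu>_def by (rule N.prob_space_distr) measurable
  have "distr \<pi> (MX \<Otimes>\<^sub>M borel) (\<lambda>w. (X w, ?h (u (X w), v (Y w)))) = distr \<pi> MX X \<Otimes>\<^sub>M distr \<pi> borel (\<lambda>w. ?h (u (X w), v (Y w)))"
  proof (rule product_law_of_joint_kernel[OF \<pi> \<mu> rp rm u v])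
    show "distr \<pi> (past_space t) (\<lambda>w. u (X w)) = distr \<mu> (past_space t) (past t)"
      unfolding ue law[symmetric] by (simp add: distr_distr comp_def)
    show "AE w in \<pi>. distr (p (X w)) (future_space t) v = m (u (X w))"
      using proj by (simp add: ue)
    show "?h \<in> borel_measurable (past_space t \<Otimes>\<^sub>M future_space t)" by measurable
    show "distr \<mu> (past_space t \<Otimes>\<^sub>M borel) (\<lambda>w. (past t w, ?h (past t w, future t w))) =
       distr \<mu> (past_space t) (past t) \<Otimes>\<^sub>M distr \<mu> borel (\<lambda>w. ?h (past t w, future t w))"
      using innovation_indep_past[OF L q, of a] by (simp add: \<mu>_def h_def)
  qed
  then show ?thesis by (simp add: ue ve)
qed

text \<open>
  The coordinate with the earlier time is a function of the joint past up to that time, and the later one is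
  independent of this joint past.
\<close>

lemma bicausal_innovations_uncorrelated:
  fixes a b :: "real ^ ('t::{finite,linorder} \<times> 'd::finite)" and L M :: "real ^ ('t \<times> 'd) ^ ('t \<times> 'd)"
  assumes L: "causal_iso L" and M: "causal_iso M"
  defines "\<mu> \<equiv> distr std_gaussian borel (\<lambda>z. a + L *v z)" and "\<nu> \<equiv> distr std_gaussian borel (\<lambda>z. b + M *v z)"
  assumes \<pi>: "\<pi> \<in> bicausal_couplings \<mu> \<nu>" and ne: "fst p \<noteq> fst q"
  shows "(\<integral>w. (matrix_inv L *v (fst w - a)) $ p * (matrix_inv M *v (snd w - b)) $ q \<partial>\<pi>) = 0"
proof -
  have coup: "\<pi> \<in> couplings \<mu> \<nu>" using \<pi> by (simp add: bicausal_couplings_def)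
  have sets: "sets \<pi> = sets (borel \<Otimes>\<^sub>M borel)"
    using coup by (simp add: couplings_def \<mu>_def \<nu>_def sets_pair_measure_distr_borel)
  note [measurable_cong] = sets
  have P: "prob_space \<pi>" using coup by (simp add: couplings_def)
  interpret P: prob_space \<pi> by fact
  have law: "distr \<pi> borel fst = \<mu>" "distr \<pi> borel snd = \<nu>"
  proof -
    have "distr \<pi> borel fst = distr \<pi> \<mu> fst" "distr \<pi> borel snd = distr \<pi> \<nu> snd"
      by (auto intro!: distr_cong simp: \<mu>_def \<nu>_def)
    then show "distr \<pi> borel fst = \<mu>" "distr \<pi> borel snd = \<nu>"
      using coup by (simp_all add: couplings_def)
  qed
  have mean: "has_bochner_integral \<pi> (\<lambda>w. (matrix_inv L *v (fst w - a)) $ r) 0"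
    "has_bochner_integral \<pi> (\<lambda>w. (matrix_inv M *v (snd w - b)) $ r) 0" for r
  proof -
    have "has_bochner_integral \<mu> (\<lambda>x. (matrix_inv L *v (x - a)) $ r) 0"
      unfolding \<mu>_def using has_bochner_integral_std_gaussian_nth[of r]
      by (subst has_bochner_integral_distr_iff) (simp_all add: matrix_inv_vector[OF causal_iso_invertible[OF L]])
    then show "has_bochner_integral \<pi> (\<lambda>w. (matrix_inv L *v (fst w - a)) $ r) 0"
      unfolding law(1)[symmetric] by (subst (asm) has_bochner_integral_distr_iff) simp_all
    have "has_bochner_integral \<nu> (\<lambda>x. (matrix_inv M *v (x - b)) $ r) 0"
      unfolding \<nu>_def using has_bochner_integral_std_gaussian_nth[of r]
      by (subst has_bochner_integral_distr_iff) (simp_all add: matrix_inv_vector[OF causal_iso_invertible[OF M]])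
    then show "has_bochner_integral \<pi> (\<lambda>w. (matrix_inv M *v (snd w - b)) $ r) 0"
      unfolding law(2)[symmetric] by (subst (asm) has_bochner_integral_distr_iff) simp_all
  qed
  \<comment> \<open>The two times differ, so \<open>t\<close> is not the last time and bicausality at \<open>t\<close> is available.\<close>
  define t where "t = min (fst p) (fst q)"
  have "t < Max UNIV"
  proof -
    have "max (fst p) (fst q) \<le> Max UNIV" by (rule Max_ge) auto
    moreover have "t < max (fst p) (fst q)" using ne by (auto simp: t_def min_def max_def)
    ultimately show ?thesis by (metis less_le_trans)
  qed
  then obtain m n k where
    rm: "regular_cond_law \<mu> (past t) (past_space t) (future t) (future_space t) m" and
    rn: "regular_cond_law \<nu> (past t) (past_space t) (future t) (future_space t) n" and
    rk: "regular_cond_law \<pi>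
       (\<lambda>(x, y). (past t x, past t y)) (past_space t \<Otimes>\<^sub>M past_space t)
       (\<lambda>(x, y). (future t x, future t y)) (future_space t \<Otimes>\<^sub>M future_space t) k" and
    ae: "AE (x, y) in \<pi>. k (past t x, past t y) \<in> couplings (m (past t x)) (n (past t y))"
    using \<pi> unfolding bicausal_couplings_def by blast
  have past_in: "past t x \<in> space (past_space t)" for x :: "real ^ ('t \<times> 'd)"
    using measurable_space[OF measurable_past[of t], of x] by simp
  have sets_m: "sets (m (past t x)) = sets (future_space t)" for x
  proof -
    have "m \<in> past_space t \<rightarrow>\<^sub>M prob_algebra (future_space t)" using rm unfolding regular_cond_law_def by blast
    from measurable_space[OF this past_in[of x]] show ?thesis by (simp add: space_prob_algebra)
  qed
  have sets_n: "sets (n (past t x)) = sets (future_space t)" for x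
  proof -
    have "n \<in> past_space t \<rightarrow>\<^sub>M prob_algebra (future_space t)" using rn unfolding regular_cond_law_def by blast
    from measurable_space[OF this past_in[of x]] show ?thesis by (simp add: space_prob_algebra)
  qed
  let ?X = "\<lambda>(x, y). (past t x, past t y)" and ?MX = "past_space t \<Otimes>\<^sub>M past_space t :: (('t \<times> 'd \<Rightarrow> real) \<times> ('t \<times> 'd \<Rightarrow> real)) measure"
  have [measurable]: "?X \<in> \<pi> \<rightarrow>\<^sub>M ?MX" unfolding split_beta' by measurable
  show ?thesis
  proof (cases "fst p < fst q")
    case True
    then have t: "fst p \<le> t" "t < fst q" by (auto simp: t_def)
    have proj: "AE w in \<pi>. distr (k (?X w)) (future_space t) snd = n (past t (snd w))"
      using ae
    proof eventually_elim
      case (elim w)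
      have "distr (k (?X w)) (future_space t) snd = distr (k (?X w)) (n (past t (snd w))) snd"
        by (rule distr_cong) (simp_all add: sets_n)
      with elim show ?case by (simp add: couplings_def split_beta')
    qed
    have "distr \<pi> (?MX \<Otimes>\<^sub>M borel) (\<lambda>w. (?X w, (matrix_inv M *v (snd w - b)) $ q)) =
        distr \<pi> ?MX ?X \<Otimes>\<^sub>M distr \<pi> borel (\<lambda>w. (matrix_inv M *v (snd w - b)) $ q)"
      by (rule innovation_indep_joint_past[OF M t(2) P rk rn[unfolded \<nu>_def], where u = snd and v = snd])
        (use proj law in \<open>auto simp: \<nu>_def split_beta'\<close>)
    then have ind: "P.indep_var borel (\<lambda>w. (\<lambda>u. (matrix_inv L *v (path_of t (fst u) (future t 0) - a)) $ p) (?X w))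
        borel (\<lambda>w. (matrix_inv M *v (snd w - b)) $ q)"
      by (rule indep_var_of_product_law[OF P, rotated 3]) measurable
    have eq: "(matrix_inv L *v (path_of t (past t x) (future t 0) - a)) $ p = (matrix_inv L *v (x - a)) $ p" for x
      by (rule causal_iso_agree[OF causal_iso_matrix_inv[OF L] _ t(1)]) (simp add: path_of_past_nth)
    then have "P.indep_var borel (\<lambda>w. (matrix_inv L *v (fst w - a)) $ p) borel (\<lambda>w. (matrix_inv M *v (snd w - b)) $ q)"
      using ind by (simp add: split_beta')
    from P.indep_var_lebesgue_integral[OF this] show ?thesis
      using mean[of p] mean[of q] by (simp add: has_bochner_integral_iff)
  next
    case False
    with ne have t: "fst q \<le> t" "t < fst p" by (auto simp: t_def)
    have proj: "AE w in \<pi>. distr (k (?X w)) (future_space t) fst = m (past t (fst w))"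
      using ae
    proof eventually_elim
      case (elim w)
      have "distr (k (?X w)) (future_space t) fst = distr (k (?X w)) (m (past t (fst w))) fst"
        by (rule distr_cong) (simp_all add: sets_m)
      with elim show ?case by (simp add: couplings_def split_beta')
    qed
    have "distr \<pi> (?MX \<Otimes>\<^sub>M borel) (\<lambda>w. (?X w, (matrix_inv L *v (fst w - a)) $ p)) =
        distr \<pi> ?MX ?X \<Otimes>\<^sub>M distr \<pi> borel (\<lambda>w. (matrix_inv L *v (fst w - a)) $ p)"
      by (rule innovation_indep_joint_past[OF L t(2) P rk rm[unfolded \<mu>_def], where u = fst and v = fst])
        (use proj law in \<open>auto simp: \<mu>_def split_beta'\<close>)
    then have ind: "P.indep_var borel (\<lambda>w. (\<lambda>u. (matrix_inv M *v (path_of t (snd u) (future t 0) - b)) $ q) (?X w))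
        borel (\<lambda>w. (matrix_inv L *v (fst w - a)) $ p)"
      by (rule indep_var_of_product_law[OF P, rotated 3]) measurable
    have eq: "(matrix_inv M *v (path_of t (past t y) (future t 0) - b)) $ q = (matrix_inv M *v (y - b)) $ q" for y
      by (rule causal_iso_agree[OF causal_iso_matrix_inv[OF M] _ t(1)]) (simp add: path_of_past_nth)
    have "P.indep_var borel (\<lambda>w. (matrix_inv M *v (snd w - b)) $ q) borel (\<lambda>w. (matrix_inv L *v (fst w - a)) $ p)"
      using ind by (simp add: split_beta' eq)
    from P.indep_var_lebesgue_integral[OF this] show ?thesis
      using mean[of p] mean[of q] by (simp add: has_bochner_integral_iff mult.commute)
  qed
qed

section \<open>The optimal value for whitened Gaussians\<close>

definition whiten_pair :: "real ^ 'n \<Rightarrow> real ^ 'n ^ 'n \<Rightarrow> real ^ 'n \<Rightarrow> real ^ 'n ^ 'n \<Rightarrow>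
    (real ^ 'n) \<times> (real ^ 'n) \<Rightarrow> (real ^ 'n) \<times> (real ^ 'n)" where
  "whiten_pair a L b M = (\<lambda>(x, y). (matrix_inv L *v (x - a), matrix_inv M *v (y - b)))"

lemma measurable_whiten_pair [measurable]:
  "whiten_pair a L b M \<in> borel \<Otimes>\<^sub>M borel \<rightarrow>\<^sub>M borel \<Otimes>\<^sub>M borel"
  unfolding whiten_pair_def split_beta' by measurable

lemma whiten_affine_pair:
  assumes "invertible L" "invertible M"
  shows "whiten_pair a L b M (affine_pair a L b M u) = u" "affine_pair a L b M (whiten_pair a L b M u) = u"
  by (simp_all add: whiten_pair_def affine_pair_def split_beta' matrix_inv_vector assms)

text \<open>
  Two Gaussian laws with causal square roots \<open>L\<close> and \<open>M\<close> of their covariances that are rotated such that the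
  diagonal blocks of \<open>M\<^sup>T L\<close> are diagonal, with singular values \<open>s\<close>.
\<close>

locale whitened_gaussians =
  fixes a b :: "real ^ ('t::{finite,linorder} \<times> 'd::finite)"
    and L M :: "real ^ ('t \<times> 'd) ^ ('t \<times> 'd)"
    and s :: "'t \<times> 'd \<Rightarrow> real"
  assumes L: "causal_iso L" and M: "causal_iso M"
    and s_nonneg: "\<And>p. 0 \<le> s p"
    and diag: "\<And>p q. fst p = fst q \<Longrightarrow> (transpose M ** L) $ p $ q = (if p = q then s p else 0)"
begin

abbreviation "\<mu> \<equiv> distr std_gaussian borel (\<lambda>z. a + L *v z)"
abbreviation "\<nu> \<equiv> distr std_gaussian borel (\<lambda>z. b + M *v z)"
abbreviation "law P \<equiv> distr P (borel \<Otimes>\<^sub>M borel) (affine_pair a L b M)"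
abbreviation "cost \<pi> \<equiv> enn2ereal (\<integral>\<^sup>+(x, y). ennreal ((norm (x - y))\<^sup>2) \<partial>\<pi>)"
abbreviation "corr P p \<equiv> (\<integral>u. fst u $ p * snd u $ p \<partial>P)"

definition "base = (norm (a - b))\<^sup>2 + trace (L ** transpose L) + trace (M ** transpose M)"

lemmas inverses = causal_iso_invertible[OF L] causal_iso_invertible[OF M]

text \<open>
  The mixed moments between distinct times vanish by \<open>off\<close>, those within one time but between distinct coordinates
  have coefficient 0 by \<open>diag\<close>.
\<close>

lemma cost_law:
  assumes P: "P \<in> couplings std_gaussian std_gaussian"
    and off: "\<And>p q. fst p \<noteq> fst q \<Longrightarrow> (\<integral>u. fst u $ p * snd u $ q \<partial>P) = 0"
  shows "cost (law P) = ereal (base - 2 * (\<Sum>p\<in>UNIV. s p * corr P p))"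
proof -
  note [measurable_cong] = couplings_std_gaussianD(2)[OF P]
  let ?f = "\<lambda>u. (norm ((a - b) + L *v fst u - M *v snd u))\<^sup>2"
  have "(\<Sum>q\<in>UNIV. \<Sum>r\<in>UNIV. (transpose M ** L) $ r $ q * (\<integral>u. fst u $ q * snd u $ r \<partial>P)) =
     (\<Sum>q\<in>UNIV. \<Sum>r\<in>UNIV. if r = q then s q * corr P q else 0)"
  proof (intro sum.cong refl)
    fix q r
    show "(transpose M ** L) $ r $ q * (\<integral>u. fst u $ q * snd u $ r \<partial>P) = (if r = q then s q * corr P q else 0)"
    proof (cases "fst r = fst q")
      case True
      then show ?thesis by (simp add: diag)
    next
      case False
      then have "fst q \<noteq> fst r" "r \<noteq> q" by auto
      then show ?thesis by (simp add: off del: mult_eq_0_iff)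
    qed
  qed
  then have hb: "has_bochner_integral P ?f (base - 2 * (\<Sum>p\<in>UNIV. s p * corr P p))"
    using has_bochner_integral_transport_cost[OF P, of "a - b" L M] by (simp add: base_def)
  have "(\<integral>\<^sup>+(x, y). ennreal ((norm (x - y))\<^sup>2) \<partial>law P) = (\<integral>\<^sup>+u. ennreal (?f u) \<partial>P)"
    by (subst nn_integral_distr) (auto simp: affine_pair_def split_beta' algebra_simps)
  also have "\<dots> = ennreal (base - 2 * (\<Sum>p\<in>UNIV. s p * corr P p))"
    using hb by (subst nn_integral_eq_integral) (auto simp: has_bochner_integral_iff)
  finally have "(\<integral>\<^sup>+(x, y). ennreal ((norm (x - y))\<^sup>2) \<partial>law P) = ennreal (base - 2 * (\<Sum>p\<in>UNIV. s p * corr P p))" .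
  moreover have "0 \<le> base - 2 * (\<Sum>p\<in>UNIV. s p * corr P p)"
  proof -
    have "0 \<le> (\<integral>u. ?f u \<partial>P)" by (rule Bochner_Integration.integral_nonneg) simp
    then show ?thesis using hb by (simp only: has_bochner_integral_iff)
  qed
  ultimately show ?thesis by (simp add: enn2ereal_ennreal)
qed

lemma prod_law: "\<mu> \<Otimes>\<^sub>M \<nu> = law (std_gaussian \<Otimes>\<^sub>M std_gaussian)"
proof -
  interpret N: prob_space "std_gaussian :: (real ^ ('t \<times> 'd)) measure" by (rule prob_space_std_gaussian)
  show ?thesis
    unfolding affine_pair_def
    by (rule pair_measure_distr) (auto intro!: prob_space_imp_sigma_finite N.prob_space_distr)
qed

lemma sets_prod_law [simp]: "sets (\<mu> \<Otimes>\<^sub>M \<nu>) = sets (borel \<Otimes>\<^sub>M borel)"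
  by (intro sets_pair_measure_cong) simp_all

lemma prob_space_prod_law: "prob_space (\<mu> \<Otimes>\<^sub>M \<nu>)"
  unfolding prod_law by (rule prob_space.prob_space_distr[OF prob_space_std_gaussian_pair]) measurable

lemma sets_std_pair [simp, measurable_cong]:
  "sets (std_gaussian \<Otimes>\<^sub>M std_gaussian) = sets (borel \<Otimes>\<^sub>M borel)"
  by (intro sets_pair_measure_cong) simp_all

lemma kl_div_law_ge:
  assumes P: "P \<in> couplings std_gaussian std_gaussian" and d: "\<And>p. \<bar>d p\<bar> < 1"
  shows "ereal (\<Sum>p\<in>UNIV. - ln (1 - (d p)\<^sup>2) / 2 + d p * (corr P p - d p) / (1 - (d p)\<^sup>2)) \<le> kl_div (law P) (\<mu> \<Otimes>\<^sub>M \<nu>)"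
proof -
  note D = couplings_std_gaussianD[OF P]
  note [measurable_cong] = D(2)
  interpret C: prob_space "corr_gaussian d" by (rule prob_space_corr_gaussian)
  let ?g = "\<lambda>u. corr_log_density d (whiten_pair a L b M u)"
  have hb: "has_bochner_integral (law P) ?g
      (\<Sum>p\<in>UNIV. - ln (1 - (d p)\<^sup>2) / 2 + d p * (corr P p - d p) / (1 - (d p)\<^sup>2))"
    using has_bochner_integral_corr_log_density[OF P d]
    by (subst has_bochner_integral_distr_iff) (simp_all add: whiten_affine_pair[OF inverses])
  have "ereal (\<integral>u. ?g u \<partial>law P) \<le> kl_div (law P) (\<mu> \<Otimes>\<^sub>M \<nu>)"
  proof (rule kl_div_ge)
    show "sigma_finite_measure (\<mu> \<Otimes>\<^sub>M \<nu>)" by (rule prob_space_imp_sigma_finite[OF prob_space_prod_law])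
    show "prob_space (law P)" by (rule prob_space.prob_space_distr[OF D(1)]) measurable
    show "sets (law P) = sets (\<mu> \<Otimes>\<^sub>M \<nu>)" by simp
    show "?g \<in> borel_measurable (\<mu> \<Otimes>\<^sub>M \<nu>)"
      by (simp cong: measurable_cong_sets)
    show "integrable (law P) ?g" using hb by (simp add: has_bochner_integral_iff)
    have "(\<integral>\<^sup>+u. ennreal (exp (?g u)) \<partial>(\<mu> \<Otimes>\<^sub>M \<nu>)) = (\<integral>\<^sup>+u. ennreal (exp (corr_log_density d u)) \<partial>(std_gaussian \<Otimes>\<^sub>M std_gaussian))"
      unfolding prod_law by (subst nn_integral_distr) (simp_all add: whiten_affine_pair[OF inverses])
    also have "\<dots> = emeasure (corr_gaussian d) (space (corr_gaussian d))"
    proof -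
      have "corr_log_density d \<in> borel_measurable (std_gaussian \<Otimes>\<^sub>M std_gaussian)" by measurable
      moreover have "space (std_gaussian \<Otimes>\<^sub>M std_gaussian) \<in> sets (std_gaussian \<Otimes>\<^sub>M (std_gaussian :: (real ^ ('t \<times> 'd)) measure))"
        by (rule sets.top)
      ultimately show ?thesis
        unfolding corr_gaussian_eq_density[of d, OF d] space_density
        by (subst emeasure_density) (auto intro!: nn_integral_cong simp del: sets_std_pair)
    qed
    also have "\<dots> = 1" by (rule C.emeasure_space_1)
    finally show "(\<integral>\<^sup>+u. ennreal (exp (?g u)) \<partial>(\<mu> \<Otimes>\<^sub>M \<nu>)) \<le> 1" by simp
  qed
  then show ?thesis using hb by (simp add: has_bochner_integral_iff)
qed

lemma kl_div_law_corr_gaussian: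
  assumes d: "\<And>p. \<bar>d p\<bar> < 1"
  shows "kl_div (law (corr_gaussian d)) (\<mu> \<Otimes>\<^sub>M \<nu>) = ereal (\<Sum>p\<in>UNIV. - ln (1 - (d p)\<^sup>2) / 2)"
proof -
  let ?g = "\<lambda>u. corr_log_density d (whiten_pair a L b M u)"
  have hb: "has_bochner_integral (law (corr_gaussian d)) ?g (\<Sum>p\<in>UNIV. - ln (1 - (d p)\<^sup>2) / 2)"
    using has_bochner_integral_corr_log_density[OF corr_gaussian_coupling[of d, OF d], of d, OF d]
    by (subst has_bochner_integral_distr_iff) (simp_all add: whiten_affine_pair[OF inverses] corr_gaussian_correlation[of d, OF d])
  have "kl_div (law (corr_gaussian d)) (\<mu> \<Otimes>\<^sub>M \<nu>) = ereal (\<integral>u. ?g u \<partial>law (corr_gaussian d))"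
  proof (rule kl_div_density)
    show "sigma_finite_measure (\<mu> \<Otimes>\<^sub>M \<nu>)" by (rule prob_space_imp_sigma_finite[OF prob_space_prod_law])
    show "?g \<in> borel_measurable (\<mu> \<Otimes>\<^sub>M \<nu>)"
      by (simp cong: measurable_cong_sets)
    show "integrable (law (corr_gaussian d)) ?g" using hb by (simp add: has_bochner_integral_iff)
    have "density (\<mu> \<Otimes>\<^sub>M \<nu>) (\<lambda>u. ennreal (exp (?g u))) =
        distr (density (std_gaussian \<Otimes>\<^sub>M std_gaussian) (\<lambda>u. ennreal (exp (?g (affine_pair a L b M u))))) (borel \<Otimes>\<^sub>M borel) (affine_pair a L b M)"
      unfolding prod_law by (rule density_distr) measurable
    also have "\<dots> = law (corr_gaussian d)"
      by (simp add: whiten_affine_pair[OF inverses] corr_gaussian_eq_density[of d, OF d])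
    finally show "law (corr_gaussian d) = density (\<mu> \<Otimes>\<^sub>M \<nu>) (\<lambda>u. ennreal (exp (?g u)))" ..
  qed
  then show ?thesis using hb by (simp add: has_bochner_integral_iff)
qed

text \<open>
  The whitened coupling \<open>P\<close> retains only the consequence of bicausality that enters the cost.
\<close>

lemma bicausal_eq_law:
  assumes \<pi>: "\<pi> \<in> bicausal_couplings \<mu> \<nu>"
  obtains P where "P \<in> couplings std_gaussian std_gaussian"
    "\<And>p q. fst p \<noteq> fst q \<Longrightarrow> (\<integral>u. fst u $ p * snd u $ q \<partial>P) = 0" "\<pi> = law P"
proof
  let ?P = "distr \<pi> (borel \<Otimes>\<^sub>M borel) (whiten_pair a L b M)"
  have coup: "\<pi> \<in> couplings \<mu> \<nu>" using \<pi> by (simp add: bicausal_couplings_def)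
  have sets: "sets \<pi> = sets (borel \<Otimes>\<^sub>M borel)" using coup by (simp add: couplings_def)
  note [measurable_cong] = sets
  interpret prob_space \<pi> using coup by (simp add: couplings_def)
  have law: "distr \<pi> borel fst = \<mu>" "distr \<pi> borel snd = \<nu>"
  proof -
    have "distr \<pi> borel fst = distr \<pi> \<mu> fst" "distr \<pi> borel snd = distr \<pi> \<nu> snd"
      by (auto intro!: distr_cong)
    then show "distr \<pi> borel fst = \<mu>" "distr \<pi> borel snd = \<nu>"
      using coup by (simp_all add: couplings_def)
  qed
  have "distr ?P std_gaussian fst = distr (distr \<pi> borel fst) std_gaussian (\<lambda>x. matrix_inv L *v (x - a))"
    by (simp add: distr_distr comp_def whiten_pair_def split_beta')
  also have "\<dots> = distr std_gaussian std_gaussian (\<lambda>x. x)"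
    unfolding law by (simp add: distr_distr comp_def matrix_inv_vector[OF inverses(1)])
  finally have 1: "distr ?P std_gaussian fst = std_gaussian" by (simp add: distr_id2)
  have "distr ?P std_gaussian snd = distr (distr \<pi> borel snd) std_gaussian (\<lambda>x. matrix_inv M *v (x - b))"
    by (simp add: distr_distr comp_def whiten_pair_def split_beta')
  also have "\<dots> = distr std_gaussian std_gaussian (\<lambda>x. x)"
    unfolding law by (simp add: distr_distr comp_def matrix_inv_vector[OF inverses(2)])
  finally have 2: "distr ?P std_gaussian snd = std_gaussian" by (simp add: distr_id2)
  have "prob_space ?P" by (rule prob_space_distr) measurable
  with 1 2 show "?P \<in> couplings std_gaussian std_gaussian" by (simp add: couplings_def)
  show "(\<integral>u. fst u $ p * snd u $ q \<partial>?P) = 0" if "fst p \<noteq> fst q" for p q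
    using bicausal_innovations_uncorrelated[OF L M \<pi> that]
    by (subst integral_distr) (simp_all add: whiten_pair_def split_beta')
  have "law ?P = distr \<pi> (borel \<Otimes>\<^sub>M borel) (\<lambda>x. x)"
    by (simp add: distr_distr comp_def whiten_affine_pair[OF inverses])
  then show "\<pi> = law ?P" by (simp add: distr_id2 sets)
qed

lemma corr_le_1:
  fixes p :: "'t \<times> 'd"
  assumes P: "P \<in> couplings std_gaussian std_gaussian"
  shows "corr P p \<le> 1"
proof -
  have sq: "has_bochner_integral std_gaussian (\<lambda>z :: real ^ ('t \<times> 'd). (z $ p)\<^sup>2) 1"
    using has_bochner_integral_std_gaussian_mult[of p p] by (simp add: power2_eq_square)
  note S = has_bochner_integral_coupling[OF P sq]
  have hb: "has_bochner_integral P (\<lambda>u. ((fst u $ p)\<^sup>2 + (snd u $ p)\<^sup>2) / 2) ((1 + 1) / 2)"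
    by (intro has_bochner_integral_divide_zero has_bochner_integral_add S)
  have "corr P p \<le> (\<integral>u. ((fst u $ p)\<^sup>2 + (snd u $ p)\<^sup>2) / 2 \<partial>P)"
  proof (rule integral_mono)
    show "integrable P (\<lambda>u. fst u $ p * snd u $ p)" by (rule integrable_coupling_mult[OF P])
    show "integrable P (\<lambda>u. ((fst u $ p)\<^sup>2 + (snd u $ p)\<^sup>2) / 2)" using hb by (simp add: has_bochner_integral_iff)
    fix u :: "(real ^ ('t \<times> 'd)) \<times> (real ^ ('t \<times> 'd))"
    have "0 \<le> (fst u $ p - snd u $ p)\<^sup>2" by simp
    then show "fst u $ p * snd u $ p \<le> ((fst u $ p)\<^sup>2 + (snd u $ p)\<^sup>2) / 2"
      by (simp add: power2_diff)
  qed
  with hb show ?thesis by (simp add: has_bochner_integral_iff)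
qed

lemma corr_gaussian_off_block:
  fixes p q :: "'t \<times> 'd"
  assumes d: "\<And>p. \<bar>d p\<bar> < 1" and "fst p \<noteq> fst q"
  shows "(\<integral>u. fst u $ p * snd u $ q \<partial>corr_gaussian d) = 0"
proof -
  let ?\<pi> = "law (corr_gaussian d)"
  have "(\<integral>u. fst u $ p * snd u $ q \<partial>corr_gaussian d) = (\<integral>w. (matrix_inv L *v (fst w - a)) $ p * (matrix_inv M *v (snd w - b)) $ q \<partial>?\<pi>)"
    by (subst integral_distr) (simp_all add: affine_pair_def split_beta' matrix_inv_vector inverses)
  also have "\<dots> = 0"
    by (rule bicausal_innovations_uncorrelated[OF L M affine_corr_gaussian_bicausal[OF L M, of d, OF d] assms(2)])
  finally show ?thesis .
qed

lemma cost_law_corr_gaussian: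
  assumes d: "\<And>p. \<bar>d p\<bar> < 1"
  shows "cost (law (corr_gaussian d)) = ereal (base - 2 * (\<Sum>p\<in>UNIV. s p * d p))"
  using cost_law[OF corr_gaussian_coupling[of d, OF d] corr_gaussian_off_block[of d, OF d]]
  by (simp add: corr_gaussian_correlation[of d, OF d])

text \<open>
  Correlation 1 would attain the infimum, but that pair has no density. The correlated pairs with \<open>\<delta> < 1\<close> suffice,
  since their cost tends to the value as \<open>\<delta>\<close> tends to 1.
\<close>

lemma adapted_wasserstein_sq_zero:
  "adapted_wasserstein_sq 0 \<mu> \<nu> = ereal (base - 2 * (\<Sum>p\<in>UNIV. s p))"
proof (rule antisym)
  have le: "adapted_wasserstein_sq 0 \<mu> \<nu> \<le> ereal (base - 2 * (\<Sum>p\<in>UNIV. s p * \<delta>))" if "0 < \<delta>" "\<delta> < 1" for \<delta>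
  proof -
    have d: "\<bar>\<delta>\<bar> < 1" using that by simp
    have "adapted_wasserstein_sq 0 \<mu> \<nu> \<le> cost (law (corr_gaussian (\<lambda>_. \<delta>))) + ereal 0 * kl_div (law (corr_gaussian (\<lambda>_. \<delta>))) (\<mu> \<Otimes>\<^sub>M \<nu>)"
      unfolding adapted_wasserstein_sq_def by (rule INF_lower) (rule affine_corr_gaussian_bicausal[OF L M d])
    also have "\<dots> = ereal (base - 2 * (\<Sum>p\<in>UNIV. s p * \<delta>))"
      using cost_law_corr_gaussian[of "\<lambda>_. \<delta>", OF d] by (simp add: zero_ereal_def[symmetric])
    finally show ?thesis .
  qed
  show "adapted_wasserstein_sq 0 \<mu> \<nu> \<le> ereal (base - 2 * (\<Sum>p\<in>UNIV. s p))"
  proof (rule tendsto_lowerbound)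
    show "((\<lambda>\<delta>. ereal (base - 2 * (\<Sum>p\<in>UNIV. s p * \<delta>))) \<longlongrightarrow> ereal (base - 2 * (\<Sum>p\<in>UNIV. s p))) (at_left 1)"
      by (rule tendsto_eq_intros | simp)+
    show "\<forall>\<^sub>F \<delta> in at_left 1. adapted_wasserstein_sq 0 \<mu> \<nu> \<le> ereal (base - 2 * (\<Sum>p\<in>UNIV. s p * \<delta>))"
      using eventually_at_left_real[OF zero_less_one] by eventually_elim (simp_all add: le)
  qed simp
  show "ereal (base - 2 * (\<Sum>p\<in>UNIV. s p)) \<le> adapted_wasserstein_sq 0 \<mu> \<nu>"
    unfolding adapted_wasserstein_sq_def
  proof (rule INF_greatest)
    fix \<pi> assume "\<pi> \<in> bicausal_couplings \<mu> \<nu>"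
    from bicausal_eq_law[OF this] obtain P where P: "P \<in> couplings std_gaussian std_gaussian"
      and off: "\<And>p q. fst p \<noteq> fst q \<Longrightarrow> (\<integral>u. fst u $ p * snd u $ q \<partial>P) = 0" and \<pi>: "\<pi> = law P"
      by blast
    have "(\<Sum>p\<in>UNIV. s p * corr P p) \<le> (\<Sum>p\<in>UNIV. s p)"
      by (rule sum_mono) (use corr_le_1[OF P] s_nonneg in \<open>simp add: mult_left_le\<close>)
    moreover have "cost \<pi> = ereal (base - 2 * (\<Sum>p\<in>UNIV. s p * corr P p))"
      unfolding \<pi> by (rule cost_law[OF P off])
    ultimately show "ereal (base - 2 * (\<Sum>p\<in>UNIV. s p)) \<le> cost \<pi> + ereal 0 * kl_div \<pi> (\<mu> \<Otimes>\<^sub>M \<nu>)"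
      by (simp add: zero_ereal_def[symmetric])
  qed
qed

text \<open>
  By \<open>opt\<close> the dependence of the two lower bounds on the correlations of the coupling cancels, so the sum is the same
  number for every coupling. For the correlated pair with parameter \<open>d\<close> both bounds are equalities.
\<close>

lemma adapted_wasserstein_sq_pos:
  assumes "0 < l" and d: "\<And>p. \<bar>d p\<bar> < 1" and opt: "\<And>p. l * d p = 2 * s p * (1 - (d p)\<^sup>2)"
  shows "adapted_wasserstein_sq l \<mu> \<nu> = ereal (base - 2 * (\<Sum>p\<in>UNIV. s p * d p) - l / 2 * (\<Sum>p\<in>UNIV. ln (1 - (d p)\<^sup>2)))"
proof (rule antisym)
  have "adapted_wasserstein_sq l \<mu> \<nu> \<le> cost (law (corr_gaussian d)) + ereal l * kl_div (law (corr_gaussian d)) (\<mu> \<Otimes>\<^sub>M \<nu>)"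
    unfolding adapted_wasserstein_sq_def by (rule INF_lower) (rule affine_corr_gaussian_bicausal[OF L M d])
  also have "\<dots> = ereal (base - 2 * (\<Sum>p\<in>UNIV. s p * d p) - l / 2 * (\<Sum>p\<in>UNIV. ln (1 - (d p)\<^sup>2)))"
    unfolding cost_law_corr_gaussian[of d, OF d] kl_div_law_corr_gaussian[of d, OF d]
    by (simp add: sum_divide_distrib[symmetric] sum_negf)
  finally show "adapted_wasserstein_sq l \<mu> \<nu> \<le> \<dots>" .
  show "ereal (base - 2 * (\<Sum>p\<in>UNIV. s p * d p) - l / 2 * (\<Sum>p\<in>UNIV. ln (1 - (d p)\<^sup>2))) \<le> adapted_wasserstein_sq l \<mu> \<nu>"
    unfolding adapted_wasserstein_sq_def
  proof (rule INF_greatest)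
    fix \<pi> assume "\<pi> \<in> bicausal_couplings \<mu> \<nu>"
    from bicausal_eq_law[OF this] obtain P where P: "P \<in> couplings std_gaussian std_gaussian"
      and off: "\<And>p q. fst p \<noteq> fst q \<Longrightarrow> (\<integral>u. fst u $ p * snd u $ q \<partial>P) = 0" and \<pi>: "\<pi> = law P"
      by blast
    let ?k = "\<Sum>p\<in>UNIV. - ln (1 - (d p)\<^sup>2) / 2 + d p * (corr P p - d p) / (1 - (d p)\<^sup>2)"
    have "l * ?k = (\<Sum>p\<in>UNIV. - l / 2 * ln (1 - (d p)\<^sup>2) + 2 * s p * (corr P p - d p))"
      unfolding sum_distrib_left
    proof (rule sum.cong[OF refl])
      fix p
      have "1 - (d p)\<^sup>2 \<noteq> 0" using d[of p] abs_square_less_1[of "d p"] by linarith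
      then have "l * d p / (1 - (d p)\<^sup>2) = 2 * s p" by (simp add: opt)
      then have "l * d p / (1 - (d p)\<^sup>2) * (corr P p - d p) = 2 * s p * (corr P p - d p)" by simp
      then have X: "l * (d p * (corr P p - d p) / (1 - (d p)\<^sup>2)) = 2 * s p * (corr P p - d p)"
        by (simp add: mult.assoc)
      then show "l * (- ln (1 - (d p)\<^sup>2) / 2 + d p * (corr P p - d p) / (1 - (d p)\<^sup>2)) = - l / 2 * ln (1 - (d p)\<^sup>2) + 2 * s p * (corr P p - d p)"
        unfolding distrib_left X by simp
    qed
    also have "\<dots> = 2 * (\<Sum>p\<in>UNIV. s p * corr P p) - 2 * (\<Sum>p\<in>UNIV. s p * d p) - l / 2 * (\<Sum>p\<in>UNIV. ln (1 - (d p)\<^sup>2))"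
      by (simp add: sum.distrib sum_distrib_left sum_subtractf right_diff_distrib sum_negf mult.assoc)
    finally have k: "base - 2 * (\<Sum>p\<in>UNIV. s p * corr P p) + l * ?k =
        base - 2 * (\<Sum>p\<in>UNIV. s p * d p) - l / 2 * (\<Sum>p\<in>UNIV. ln (1 - (d p)\<^sup>2))" by simp
    have "ereal (base - 2 * (\<Sum>p\<in>UNIV. s p * d p) - l / 2 * (\<Sum>p\<in>UNIV. ln (1 - (d p)\<^sup>2))) =
        ereal (base - 2 * (\<Sum>p\<in>UNIV. s p * corr P p)) + ereal l * ereal ?k"
      unfolding k[symmetric] by simp
    also have "\<dots> \<le> cost \<pi> + ereal l * kl_div \<pi> (\<mu> \<Otimes>\<^sub>M \<nu>)"
    proof -
      have "cost \<pi> = ereal (base - 2 * (\<Sum>p\<in>UNIV. s p * corr P p))"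
        unfolding \<pi> by (rule cost_law[OF P off])
      moreover have "ereal l * ereal ?k \<le> ereal l * kl_div \<pi> (\<mu> \<Otimes>\<^sub>M \<nu>)"
        unfolding \<pi> by (rule ereal_mult_left_mono[OF kl_div_law_ge[OF P d]]) (use \<open>0 < l\<close> in simp)
      ultimately show ?thesis by (simp only: add_left_mono)
    qed
    finally show "ereal (base - 2 * (\<Sum>p\<in>UNIV. s p * d p) - l / 2 * (\<Sum>p\<in>UNIV. ln (1 - (d p)\<^sup>2))) \<le> cost \<pi> + ereal l * kl_div \<pi> (\<mu> \<Otimes>\<^sub>M \<nu>)" .
  qed
qed

end

section \<open>The closed formula\<close>

text \<open>
  With \<open>c = l / (4 x)\<close>, the number \<open>y = f_lambda l x\<close> is the positive root of \<open>y\<^sup>2 + 2 c y = 1\<close>.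
\<close>

lemma f_lambda_critical:
  assumes "0 < l" "0 \<le> x"
  shows "\<bar>f_lambda l x\<bar> < 1" "l * f_lambda l x = 2 * x * (1 - (f_lambda l x)\<^sup>2)"
proof -
  have "\<bar>f_lambda l x\<bar> < 1 \<and> l * f_lambda l x = 2 * x * (1 - (f_lambda l x)\<^sup>2)"
  proof (cases "x = 0")
    case False
    with assms have x: "0 < x" by simp
    define c where "c = l / (4 * x)"
    define y where "y = f_lambda l x"
    have c: "0 < c" using x assms by (simp add: c_def)
    have y: "y = sqrt (c\<^sup>2 + 1) - c"
      using x by (simp add: y_def f_lambda_def c_def)
    have "c = sqrt (c\<^sup>2)" using c by simp
    also have "\<dots> < sqrt (c\<^sup>2 + 1)" by (rule real_sqrt_less_mono) simp
    finally have ypos: "0 < y" by (simp add: y)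
    have "(y + c)\<^sup>2 = c\<^sup>2 + 1" by (simp add: y add_nonneg_nonneg)
    then have e: "1 - y\<^sup>2 = 2 * c * y" by (simp add: power2_eq_square algebra_simps)
    then have "0 < 1 - y\<^sup>2" using c ypos by simp
    then have "\<bar>y\<bar> < 1" using abs_square_less_1[of y] by simp
    moreover have "l * y = 2 * x * (1 - y\<^sup>2)"
      unfolding e using x by (simp add: c_def)
    ultimately show ?thesis by (simp add: y_def)
  qed (simp add: f_lambda_def)
  then show "\<bar>f_lambda l x\<bar> < 1" "l * f_lambda l x = 2 * x * (1 - (f_lambda l x)\<^sup>2)" by auto
qed

lemma f_lambda_zero: "f_lambda 0 = sgn"
  by (auto simp: f_lambda_def fun_eq_iff)

lemma tendsto_f_lambda:
  assumes "0 \<le> x"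
  shows "((\<lambda>l. x * f_lambda l x) \<longlongrightarrow> x) (at_right 0)"
    and "((\<lambda>l. l * ln (1 - (f_lambda l x)\<^sup>2)) \<longlongrightarrow> 0) (at_right 0)"
proof -
  have "((\<lambda>l. x * f_lambda l x) \<longlongrightarrow> x) (at_right 0) \<and> ((\<lambda>l. l * ln (1 - (f_lambda l x)\<^sup>2)) \<longlongrightarrow> 0) (at_right 0)"
  proof (cases "x = 0")
    case False
    with assms have x: "0 < x" by simp
    have f: "f_lambda l x = sqrt ((l / (4 * x))\<^sup>2 + 1) - l / (4 * x)" for l
      using x by (simp add: f_lambda_def)
    show ?thesis
      unfolding f using x by (intro conjI; real_asymp)
  qed (simp add: f_lambda_def)
  then show "((\<lambda>l. x * f_lambda l x) \<longlongrightarrow> x) (at_right 0)"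
    "((\<lambda>l. l * ln (1 - (f_lambda l x)\<^sup>2)) \<longlongrightarrow> 0) (at_right 0)" by auto
qed

theorem theorem2p4:
  fixes a b :: "real ^ ('t::{finite,linorder} \<times> 'd::{finite,linorder})"
    and A B L M :: "real ^ ('t \<times> 'd) ^ ('t \<times> 'd)"
    and S :: "'t \<Rightarrow> real ^ ('d::{finite,linorder}) ^ ('d::{finite,linorder})"
    and \<mu> \<nu> :: "(real ^ ('t \<times> 'd)) measure"
    and lam :: real
  assumes "\<mu> = gaussian_measure a A" and "\<nu> = gaussian_measure b B"
    and "cholesky A L" and "cholesky B M"
    and "0 \<le> lam"
    and "\<And>t. singular_value_matrix (block (transpose M ** L) t t) (S t)"
  shows "(let S' = block_diag S; D = map_matrix (f_lambda lam) S'
          in adapted_wasserstein_sq lam \<mu> \<nu> =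
            ereal ((norm (a - b))\<^sup>2 + trace (A + B) - 2 * trace (D ** S')
                   - lam / 2 * ln (det (mat 1 - D ** D))))
       \<and> f_lambda 0 = sgn
       \<and> adapted_wasserstein_sq 0 \<mu> \<nu> =
            ereal ((norm (a - b))\<^sup>2 + trace (A + B) - 2 * trace (block_diag S))
       \<and> ((\<lambda>l. adapted_wasserstein_sq l \<mu> \<nu>) \<longlongrightarrow> adapted_wasserstein_sq 0 \<mu> \<nu>) (at_right 0)"
proof -
  \<comment> \<open>The orthogonal factors are chosen for all times at once and absorbed into \<open>L\<close> and \<open>M\<close>.\<close>
  have "\<exists>U V. \<forall>t. orthogonal_matrix (U t) \<and> orthogonal_matrix (V t) \<and>
      block (transpose M ** L) t t = U t ** S t ** transpose (V t)"
    using assms(6) unfolding singular_value_matrix_def by metis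
  then obtain U V where U: "\<And>t. orthogonal_matrix (U t)" and V: "\<And>t. orthogonal_matrix (V t)"
    and svd: "\<And>t. block (transpose M ** L) t t = U t ** S t ** transpose (V t)" by blast
  have S_off: "S t $ i $ j = 0" if "i \<noteq> j" for t i j
    using assms(6) that unfolding singular_value_matrix_def by blast
  have S_nonneg: "0 \<le> S t $ i $ i" for t i
    using assms(6) unfolding singular_value_matrix_def by blast
  define L' where "L' = L ** block_diag V"
  define M' where "M' = M ** block_diag U"
  define s where "s p = S (fst p) $ snd p $ snd p" for p
  have A: "A = L' ** transpose L'" and B: "B = M' ** transpose M'"
  proof -
    have "L' ** transpose L' = L ** (block_diag V ** transpose (block_diag V)) ** transpose L"
      by (simp add: L'_def matrix_transpose_mul matrix_mul_assoc)
    then show "A = L' ** transpose L'" using assms(3) block_diag_orthogonal(2)[of V, OF V]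
      by (simp add: cholesky_def matrix_mul_rid)
    have "M' ** transpose M' = M ** (block_diag U ** transpose (block_diag U)) ** transpose M"
      by (simp add: M'_def matrix_transpose_mul matrix_mul_assoc)
    then show "B = M' ** transpose M'" using assms(4) block_diag_orthogonal(2)[of U, OF U]
      by (simp add: cholesky_def matrix_mul_rid)
  qed
  interpret whitened_gaussians a b L' M' s
  proof
    show "causal_iso L'" "causal_iso M'"
      unfolding L'_def M'_def
      using cholesky_causal_iso[OF assms(3)] cholesky_causal_iso[OF assms(4)] causal_iso_block_diag[of V, OF V] causal_iso_block_diag[of U, OF U]
      by (auto intro: causal_iso_mult)
    show "0 \<le> s p" for p by (simp add: s_def S_nonneg)
    have "block (transpose M' ** L') t t = S t" for t
    proof -
      have "transpose M' ** L' = block_diag (\<lambda>t. transpose (U t)) ** (transpose M ** L ** block_diag V)"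
        by (simp add: L'_def M'_def matrix_transpose_mul matrix_mul_assoc transpose_block_diag)
      then have "block (transpose M' ** L') t t = transpose (U t) ** (U t ** S t ** transpose (V t) ** V t)"
        by (simp only: block_mult_block_diag svd)
      also have "\<dots> = (transpose (U t) ** U t) ** S t ** (transpose (V t) ** V t)"
        by (simp add: matrix_mul_assoc)
      also have "\<dots> = S t"
        using U[of t] V[of t] by (simp add: orthogonal_matrix matrix_mul_lid matrix_mul_rid)
      finally show ?thesis .
    qed
    then have "(transpose M' ** L') $ (t, i) $ (t, j) = S t $ i $ j" for t i j
      by (metis (no_types, lifting) block_def vec_lambda_beta)
    then show "(transpose M' ** L') $ p $ q = (if p = q then s p else 0)" if "fst p = fst q" for p q
      using that S_off by (cases p; cases q) (auto simp: s_def)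
  qed
  have laws: "\<mu> = distr std_gaussian borel (\<lambda>z. a + L' *v z)" "\<nu> = distr std_gaussian borel (\<lambda>z. b + M' *v z)"
    unfolding assms(1,2) A B by (rule gaussian_measure_eq_distr, rule inverses)+
  have base: "base = (norm (a - b))\<^sup>2 + trace (A + B)"
    by (simp add: base_def A B trace_add)
  have tr: "trace (block_diag S) = (\<Sum>p\<in>UNIV. s p)"
    by (simp add: trace_def block_diag_def s_def)
  have zero: "adapted_wasserstein_sq 0 \<mu> \<nu> = ereal ((norm (a - b))\<^sup>2 + trace (A + B) - 2 * trace (block_diag S))"
    unfolding laws adapted_wasserstein_sq_zero base tr ..
  have pos: "adapted_wasserstein_sq l \<mu> \<nu> = ereal (base - 2 * (\<Sum>p\<in>UNIV. s p * f_lambda l (s p))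
      - l / 2 * (\<Sum>p\<in>UNIV. ln (1 - (f_lambda l (s p))\<^sup>2)))" if "0 < l" for l
    unfolding laws
    by (rule adapted_wasserstein_sq_pos[OF that]) (rule f_lambda_critical[OF that s_nonneg])+
  have S_diag: "block_diag S $ p $ q = (if p = q then s p else 0)" for p q
    using S_off by (cases p; cases q) (auto simp: block_diag_def s_def)
  have D: "map_matrix (f_lambda l) (block_diag S) = (\<chi> p q. if p = q then f_lambda l (s p) else 0)" for l
    by (simp add: map_matrix_def vec_eq_iff S_diag f_lambda_def)
  have DS: "trace (map_matrix (f_lambda l) (block_diag S) ** block_diag S) = (\<Sum>p\<in>UNIV. s p * f_lambda l (s p))" for l
    unfolding D by (simp add: trace_def matrix_matrix_mult_def S_diag if_distrib[of "\<lambda>x. x * _"] mult.commute cong: if_cong)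
  have DD: "det (mat 1 - map_matrix (f_lambda l) (block_diag S) ** map_matrix (f_lambda l) (block_diag S))
      = (\<Prod>p\<in>UNIV. 1 - (f_lambda l (s p))\<^sup>2)" for l
  proof -
    have "mat 1 - map_matrix (f_lambda l) (block_diag S) ** map_matrix (f_lambda l) (block_diag S)
        = (\<chi> p q. if p = q then 1 - (f_lambda l (s p))\<^sup>2 else 0)"
      unfolding D by (simp add: vec_eq_iff mat_def matrix_matrix_mult_def if_distrib[of "\<lambda>x. x * _"] power2_eq_square cong: if_cong)
    then show ?thesis by (subst det_diagonal) auto
  qed
  have formula: "adapted_wasserstein_sq lam \<mu> \<nu> =
      ereal ((norm (a - b))\<^sup>2 + trace (A + B) - 2 * trace (map_matrix (f_lambda lam) (block_diag S) ** block_diag S)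
        - lam / 2 * ln (det (mat 1 - map_matrix (f_lambda lam) (block_diag S) ** map_matrix (f_lambda lam) (block_diag S))))"
  proof (cases "lam = 0")
    case True
    have "s p * sgn (s p) = s p" for p using s_nonneg[of p] by (simp add: sgn_if)
    then have "(\<Sum>p\<in>UNIV. s p * sgn (s p)) = (\<Sum>p\<in>UNIV. s p)" by (intro sum.cong refl)
    then show ?thesis
      unfolding True zero DS tr by (simp add: f_lambda_zero)
  next
    case False
    then have l: "0 < lam" using assms(5) by simp
    have nonzero: "1 - (f_lambda lam (s p))\<^sup>2 \<noteq> 0" for p
      using f_lambda_critical(1)[OF l s_nonneg[of p]] abs_square_less_1[of "f_lambda lam (s p)"] by linarith
    then have "ln (\<Prod>p\<in>UNIV. 1 - (f_lambda lam (s p))\<^sup>2) = (\<Sum>p\<in>UNIV. ln (1 - (f_lambda lam (s p))\<^sup>2))"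
      by (intro ln_prod[OF finite] nonzero)
    then show ?thesis
      unfolding pos[OF l] DS DD base by simp
  qed
  have lim: "((\<lambda>l. adapted_wasserstein_sq l \<mu> \<nu>) \<longlongrightarrow> adapted_wasserstein_sq 0 \<mu> \<nu>) (at_right 0)"
  proof -
    have "((\<lambda>l. base - 2 * (\<Sum>p\<in>UNIV. s p * f_lambda l (s p)) - (\<Sum>p\<in>UNIV. l * ln (1 - (f_lambda l (s p))\<^sup>2)) / 2)
        \<longlongrightarrow> base - 2 * (\<Sum>p\<in>UNIV. s p) - (\<Sum>p\<in>(UNIV :: ('t \<times> 'd) set). 0) / 2) (at_right 0)"
      by (intro tendsto_intros tendsto_f_lambda s_nonneg) simp
    then have "((\<lambda>l. ereal (base - 2 * (\<Sum>p\<in>UNIV. s p * f_lambda l (s p)) - l / 2 * (\<Sum>p\<in>UNIV. ln (1 - (f_lambda l (s p))\<^sup>2))))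
        \<longlongrightarrow> ereal (base - 2 * (\<Sum>p\<in>UNIV. s p))) (at_right 0)"
      by (simp add: sum_distrib_left sum_divide_distrib)
    moreover have "\<forall>\<^sub>F l in at_right 0. ereal (base - 2 * (\<Sum>p\<in>UNIV. s p * f_lambda l (s p)) - l / 2 * (\<Sum>p\<in>UNIV. ln (1 - (f_lambda l (s p))\<^sup>2)))
        = adapted_wasserstein_sq l \<mu> \<nu>"
      using eventually_at_right_less[of 0] by eventually_elim (simp add: pos)
    ultimately show ?thesis
      unfolding zero base[symmetric] tr by (rule Lim_transform_eventually)
  qed
  show ?thesis
    using formula zero lim f_lambda_zero by (simp add: Let_def)
qed

end
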